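(* Let $P=(p_1,\dots,p_N)$ be a polynomial map $\mathbb{C}^N\to\mathbb{C}^N$ (each $p_j\in\mathbb{C}[x_1,\dots,x_N]$), and regard $P$ as a map on the set $\mathcal{C}$ of commuting matrix $N$-tuples by evaluation. The following are equivalent: (1) For every $n$, every commuting tuple $X\in\mathcal{C}\cap\mathcal{M}_n(\mathbb{C})^N$ and every $H\in\mathcal{M}_n(\mathbb{C})^N$ such that $\begin{pmatrix}X&H\\0&X\end{pmatrix}\in\mathcal{C}$, the equality $DP(X)[H]=0$ implies $H=0$. (2) $P$ is injective on $\mathcal{C}$. (3) $P$ is a bijection of $\mathcal{C}$ onto itself. (4) $P^{-1}$ exists and is given by a (commutative) polynomial map.
   Context: $\mathcal{M}_n(\mathbb{C})$ denotes the $n\times n$ complex matrices; $\mathcal{C}=\bigcup_{n\ge1}\{(X_1,\dots,X_N)\in\mathcal{M}_n(\mathbb{C})^N: X_iX_j=X_jX_i\ \forall i,j\}$ is the set of commuting matrix $N$-tuples, which is closed under direct sums and simultaneous similarity. A commutative polynomial is evaluated on a commuting tuple by substitution (well defined since the entries commute), and $P$ maps $\mathcal{C}\cap\mathcal{M}_n(\mathbb{C})^N$ into itself. Block matrices of tuples are formed coordinatewise. The derivative is defined by $P\begin{pmatrix}X&H\\0&X\end{pmatrix}=\begin{pmatrix}P(X)&DP(X)[H]\\0&P(X)\end{pmatrix}$, i.e. $DP(X)[H]$ is the upper-right block of $P\begin{pmatrix}X&H\\0&X\end{pmatrix}$. *)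

theory Defs
  imports "Jordan_Normal_Form.Matrix" "HOL-Library.Poly_Mapping"
begin

text \<open>Commutative polynomials in the variables x_0, x_1, ... over the complex numbers:
  finitely supported maps from monomials (exponent vectors nat =>0 nat) to coefficients.\<close>
type_synonym cpoly = "(nat \<Rightarrow>\<^sub>0 nat) \<Rightarrow>\<^sub>0 complex"

definition poly_in_vars :: "nat \<Rightarrow> cpoly \<Rightarrow> bool" where
  "poly_in_vars N p \<longleftrightarrow> (\<forall>m\<in>Poly_Mapping.keys p. Poly_Mapping.keys m \<subseteq> {..<N})"

definition poly_map :: "nat \<Rightarrow> (nat \<Rightarrow> cpoly) \<Rightarrow> bool" where
  "poly_map N P \<longleftrightarrow> (\<forall>j<N. poly_in_vars N (P j))"

definition ctuple :: "nat \<Rightarrow> nat \<Rightarrow> (nat \<Rightarrow> complex mat) \<Rightarrow> bool" where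
  "ctuple N n X \<longleftrightarrow> (\<forall>i<N. X i \<in> carrier_mat n n) \<and>
                      (\<forall>i<N. \<forall>j<N. X i * X j = X j * X i)"

definition mono_eval :: "nat \<Rightarrow> nat \<Rightarrow> (nat \<Rightarrow>\<^sub>0 nat) \<Rightarrow> (nat \<Rightarrow> complex mat) \<Rightarrow> complex mat" where
  "mono_eval N n m X = foldr (\<lambda>i A. X i ^\<^sub>m Poly_Mapping.lookup m i * A) [0..<N] (1\<^sub>m n)"

definition peval :: "nat \<Rightarrow> nat \<Rightarrow> cpoly \<Rightarrow> (nat \<Rightarrow> complex mat) \<Rightarrow> complex mat" where
  "peval N n p X = mat n n (\<lambda>ij. \<Sum>m\<in>Poly_Mapping.keys p. Poly_Mapping.lookup p m * (mono_eval N n m X $$ ij))"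

definition pmap_eval :: "nat \<Rightarrow> nat \<Rightarrow> (nat \<Rightarrow> cpoly) \<Rightarrow> (nat \<Rightarrow> complex mat) \<Rightarrow> (nat \<Rightarrow> complex mat)" where
  "pmap_eval N n P X = (\<lambda>j. if j < N then peval N n (P j) X else 0\<^sub>m n n)"

definition block_tuple :: "nat \<Rightarrow> (nat \<Rightarrow> complex mat) \<Rightarrow> (nat \<Rightarrow> complex mat) \<Rightarrow> (nat \<Rightarrow> complex mat)" where
  "block_tuple n X H = (\<lambda>i. four_block_mat (X i) (H i) (0\<^sub>m n n) (X i))"

definition upper_right :: "nat \<Rightarrow> complex mat \<Rightarrow> complex mat" where
  "upper_right n M = mat n n (\<lambda>(i, j). M $$ (i, j + n))"

definition deriv_pmap :: "nat \<Rightarrow> nat \<Rightarrow> (nat \<Rightarrow> cpoly) \<Rightarrow> (nat \<Rightarrow> complex mat) \<Rightarrow> (nat \<Rightarrow> complex mat) \<Rightarrow> (nat \<Rightarrow> complex mat)" where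
  "deriv_pmap N n P X H = (\<lambda>j. upper_right n (pmap_eval N (2 * n) P (block_tuple n X H) j))"

end

theory Submission
  imports "HOL-Homology.Invariance_of_Domain" "HOL-Computational_Algebra.Fundamental_Theorem_Algebra" Defs
begin

text \<open>Everything but the polynomiality of the inverse is block matrix algebra: a block tuple with \<open>H = [Z, T]\<close>
  is similar to \<open>Z \<oplus> Z\<close>, which makes nonsingularity of the derivative equivalent to injectivity.

  For the inverse, injectivity on \<open>1 \<times> 1\<close> tuples suffices (Rudin). Let \<open>k\<close> be a countable subfield of the
  complex numbers containing the coefficients of \<open>P\<close>, and let \<open>a\<close> be a point with coordinates algebraically
  independent over \<open>k\<close>. If \<open>a i\<close> were not in \<open>k(P(a))\<close>, some field homomorphism over \<open>k(P(a))\<close> would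
  move \<open>a i\<close>, giving a second point in the fibre. Hence \<open>x i * g(P) = f(P)\<close> identically, where \<open>g\<close> is taken of
  minimal degree. If \<open>g\<close> were not constant, \<open>g \<circ> P\<close> would have a zero. The image of \<open>P\<close> is open by invariance of
  domain, so it contains a zero of \<open>g\<close> with all coordinates but one generic; there \<open>f\<close> vanishes too, and unique
  factorization over the ring generated by the generic coordinates yields a common factor of \<open>f\<close> and \<open>g\<close>,
  contradicting minimality.\<close>

section \<open>Unique factorization in subrings of a domain\<close>

text \<open>The obstacle is that \<open>P\<close> is not known to be surjective until its inverse
  has been found. The relation \<open>f(P(x)) = x i * g(P(x))\<close> turns a zero of
  \<open>g\<close> into a zero of \<open>f\<close> only inside the image of \<open>P\<close>, so
  every perturbation of a zero has to stay in that image. A zero of a nonconstant \<open>g\<close>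
  cannot have all coordinates generic; leaving one free makes divisibility a one-variable question
  over the ring generated by the others, which is a copy of a polynomial ring over \<open>k\<close>
  and therefore factorial.

  Countability takes the place of transcendence bases: only countably many numbers are algebraic
  over a countable ring, so every disc contains transcendental ones. For the same reason
  homomorphisms are extended one element at a time, and only to a countable field containing the
  finitely many coordinates in play. Genericity reduces an identity of polynomial functions over
  \<open>k\<close> to its instance at a single point.

  The left inverse so found is also a right inverse, because \<open>P(Q(y)) = y\<close> holds on the
  image of \<open>P\<close>, which contains a box.\<close>

definition is_subring :: "'a::idom set \<Rightarrow> bool" where
  "is_subring S \<longleftrightarrow> 0 \<in> S \<and> 1 \<in> S \<and> (\<forall>x\<in>S. - x \<in> S) \<and> (\<forall>x\<in>S. \<forall>y\<in>S. x + y \<in> S \<and> x * y \<in> S)"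

lemma is_subringD:
  assumes "is_subring S"
  shows "0 \<in> S" "1 \<in> S" "x \<in> S \<Longrightarrow> - x \<in> S" "x \<in> S \<Longrightarrow> y \<in> S \<Longrightarrow> x + y \<in> S"
    "x \<in> S \<Longrightarrow> y \<in> S \<Longrightarrow> x * y \<in> S" "x \<in> S \<Longrightarrow> y \<in> S \<Longrightarrow> x - y \<in> S"
proof -
  show *: "0 \<in> S" "1 \<in> S" "x \<in> S \<Longrightarrow> - x \<in> S" "x \<in> S \<Longrightarrow> y \<in> S \<Longrightarrow> x + y \<in> S"
    "x \<in> S \<Longrightarrow> y \<in> S \<Longrightarrow> x * y \<in> S" for x y
    using assms unfolding is_subring_def by blast+
  show "x - y \<in> S" if "x \<in> S" "y \<in> S"
    using *(4)[OF that(1) *(3)[OF that(2)]] by simp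
qed

lemma is_subring_sum: "is_subring S \<Longrightarrow> (\<And>i. i \<in> I \<Longrightarrow> f i \<in> S) \<Longrightarrow> sum f I \<in> S"
  by (induction I rule: infinite_finite_induct) (simp_all add: is_subringD(1,4))

lemma is_subring_power: "is_subring S \<Longrightarrow> x \<in> S \<Longrightarrow> x ^ n \<in> S"
  by (induction n) (simp_all add: is_subringD(2,5))

definition polys_in :: "'a::idom set \<Rightarrow> 'a poly set" where
  "polys_in R = {u. \<forall>i. coeff u i \<in> R}"

lemma polys_inD: "u \<in> polys_in R \<Longrightarrow> coeff u i \<in> R"
  by (simp add: polys_in_def)

lemma is_subring_polys_in:
  assumes "is_subring R" shows "is_subring (polys_in R)"
proof -
  note R = is_subringD[OF assms]
  have "coeff 1 i \<in> R" for i
    using R(1,2) by (simp add: coeff_1)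
  moreover have "coeff (u * v) i \<in> R" if "\<forall>i. coeff u i \<in> R" "\<forall>i. coeff v i \<in> R" for u v i
    unfolding coeff_mult using that by (intro is_subring_sum[OF assms] R(5)) auto
  ultimately show ?thesis
    unfolding is_subring_def polys_in_def using R(1,3,4) by simp
qed

lemma monom_in_polys_in: "is_subring R \<Longrightarrow> c \<in> R \<Longrightarrow> monom c n \<in> polys_in R"
  by (simp add: polys_in_def is_subringD(1))

lemma const_in_polys_in: "is_subring R \<Longrightarrow> c \<in> R \<Longrightarrow> [:c:] \<in> polys_in R"
  using monom_in_polys_in[of R c 0] by (simp add: monom_0)

lemma smult_in_polys_in: "is_subring R \<Longrightarrow> c \<in> R \<Longrightarrow> u \<in> polys_in R \<Longrightarrow> smult c u \<in> polys_in R"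
  by (simp add: polys_in_def is_subringD(5))

text \<open>The leading coefficient of \<open>m\<close> need not be invertible in \<open>R\<close>.
  Multiplying by it once per reduction step keeps quotient and remainder over
  \<open>R\<close>.\<close>

lemma pseudo_division_in:
  assumes R: "is_subring R" and m: "m \<in> polys_in R" "m \<noteq> 0"
  shows "u \<in> polys_in R \<Longrightarrow> \<exists>j. \<exists>q\<in>polys_in R. \<exists>r\<in>polys_in R.
    smult (lead_coeff m ^ j) u = q * m + r \<and> (r = 0 \<or> degree r < degree m)"
proof (induction "degree u" arbitrary: u rule: less_induct)
  case less
  note P = is_subringD[OF is_subring_polys_in[OF R]]
  show ?case
  proof (cases "u = 0 \<or> degree u < degree m")
    case True
    then show ?thesis using less.prems P by (intro exI[of _ 0] bexI[of _ 0] bexI[of _ u]) auto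
  next
    case False
    define s where "s = monom (lead_coeff u) (degree u - degree m)"
    define v where "v = smult (lead_coeff m) u - s * m"
    have s: "s \<in> polys_in R" unfolding s_def using R less.prems by (auto intro!: monom_in_polys_in polys_inD)
    have v: "v \<in> polys_in R" unfolding v_def
      by (intro P(6) P(5) smult_in_polys_in R less.prems s m polys_inD[OF m(1)])
    have du: "degree u \<ge> degree m" using False by auto
    have degs: "degree (s * m) = degree u"
      using False m du by (subst degree_mult_eq) (auto simp: s_def degree_monom_eq)
    have "coeff v (degree u) = 0"
    proof -
      have "lead_coeff (s * m) = lead_coeff u * lead_coeff m"
        by (simp only: lead_coeff_mult) (use False in \<open>simp add: s_def degree_monom_eq\<close>)
      then show ?thesis using degs by (simp add: v_def)
    qed
    moreover have "degree v \<le> degree u"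
      unfolding v_def using degs by (intro degree_diff_le) auto
    ultimately have "v = 0 \<or> degree v < degree u"
      by (metis eq_zero_or_degree_less)
    then show ?thesis
    proof
      assume "v = 0"
      then show ?thesis using P s
        by (intro exI[of _ 1] bexI[of _ s] bexI[of _ 0]) (auto simp: v_def)
    next
      assume "degree v < degree u"
      from less.hyps[OF this v] obtain j q r where
        jqr: "q \<in> polys_in R" "r \<in> polys_in R" "smult (lead_coeff m ^ j) v = q * m + r"
          "r = 0 \<or> degree r < degree m" by blast
      have "smult (lead_coeff m ^ Suc j) u = smult (lead_coeff m ^ j) v + smult (lead_coeff m ^ j) s * m"
        by (simp add: v_def smult_diff_right mult.commute)
      also have "\<dots> = (q + smult (lead_coeff m ^ j) s) * m + r"
        by (simp add: jqr(3) distrib_right)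
      finally show ?thesis using jqr(1,2,4)
        P(4)[OF jqr(1) smult_in_polys_in[OF R is_subring_power[OF R polys_inD[OF m(1)]] s]] by blast
    qed
  qed
qed

section \<open>Prime factorization relative to a subring\<close>

definition dvd_in :: "'a::idom set \<Rightarrow> 'a \<Rightarrow> 'a \<Rightarrow> bool" where
  "dvd_in S x y \<longleftrightarrow> (\<exists>z\<in>S. y = x * z)"

definition prime_in :: "'a::idom set \<Rightarrow> 'a \<Rightarrow> bool" where
  "prime_in S p \<longleftrightarrow> p \<in> S \<and> p \<noteq> 0 \<and> \<not> dvd_in S p 1 \<and>
     (\<forall>x\<in>S. \<forall>y\<in>S. dvd_in S p (x * y) \<longrightarrow> dvd_in S p x \<or> dvd_in S p y)"

text \<open>The number counts prime factors with multiplicity, up to a unit. It serves as a measure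
  when a leading coefficient with as few primes as possible is chosen.\<close>

inductive factors_in :: "'a::idom set \<Rightarrow> 'a \<Rightarrow> nat \<Rightarrow> bool" for S where
  unit: "x \<in> S \<Longrightarrow> dvd_in S x 1 \<Longrightarrow> factors_in S x 0"
| prime_mult: "prime_in S p \<Longrightarrow> factors_in S x n \<Longrightarrow> factors_in S (p * x) (Suc n)"

text \<open>The factors are primes rather than irreducibles, so the existence of a factorization
  already forces its uniqueness.\<close>

definition factorial_in :: "'a::idom set \<Rightarrow> bool" where
  "factorial_in S \<longleftrightarrow> is_subring S \<and> (\<forall>x\<in>S. x \<noteq> 0 \<longrightarrow> (\<exists>n. factors_in S x n))"

lemma factors_in_mem: "factors_in S x n \<Longrightarrow> is_subring S \<Longrightarrow> x \<in> S"
  by (induction rule: factors_in.induct) (auto simp: is_subringD prime_in_def)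

lemma dvd_in_trans: "is_subring S \<Longrightarrow> dvd_in S x y \<Longrightarrow> dvd_in S y z \<Longrightarrow> dvd_in S x z"
  unfolding dvd_in_def using is_subringD(5) by (fastforce simp: mult.assoc)

lemma factors_in_unit_mult:
  assumes "factors_in S x n" "is_subring S" "v \<in> S" "dvd_in S v 1"
  shows "factors_in S (v * x) n"
  using assms(1)
proof (induction rule: factors_in.induct)
  case (unit x)
  then obtain a b where "a \<in> S" "b \<in> S" "1 = x * a" "1 = v * b" using assms unfolding dvd_in_def by blast
  then have "1 = (v * x) * (a * b)" by (metis mult.assoc mult.commute mult_1)
  then show ?case using unit assms \<open>a \<in> S\<close> \<open>b \<in> S\<close>
    by (intro factors_in.unit) (auto simp: dvd_in_def is_subringD)
next
  case (prime_mult p x n)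
  then show ?case using factors_in.prime_mult[of S p "v * x" n] by (simp add: mult.left_commute)
qed

text \<open>For a product \<open>q * x\<close> with \<open>q\<close> prime, either \<open>p\<close>
  divides \<open>q\<close>, and the two differ by a unit that the remaining factors absorb, or
  \<open>p\<close> divides \<open>x\<close> and induction applies.\<close>

lemma factors_in_prime_dvd:
  assumes S: "is_subring S" and p: "prime_in S p"
  shows "factors_in S x n \<Longrightarrow> dvd_in S p x \<Longrightarrow> \<exists>z n'. x = p * z \<and> n = Suc n' \<and> factors_in S z n'"
proof (induction rule: factors_in.induct)
  case (unit x)
  then show ?case using p dvd_in_trans[OF S] unfolding prime_in_def by blast
next
  case (prime_mult q x n)
  have xS: "x \<in> S" "q \<in> S" using prime_mult.hyps factors_in_mem[OF _ S] by (auto simp: prime_in_def)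
  then consider "dvd_in S p q" | "dvd_in S p x"
    using prime_mult.prems p unfolding prime_in_def by blast
  then show ?case
  proof cases
    case 1
    then obtain w where w: "w \<in> S" "q = p * w" unfolding dvd_in_def by blast
    have "dvd_in S q (p * w)" using w S is_subringD(2) unfolding dvd_in_def by (metis mult_1_right)
    moreover have "p \<in> S" using p prime_in_def by auto
    ultimately consider "dvd_in S q p" | "dvd_in S q w"
      using prime_mult.hyps(1) w unfolding prime_in_def by blast
    \<comment> \<open>If \<open>q\<close> divides \<open>p\<close>, then \<open>w\<close> and the
      cofactor are mutually inverse; if \<open>q\<close> divides \<open>w\<close>, then
      \<open>p\<close> would be a unit.\<close>
    then have "dvd_in S w 1"
    proof cases
      case 1
      then obtain v where "v \<in> S" "p = q * v" unfolding dvd_in_def by blast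
      then have "p * 1 = p * (w * v)" using w by (simp add: mult.assoc)
      then have "1 = w * v" using p unfolding prime_in_def by (metis mult_left_cancel)
      then show ?thesis using \<open>v \<in> S\<close> dvd_in_def by blast
    next
      case 2
      then obtain v where v: "v \<in> S" "w = q * v" unfolding dvd_in_def by blast
      then have "w * 1 = w * (p * v)" using w by (simp add: mult_ac)
      moreover have "w \<noteq> 0" using w prime_mult.hyps(1) unfolding prime_in_def by auto
      ultimately have "1 = p * v" by (metis mult_left_cancel)
      then show ?thesis using v p unfolding prime_in_def dvd_in_def by blast
    qed
    then show ?thesis
      using factors_in_unit_mult[OF prime_mult.hyps(2) S w(1)] w(2) by (metis mult.assoc)
  next
    case 2
    then obtain z n' where z: "x = p * z" "n = Suc n'" "factors_in S z n'" using prime_mult.IH by blast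
    then have "factors_in S (q * z) n" using prime_mult.hyps(1) factors_in.prime_mult by auto
    then show ?thesis using z by (metis mult.left_commute)
  qed
qed

lemma dvd_in_const_iff:
  assumes "is_subring R"
  shows "dvd_in (polys_in R) [:c:] u \<longleftrightarrow> (\<forall>i. dvd_in R c (coeff u i))"
proof
  assume "dvd_in (polys_in R) [:c:] u"
  then show "\<forall>i. dvd_in R c (coeff u i)" by (auto simp: dvd_in_def polys_in_def)
next
  assume "\<forall>i. dvd_in R c (coeff u i)"
  then obtain f where f: "\<And>i. f i \<in> R" "\<And>i. coeff u i = c * f i" unfolding dvd_in_def by metis
  show "dvd_in (polys_in R) [:c:] u"
  proof (cases "c = 0")
    case True
    then have "u = [:c:] * 0" using f by (auto simp: poly_eq_iff)
    then show ?thesis unfolding dvd_in_def using is_subringD(1)[OF is_subring_polys_in[OF assms]] by blast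
  next
    case False
    have "\<forall>\<^sub>\<infinity>i. coeff u i = 0" by (rule MOST_coeff_eq_0)
    then have "\<forall>\<^sub>\<infinity>i. f i = 0" by (rule MOST_mono) (use f False in auto)
    then have "coeff (Abs_poly f) i = f i" for i by (simp add: Abs_poly_inverse)
    then have "Abs_poly f \<in> polys_in R" "u = [:c:] * Abs_poly f"
      using f by (auto simp: polys_in_def poly_eq_iff)
    then show ?thesis unfolding dvd_in_def by blast
  qed
qed

lemma dvd_in_sum:
  assumes "is_subring R" "\<And>i. i \<in> I \<Longrightarrow> dvd_in R c (f i)"
  shows "dvd_in R c (sum f I)"
  using assms(2)
proof (induction I rule: infinite_finite_induct)
  case (insert x F)
  then obtain a b where "a \<in> R" "b \<in> R" "f x = c * a" "sum f F = c * b"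
    unfolding dvd_in_def by (metis insertI1 insertI2)
  then have "sum f (insert x F) = c * (a + b)" using insert by (simp add: distrib_left)
  then show ?case using \<open>a \<in> R\<close> \<open>b \<in> R\<close> assms(1) is_subringD(4) unfolding dvd_in_def by blast
qed (use is_subringD(1)[OF assms(1)] in \<open>force simp: dvd_in_def\<close>)+

lemma dvd_in_mult: "is_subring R \<Longrightarrow> dvd_in R c x \<Longrightarrow> y \<in> R \<Longrightarrow> dvd_in R c (x * y)"
  unfolding dvd_in_def using is_subringD(5) by (fastforce simp: mult.assoc)

text \<open>Gauss's argument: if \<open>p\<close> divides neither polynomial, take the lowest
  positions \<open>i\<close> and \<open>j\<close> of coefficients not divisible by \<open>p\<close>.
  In coefficient \<open>i + j\<close> of the product all other terms are divisible by
  \<open>p\<close>, so \<open>p\<close> would divide the product of these two coefficients.\<close>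

lemma prime_in_polys_in:
  assumes R: "is_subring R" and p: "prime_in R p"
  shows "prime_in (polys_in R) [:p:]"
proof -
  note d = dvd_in_const_iff[OF R]
  have "dvd_in (polys_in R) [:p:] u \<or> dvd_in (polys_in R) [:p:] v"
    if u: "u \<in> polys_in R" and v: "v \<in> polys_in R" and uv: "dvd_in (polys_in R) [:p:] (u * v)" for u v
  proof (rule ccontr)
    assume "\<not> ?thesis"
    then obtain i0 j0 where "\<not> dvd_in R p (coeff u i0)" "\<not> dvd_in R p (coeff v j0)" unfolding d by blast
    define i where "i = (LEAST i. \<not> dvd_in R p (coeff u i))"
    define j where "j = (LEAST i. \<not> dvd_in R p (coeff v i))"
    have i: "\<not> dvd_in R p (coeff u i)" "\<And>l. l < i \<Longrightarrow> dvd_in R p (coeff u l)"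
      unfolding i_def by (rule LeastI[of "\<lambda>i. \<not> dvd_in R p (coeff u i)" i0], fact) (use not_less_Least in blast)
    have j: "\<not> dvd_in R p (coeff v j)" "\<And>l. l < j \<Longrightarrow> dvd_in R p (coeff v l)"
      unfolding j_def by (rule LeastI[of "\<lambda>i. \<not> dvd_in R p (coeff v i)" j0], fact) (use not_less_Least in blast)
    have "coeff (u * v) (i + j) = coeff u i * coeff v j + (\<Sum>l\<in>{..i + j} - {i}. coeff u l * coeff v (i + j - l))"
      by (subst coeff_mult, subst sum.remove[of _ i]) auto
    moreover have "dvd_in R p (\<Sum>l\<in>{..i + j} - {i}. coeff u l * coeff v (i + j - l))"
    proof (rule dvd_in_sum[OF R])
      fix l assume l: "l \<in> {..i + j} - {i}"
      show "dvd_in R p (coeff u l * coeff v (i + j - l))"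
      proof (cases "l < i")
        case True
        then show ?thesis using i(2) dvd_in_mult[OF R] v polys_inD by blast
      next
        case False
        then have "i + j - l < j" using l by auto
        then have "dvd_in R p (coeff v (i + j - l) * coeff u l)"
          using j(2) dvd_in_mult[OF R] u polys_inD by blast
        then show ?thesis by (simp add: mult.commute)
      qed
    qed
    moreover have "dvd_in R p (coeff (u * v) (i + j))" using uv d by blast
    ultimately have "dvd_in R p (coeff u i * coeff v j)"
      unfolding dvd_in_def by (metis is_subringD(6)[OF R] add_diff_cancel_right' right_diff_distrib)
    then show False using i(1) j(1) p u v polys_inD unfolding prime_in_def by blast
  qed
  moreover have "\<not> dvd_in (polys_in R) [:p:] 1"
    using p d[of p 1] unfolding prime_in_def by (metis coeff_pCons_0 one_pCons)
  ultimately show ?thesis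
    using p const_in_polys_in[OF R] unfolding prime_in_def by auto
qed

text \<open>The constant \<open>c\<close> is cancelled prime by prime. Each prime divides
  \<open>m * q\<close> but not the primitive \<open>m\<close>; being prime among polynomials as
  well, it divides \<open>q\<close> and can be removed from both sides.\<close>

lemma gauss_cancel_const:
  assumes R: "is_subring R" and m: "m \<in> polys_in R"
    and prim: "\<And>p. prime_in R p \<Longrightarrow> \<not> dvd_in (polys_in R) [:p:] m"
  shows "factors_in R c n \<Longrightarrow> u \<in> polys_in R \<Longrightarrow> q \<in> polys_in R \<Longrightarrow> smult c u = m * q
    \<Longrightarrow> dvd_in (polys_in R) m u"
proof (induction arbitrary: q rule: factors_in.induct)
  case (unit c)
  then obtain d where d: "d \<in> R" "1 = c * d" unfolding dvd_in_def by blast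
  have "u = smult (d * c) u" using d by (simp add: mult.commute)
  also have "\<dots> = m * smult d q" using unit by (metis smult_smult mult_smult_right)
  finally show ?case using d unit R smult_in_polys_in unfolding dvd_in_def by blast
next
  case (prime_mult p c n)
  have pp: "prime_in (polys_in R) [:p:]" using prime_in_polys_in[OF R] prime_mult by auto
  have "c \<in> R" using factors_in_mem[OF prime_mult.hyps(2) R] .
  then have "dvd_in (polys_in R) [:p:] (m * q)"
    unfolding dvd_in_def using smult_in_polys_in[OF R \<open>c \<in> R\<close> prime_mult.prems(1)] prime_mult.prems(3)
    by (intro bexI[of _ "smult c u"]) (simp_all add: prime_mult.prems(3)[symmetric] mult.commute)
  then have "dvd_in (polys_in R) [:p:] q" using pp prim[OF prime_mult.hyps(1)] m prime_mult.prems
    unfolding prime_in_def by blast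
  then obtain q' where q': "q' \<in> polys_in R" "q = smult p q'" unfolding dvd_in_def by auto
  have "smult p (smult c u) = smult p (m * q')" using prime_mult.prems q' by simp
  moreover have "p \<noteq> 0" using prime_mult.hyps(1) unfolding prime_in_def by blast
  ultimately have "smult c u = m * q'" by (metis smult_cancel)
  then show ?case using prime_mult.IH prime_mult.prems q' by blast
qed

text \<open>The generator has least degree and, among those, a leading coefficient with fewest prime
  factors. The second choice makes it primitive, since a common prime of its coefficients could be
  divided out. Pseudo-division then has remainder 0, and \<open>gauss_cancel_const\<close> removes
  the power of the leading coefficient.\<close>

lemma vanishing_ideal_principal:
  assumes R: "factorial_in R" and ex: "u0 \<in> polys_in R" "u0 \<noteq> 0" "poly u0 \<tau> = 0"
  shows "\<exists>m\<in>polys_in R. m \<noteq> 0 \<and> poly m \<tau> = 0 \<and>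
    (\<forall>u\<in>polys_in R. poly u \<tau> = 0 \<longrightarrow> dvd_in (polys_in R) m u)"
proof -
  have S: "is_subring R" using R factorial_in_def by blast
  let ?A = "\<lambda>m. m \<in> polys_in R \<and> m \<noteq> 0 \<and> poly m \<tau> = 0"
  define d where "d = (LEAST d. \<exists>m. ?A m \<and> degree m = d)"
  have d: "\<exists>m. ?A m \<and> degree m = d" unfolding d_def by (rule LeastI[of _ "degree u0"]) (use ex in auto)
  have dmin: "degree m \<ge> d" if "?A m" for m unfolding d_def by (rule Least_le) (use that in auto)
  let ?B = "\<lambda>m n. ?A m \<and> degree m = d \<and> factors_in R (lead_coeff m) n"
  define n where "n = (LEAST n. \<exists>m. ?B m n)"
  obtain m0 where "?A m0" "degree m0 = d" using d by blast
  moreover obtain n0 where "factors_in R (lead_coeff m0) n0"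
    using R \<open>?A m0\<close> polys_inD unfolding factorial_in_def by (metis leading_coeff_0_iff)
  ultimately have "\<exists>m. ?B m n" unfolding n_def
    using \<open>degree m0 = d\<close> by (intro LeastI[of "\<lambda>n. \<exists>m. ?B m n" n0] exI[of _ m0]) simp
  then obtain m where m: "?B m n" by blast
  have nmin: "n' \<ge> n" if "?B m n'" for m n' unfolding n_def by (rule Least_le) (use that in blast)
  have prim: "\<not> dvd_in (polys_in R) [:p:] m" if p: "prime_in R p" for p
  proof
    assume a: "dvd_in (polys_in R) [:p:] m"
    then obtain m' where m': "m' \<in> polys_in R" "m = smult p m'" unfolding dvd_in_def by auto
    have p0: "p \<noteq> 0" using p unfolding prime_in_def by blast
    have "dvd_in R p (lead_coeff m)" using a dvd_in_const_iff[OF S] by blast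
    then obtain z n' where z: "lead_coeff m = p * z" "n = Suc n'" "factors_in R z n'"
      using factors_in_prime_dvd[OF S p] m by blast
    have "lead_coeff m = p * lead_coeff m'" using m' by simp
    then have "lead_coeff m' = z" using z p0 by simp
    then have "?B m' n'" using m m' z p0 by auto
    then show False using nmin z by fastforce
  qed
  have "dvd_in (polys_in R) m u" if u: "u \<in> polys_in R" "poly u \<tau> = 0" for u
  proof -
    obtain j q r where jqr: "q \<in> polys_in R" "r \<in> polys_in R"
      "smult (lead_coeff m ^ j) u = q * m + r" "r = 0 \<or> degree r < degree m"
      using pseudo_division_in[OF S, of m u] m u by blast
    have "poly (smult (lead_coeff m ^ j) u) \<tau> = 0" using u by simp
    then have "poly r \<tau> = 0" using m unfolding jqr(3) by simp
    then have "r = 0" using jqr m dmin by (metis leD)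
    moreover obtain n1 where "factors_in R (lead_coeff m ^ j) n1"
      using R m is_subring_power[OF S] polys_inD unfolding factorial_in_def
      by (metis leading_coeff_0_iff power_not_zero)
    ultimately show ?thesis using gauss_cancel_const[OF S _ prim] m jqr u
      by (metis add.right_neutral mult.commute)
  qed
  then show ?thesis using m by blast
qed

text \<open>Instead of passing to the fraction field, a prime factor is produced from a complex
  root: the generator of the polynomials vanishing at that root is prime, because evaluation maps
  into a domain. Splitting it off lowers the degree.\<close>

lemma factorial_in_polys_in:
  fixes R :: "complex set"
  assumes R: "factorial_in R" shows "factorial_in (polys_in R)"
proof -
  have S: "is_subring R" using R factorial_in_def by blast
  note SP = is_subring_polys_in[OF S]
  have "\<exists>n. factors_in (polys_in R) u n" if "u \<in> polys_in R" "u \<noteq> 0" for u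
    using that
  proof (induction "degree u" arbitrary: u rule: less_induct)
    case less
    show ?case
    proof (cases "degree u = 0")
      case True
      then obtain c where c: "u = [:c:]" by (metis degree_eq_zeroE)
      have "factors_in (polys_in R) [:x:] n" if "factors_in R x n" for x n using that
      proof (induction rule: factors_in.induct)
        case (unit x)
        then show ?case
          using const_in_polys_in[OF S]
          by (intro factors_in.unit) (fastforce simp: dvd_in_def one_pCons intro: bexI[of _ "[:_:]"])+
      next
        case (prime_mult p x n)
        then show ?case using factors_in.prime_mult[OF prime_in_polys_in[OF S]] by fastforce
      qed
      moreover have "c \<in> R" "c \<noteq> 0" using less.prems c polys_inD[of u R 0] by auto
      ultimately show ?thesis using R c unfolding factorial_in_def by blast
    next
      case False
      then obtain \<tau> where \<tau>: "poly u \<tau> = 0"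
        using fundamental_theorem_of_algebra[of u] by (metis constant_degree)
      obtain m where m: "m \<in> polys_in R" "m \<noteq> 0" "poly m \<tau> = 0"
        "\<And>u. u \<in> polys_in R \<Longrightarrow> poly u \<tau> = 0 \<Longrightarrow> dvd_in (polys_in R) m u"
        using vanishing_ideal_principal[OF R less.prems \<tau>] by blast
      have "\<not> dvd_in (polys_in R) m 1" using m(3) by (auto simp: dvd_in_def) (metis mult_eq_0_iff poly_1 poly_mult zero_neq_one)
      moreover have "dvd_in (polys_in R) m x \<or> dvd_in (polys_in R) m y"
        if "x \<in> polys_in R" "y \<in> polys_in R" "dvd_in (polys_in R) m (x * y)" for x y
      proof -
        have "poly (x * y) \<tau> = 0" using that m(3) unfolding dvd_in_def by (metis mult_zero_left poly_mult)
        then have "poly x \<tau> = 0 \<or> poly y \<tau> = 0" by simp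
        then show ?thesis using m(4) that by blast
      qed
      ultimately have pm: "prime_in (polys_in R) m" using m unfolding prime_in_def by blast
      obtain v where v: "v \<in> polys_in R" "u = m * v" using m(4) less.prems \<tau> unfolding dvd_in_def by blast
      have "degree m \<noteq> 0" using m(2,3) by (metis degree_eq_zeroE mult_eq_0_iff poly_const_conv pCons_eq_0_iff)
      then have "degree v < degree u" using v less.prems by (auto simp: degree_mult_eq)
      then show ?thesis using less.hyps[of v] v less.prems factors_in.prime_mult[OF pm] by auto
    qed
  qed
  then show ?thesis using SP unfolding factorial_in_def by blast
qed

text \<open>Meant for evaluation at a number transcendental over the coefficients, which embeds a
  polynomial ring into the complex numbers.\<close>

lemma factorial_in_image:
  assumes R: "factorial_in R" and inj: "\<And>x. x \<in> R \<Longrightarrow> h x = 0 \<Longrightarrow> x = 0"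
    and h: "\<And>x y. x \<in> R \<Longrightarrow> y \<in> R \<Longrightarrow> h (x + y) = h x + h y"
      "\<And>x y. x \<in> R \<Longrightarrow> y \<in> R \<Longrightarrow> h (x * y) = h x * h y" "h 1 = 1"
  shows "factorial_in (h ` R)"
proof -
  have S: "is_subring R" using R factorial_in_def by blast
  have "h 0 + h 0 = h 0 + 0" using h(1)[of 0 0] is_subringD(1)[OF S] by simp
  then have h0: "h 0 = 0" by (rule add_left_imp_eq)
  have hm: "h (- x) = - h x" if "x \<in> R" for x
    using h(1)[of x "- x"] that is_subringD(3)[OF S] h0 by (simp add: eq_neg_iff_add_eq_0 add.commute)
  have S': "is_subring (h ` R)"
    unfolding is_subring_def
  proof (safe)
    show "0 \<in> h ` R" using imageI[OF is_subringD(1)[OF S], of h] h0 by simp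
    show "1 \<in> h ` R" using imageI[OF is_subringD(2)[OF S], of h] h(3) by simp
    fix x y assume "x \<in> R" "y \<in> R"
    then show "h x + h y \<in> h ` R" "h x * h y \<in> h ` R" "- h x \<in> h ` R"
      using h(1)[of x y] h(2)[of x y] hm[of x]
        imageI[OF is_subringD(3)[OF S], of x h] imageI[OF is_subringD(4)[OF S], of x y h]
        imageI[OF is_subringD(5)[OF S], of x y h] by simp_all
  qed
  have inj': "x = y" if "x \<in> R" "y \<in> R" "h x = h y" for x y
  proof -
    have "h (x + - y) = h x + - h y" using h(1)[of x "- y"] hm[of y] that is_subringD(3)[OF S] by simp
    then have "h (x + - y) = 0" using that by simp
    then show ?thesis using inj[of "x + - y"] that is_subringD[OF S] by auto
  qed
  have dv: "dvd_in (h ` R) (h x) (h y) \<longleftrightarrow> dvd_in R x y" if "x \<in> R" "y \<in> R" for x y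
    unfolding dvd_in_def
  proof
    assume "\<exists>z\<in>h ` R. h y = h x * z"
    then obtain z where z: "z \<in> R" "h y = h x * h z" by auto
    then have "h y = h (x * z)" using that(1) h(2) by simp
    then show "\<exists>z\<in>R. y = x * z" using inj' that z(1) is_subringD(5)[OF S] by blast
  next
    assume "\<exists>z\<in>R. y = x * z"
    then show "\<exists>z\<in>h ` R. h y = h x * z" using that h(2) by blast
  qed
  have pr: "prime_in (h ` R) (h p)" if p: "prime_in R p" for p
  proof -
    have pR: "p \<in> R" "p \<noteq> 0" "\<not> dvd_in R p 1" using p unfolding prime_in_def by blast+
    have "\<not> dvd_in (h ` R) (h p) 1"
      using dv[OF pR(1) is_subringD(2)[OF S]] pR(3) by (simp add: h(3))
    moreover have "h p \<noteq> 0" using inj pR by blast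
    moreover have "dvd_in (h ` R) (h p) (h x) \<or> dvd_in (h ` R) (h p) (h y)"
      if xy: "x \<in> R" "y \<in> R" "dvd_in (h ` R) (h p) (h x * h y)" for x y
    proof -
      have "dvd_in R p (x * y)"
        using xy(3) dv[OF pR(1) is_subringD(5)[OF S xy(1,2)]] by (simp add: h(2)[OF xy(1,2)])
      then show ?thesis using p xy dv[OF pR(1)] unfolding prime_in_def by blast
    qed
    ultimately show ?thesis unfolding prime_in_def using pR by blast
  qed
  have "factors_in (h ` R) (h x) n" if "factors_in R x n" for x n using that
  proof (induction rule: factors_in.induct)
    case (unit x)
    then show ?case using dv[of x 1] h(3) is_subringD(2)[OF S] by (intro factors_in.unit) simp_all
  next
    case (prime_mult p x n)
    moreover have "h (p * x) = h p * h x"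
      using h(2) prime_mult factors_in_mem[OF _ S] unfolding prime_in_def by blast
    ultimately show ?case using factors_in.prime_mult[OF pr] by simp
  qed
  moreover have "\<exists>n. factors_in R x n" if "x \<in> R" "h x \<noteq> 0" for x
    using R h0 that unfolding factorial_in_def by metis
  ultimately show ?thesis using S' unfolding factorial_in_def by blast
qed

section \<open>Extending homomorphisms between countable subfields\<close>

definition algebraic_over :: "complex set \<Rightarrow> complex \<Rightarrow> bool" where
  "algebraic_over R z \<longleftrightarrow> (\<exists>u\<in>polys_in R. u \<noteq> 0 \<and> poly u z = 0)"

lemma countable_polys_in:
  assumes "countable R" shows "countable (polys_in R)"
proof -
  have "polys_in R \<subseteq> Poly ` lists R"
  proof
    fix u assume "u \<in> polys_in R"
    then have "set (coeffs u) \<subseteq> R" by (auto simp: coeffs_def polys_inD split: if_splits)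
    then have "coeffs u \<in> lists R" by auto
    then show "u \<in> Poly ` lists R" by (metis Poly_coeffs imageI)
  qed
  then show ?thesis using assms by (meson countable_image countable_lists countable_subset)
qed

lemma countable_algebraic_over:
  assumes "countable R" shows "countable {z. algebraic_over R z}"
proof -
  have "{z. algebraic_over R z} \<subseteq> (\<Union>u\<in>polys_in R - {0}. {z. poly u z = 0})"
    by (auto simp: algebraic_over_def)
  moreover have "countable \<dots>"
    using countable_polys_in[OF assms] poly_roots_finite
    by (intro countable_UN countable_Diff) (auto intro: countable_finite)
  ultimately show ?thesis by (rule countable_subset)
qed

text \<open>By the convention \<open>inverse 0 = 0\<close>, closure under inverses can be asked of
  every element.\<close>

definition is_subfield :: "complex set \<Rightarrow> bool" where
  "is_subfield F \<longleftrightarrow> is_subring F \<and> (\<forall>x\<in>F. inverse x \<in> F)"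

lemma is_subfieldD:
  assumes "is_subfield F"
  shows "is_subring F" "0 \<in> F" "1 \<in> F" "x \<in> F \<Longrightarrow> - x \<in> F" "x \<in> F \<Longrightarrow> y \<in> F \<Longrightarrow> x + y \<in> F"
    "x \<in> F \<Longrightarrow> y \<in> F \<Longrightarrow> x * y \<in> F" "x \<in> F \<Longrightarrow> y \<in> F \<Longrightarrow> x - y \<in> F"
    "x \<in> F \<Longrightarrow> inverse x \<in> F" "x \<in> F \<Longrightarrow> y \<in> F \<Longrightarrow> x / y \<in> F"
proof -
  show *: "is_subring F" "x \<in> F \<Longrightarrow> inverse x \<in> F" for x using assms unfolding is_subfield_def by blast+
  note R = is_subringD[OF *(1)]
  show "0 \<in> F" "1 \<in> F" "x \<in> F \<Longrightarrow> - x \<in> F" "x \<in> F \<Longrightarrow> y \<in> F \<Longrightarrow> x + y \<in> F"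
    "x \<in> F \<Longrightarrow> y \<in> F \<Longrightarrow> x * y \<in> F" "x \<in> F \<Longrightarrow> y \<in> F \<Longrightarrow> x - y \<in> F" by (fact R)+
  show "x / y \<in> F" if "x \<in> F" "y \<in> F" using R(5)[OF that(1) *(2)[OF that(2)]] by (simp add: divide_inverse)
qed

lemma of_nat_in_subring: "is_subring R \<Longrightarrow> of_nat n \<in> R"
  by (induction n) (simp_all add: is_subringD(1,2,4))

text \<open>The function is total but constrained on \<open>F\<close> only; apart from the value at
  1, nothing is said outside \<open>F\<close>.\<close>

definition is_field_hom :: "complex set \<Rightarrow> (complex \<Rightarrow> complex) \<Rightarrow> bool" where
  "is_field_hom F \<phi> \<longleftrightarrow> \<phi> 1 = 1 \<and> (\<forall>x\<in>F. \<forall>y\<in>F. \<phi> (x + y) = \<phi> x + \<phi> y \<and> \<phi> (x * y) = \<phi> x * \<phi> y)"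

context
  fixes F \<phi>
  assumes F: "is_subfield F" and \<phi>: "is_field_hom F \<phi>"
begin

private lemma FD: "is_subring F" "0 \<in> F" "1 \<in> F" "x \<in> F \<Longrightarrow> - x \<in> F" "x \<in> F \<Longrightarrow> inverse x \<in> F"
  by (rule is_subfieldD[OF F]; assumption)+

private lemma hom_add: "x \<in> F \<Longrightarrow> y \<in> F \<Longrightarrow> \<phi> (x + y) = \<phi> x + \<phi> y"
  and hom_mult: "x \<in> F \<Longrightarrow> y \<in> F \<Longrightarrow> \<phi> (x * y) = \<phi> x * \<phi> y"
  and hom_1: "\<phi> 1 = 1"
  using \<phi> unfolding is_field_hom_def by blast+

private lemma hom_0: "\<phi> 0 = 0"
  using hom_add[of 0 0] FD(2) by simp

private lemma hom_minus: "x \<in> F \<Longrightarrow> \<phi> (- x) = - \<phi> x"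
  using hom_add[of x "- x"] FD(4)[of x] hom_0 by (simp add: eq_neg_iff_add_eq_0 add.commute)

private lemma hom_eq_0: "x \<in> F \<Longrightarrow> \<phi> x = 0 \<longleftrightarrow> x = 0"
  using hom_mult[of x "inverse x"] FD(5)[of x] hom_0 hom_1 by (cases "x = 0") auto

private lemma hom_sum: "(\<And>i. i \<in> I \<Longrightarrow> f i \<in> F) \<Longrightarrow> \<phi> (sum f I) = (\<Sum>i\<in>I. \<phi> (f i))"
  by (induction I rule: infinite_finite_induct)
    (simp_all add: hom_0 hom_add is_subring_sum[OF FD(1)])

private lemma hom_of_nat: "\<phi> (of_nat n) = of_nat n"
  by (induction n) (simp_all add: hom_0 hom_1 hom_add FD of_nat_in_subring)

private abbreviation (input) "\<Phi> \<equiv> map_poly \<phi>"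

private lemma coeff_map: "coeff (\<Phi> u) i = \<phi> (coeff u i)"
  by (simp add: coeff_map_poly hom_0)

private lemma map_add: "u \<in> polys_in F \<Longrightarrow> v \<in> polys_in F \<Longrightarrow> \<Phi> (u + v) = \<Phi> u + \<Phi> v"
  by (intro poly_eqI) (simp add: coeff_map hom_add polys_inD)

private lemma map_minus: "u \<in> polys_in F \<Longrightarrow> \<Phi> (- u) = - \<Phi> u"
  by (intro poly_eqI) (simp add: coeff_map hom_minus polys_inD)

private lemma map_mult:
  assumes "u \<in> polys_in F" "v \<in> polys_in F" shows "\<Phi> (u * v) = \<Phi> u * \<Phi> v"
proof (intro poly_eqI)
  fix n
  have "\<phi> (\<Sum>i\<le>n. coeff u i * coeff v (n - i)) = (\<Sum>i\<le>n. \<phi> (coeff u i * coeff v (n - i)))"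
    using assms by (intro hom_sum is_subringD(5)[OF FD(1)] polys_inD)
  then show "coeff (\<Phi> (u * v)) n = coeff (\<Phi> u * \<Phi> v) n"
    using assms by (simp add: coeff_map coeff_mult hom_mult polys_inD)
qed

private lemma map_smult: "c \<in> F \<Longrightarrow> u \<in> polys_in F \<Longrightarrow> \<Phi> (smult c u) = smult (\<phi> c) (\<Phi> u)"
  by (intro poly_eqI) (simp add: coeff_map hom_mult polys_inD)

private lemma map_pderiv: "u \<in> polys_in F \<Longrightarrow> \<Phi> (pderiv u) = pderiv (\<Phi> u)"
proof (intro poly_eqI)
  fix n assume "u \<in> polys_in F"
  then show "coeff (\<Phi> (pderiv u)) n = coeff (pderiv (\<Phi> u)) n"
    using hom_mult[of "of_nat (Suc n)" "coeff u (Suc n)"] of_nat_in_subring[OF FD(1), of "Suc n"] hom_of_nat[of "Suc n"]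
    by (simp only: coeff_map coeff_pderiv polys_inD)
qed

private lemma map_eq_0: "u \<in> polys_in F \<Longrightarrow> \<Phi> u = 0 \<longleftrightarrow> u = 0"
  by (simp add: poly_eq_iff coeff_map hom_eq_0 polys_inD)

private lemma pderiv_in: "u \<in> polys_in F \<Longrightarrow> pderiv u \<in> polys_in F"
  unfolding polys_in_def coeff_pderiv mem_Collect_eq
  using is_subringD(5)[OF FD(1) of_nat_in_subring[OF FD(1)]] by blast

text \<open>This says that \<open>z\<close> may be sent to \<open>w\<close>: one implication makes
  the map from values at \<open>z\<close> to values at \<open>w\<close> well defined, the other
  keeps nonzero denominators nonzero.\<close>

private definition conj_pt where
  "conj_pt z w \<longleftrightarrow> (\<forall>u\<in>polys_in F. poly u z = 0 \<longleftrightarrow> poly (\<Phi> u) w = 0)"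

text \<open>Pseudo-division by the minimal polynomial \<open>m\<close> transports along
  \<open>\<Phi>\<close>, which gives vanishing at \<open>w\<close> from vanishing at
  \<open>z\<close>. The converse needs a separate argument, as nothing is yet known about
  polynomials over the image field.\<close>

private lemma min_poly_root_conj:
  assumes m: "m \<in> polys_in F" "m \<noteq> 0" "poly m z = 0"
    and min: "\<And>u. u \<in> polys_in F \<Longrightarrow> u \<noteq> 0 \<Longrightarrow> poly u z = 0 \<Longrightarrow> degree m \<le> degree u"
    and w: "poly (\<Phi> m) w = 0"
  shows "conj_pt z w"
proof -
  note P = is_subringD[OF is_subring_polys_in[OF FD(1)]]
  have lc: "lead_coeff v ^ j \<in> F" if "v \<in> polys_in F" for v j
    using is_subring_power[OF FD(1)] polys_inD[OF that] by blast
  have 1: "poly (\<Phi> u) w = 0" if u: "u \<in> polys_in F" "poly u z = 0" for u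
  proof -
    obtain j q r where jqr: "q \<in> polys_in F" "r \<in> polys_in F"
      "smult (lead_coeff m ^ j) u = q * m + r" "r = 0 \<or> degree r < degree m"
      using pseudo_division_in[OF FD(1) m(1,2) u(1)] by blast
    have "poly r z = poly (smult (lead_coeff m ^ j) u) z" unfolding jqr(3) using m by simp
    then have "poly r z = 0" using u by simp
    then have "r = 0" using jqr(2,4) min[of r] by fastforce
    then have "smult (\<phi> (lead_coeff m ^ j)) (\<Phi> u) = \<Phi> q * \<Phi> m"
      using jqr map_mult[OF jqr(1) m(1)] map_smult[OF lc[OF m(1)] u(1)] by (metis add.right_neutral)
    then have "\<phi> (lead_coeff m ^ j) * poly (\<Phi> u) w = 0"
      using w by (metis mult_zero_right poly_mult poly_smult)
    then show ?thesis using hom_eq_0[OF lc[OF m(1)]] m by auto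
  qed
  have 2: "poly u z = 0" if u: "u \<in> polys_in F" "poly (\<Phi> u) w = 0" for u
  proof -
    \<comment> \<open>Minimality is taken among polynomials over \<open>F\<close> whose image
      vanishes at \<open>w\<close>. Such an \<open>n\<close> divides every other one up to a
      constant, in particular \<open>m\<close>.\<close>
    define d where "d = (LEAST d. \<exists>n. n \<in> polys_in F \<and> n \<noteq> 0 \<and> poly (\<Phi> n) w = 0 \<and> degree n = d)"
    have "\<exists>n. n \<in> polys_in F \<and> n \<noteq> 0 \<and> poly (\<Phi> n) w = 0 \<and> degree n = d"
      unfolding d_def by (rule LeastI[of _ "degree m"]) (use m w in blast)
    then obtain n where n: "n \<in> polys_in F" "n \<noteq> 0" "poly (\<Phi> n) w = 0" "degree n = d" by blast
    have nmin: "d \<le> degree v" if "v \<in> polys_in F" "v \<noteq> 0" "poly (\<Phi> v) w = 0" for v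
      unfolding d_def by (rule Least_le) (use that in blast)
    have div: "\<exists>c q. c \<noteq> 0 \<and> q \<in> polys_in F \<and> smult c v = q * n"
      if v: "v \<in> polys_in F" "poly (\<Phi> v) w = 0" for v
    proof -
      obtain j q r where jqr: "q \<in> polys_in F" "r \<in> polys_in F"
        "smult (lead_coeff n ^ j) v = q * n + r" "r = 0 \<or> degree r < degree n"
        using pseudo_division_in[OF FD(1) n(1,2) v(1)] by blast
      have "smult (\<phi> (lead_coeff n ^ j)) (\<Phi> v) = \<Phi> q * \<Phi> n + \<Phi> r"
        using map_smult[OF lc[OF n(1)] v(1), of j] map_add[OF P(5)[OF jqr(1) n(1)] jqr(2)] map_mult[OF jqr(1) n(1)]
        unfolding jqr(3) by simp
      then have "poly (smult (\<phi> (lead_coeff n ^ j)) (\<Phi> v)) w = poly (\<Phi> q * \<Phi> n + \<Phi> r) w" by simp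
      then have "poly (\<Phi> r) w = 0" using v n by simp
      then have "r = 0" using jqr nmin[of r] n(4) by force
      then show ?thesis using jqr n(2) by (intro exI[of _ "lead_coeff n ^ j"] exI[of _ q]) simp
    qed
    obtain c q where cq: "c \<noteq> 0" "q \<in> polys_in F" "smult c m = q * n" using div[OF m(1) w] by blast
    have "poly q z * poly n z = 0" using cq(3) m(3) by (metis mult_zero_right poly_mult poly_smult)
    \<comment> \<open>Otherwise \<open>q\<close> would have at least the degree of \<open>m\<close>,
      leaving for \<open>n\<close> a nonzero constant, whose image cannot vanish at
      \<open>w\<close>.\<close>
    moreover have "poly q z \<noteq> 0"
    proof
      assume "poly q z = 0"
      have "q \<noteq> 0" using cq m by auto
      then have "degree m \<le> degree q" using min cq \<open>poly q z = 0\<close> by blast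
      moreover have "degree m = degree q + degree n"
        using cq(1,3) n(2) \<open>q \<noteq> 0\<close> by (metis degree_mult_eq degree_smult_eq)
      ultimately have "degree n = 0" by simp
      then obtain a where a: "n = [:a:]" by (metis degree_eq_zeroE)
      then have "a \<in> F" "a \<noteq> 0" using n polys_inD[of n F 0] by auto
      then show False using n(3) hom_eq_0 a by (simp add: map_poly_pCons hom_0)
    qed
    ultimately have "poly n z = 0" by simp
    moreover obtain c' q' where "c' \<noteq> 0" "smult c' u = q' * n" using div[OF u] by blast
    ultimately show ?thesis by (metis mult_eq_0_iff poly_mult poly_smult)
  qed
  show ?thesis unfolding conj_pt_def using 1 2 by blast
qed

text \<open>If \<open>z\<close> is transcendental, any \<open>w\<close> transcendental over the
  image field will do, and all but countably many are. If \<open>z\<close> is algebraic, its minimal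
  polynomial has degree at least 2 because \<open>z\<close> is not in \<open>F\<close>, and its
  image has two distinct roots whenever \<open>w0\<close> is one of them.\<close>

private lemma exists_conj_pt:
  assumes "countable F" "z \<notin> F" shows "\<exists>w. w \<noteq> w0 \<and> conj_pt z w"
proof (cases "algebraic_over F z")
  case False
  have "countable (\<phi> ` F)" using assms by simp
  then have "countable ({w. algebraic_over (\<phi> ` F) w} \<union> {w0})" using countable_algebraic_over by auto
  then have "{w. algebraic_over (\<phi> ` F) w} \<union> {w0} \<noteq> UNIV"
    using uncountable_UNIV_complex by metis
  then obtain w where w: "\<not> algebraic_over (\<phi> ` F) w" "w \<noteq> w0" by blast
  have "poly u z = 0 \<longleftrightarrow> poly (\<Phi> u) w = 0" if u: "u \<in> polys_in F" for u
  proof -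
    have "\<Phi> u \<in> polys_in (\<phi> ` F)" using u by (auto simp: polys_in_def coeff_map)
    then have "poly (\<Phi> u) w = 0 \<longleftrightarrow> \<Phi> u = 0" using w unfolding algebraic_over_def by auto
    also have "\<dots> \<longleftrightarrow> u = 0" using map_eq_0[OF u] .
    also have "\<dots> \<longleftrightarrow> poly u z = 0" using False u unfolding algebraic_over_def by auto
    finally show ?thesis by simp
  qed
  then show ?thesis using w unfolding conj_pt_def by blast
next
  case True
  let ?A = "\<lambda>m. m \<in> polys_in F \<and> m \<noteq> 0 \<and> poly m z = 0"
  obtain u0 where "?A u0" using True unfolding algebraic_over_def by blast
  define d where "d = (LEAST d. \<exists>m. ?A m \<and> degree m = d)"
  have "\<exists>m. ?A m \<and> degree m = d" unfolding d_def by (rule LeastI[of _ "degree u0"]) (use \<open>?A u0\<close> in blast)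
  then obtain m where m: "m \<in> polys_in F" "m \<noteq> 0" "poly m z = 0" "degree m = d" by blast
  have min: "degree m \<le> degree u" if "u \<in> polys_in F" "u \<noteq> 0" "poly u z = 0" for u
    unfolding m(4) d_def by (rule Least_le) (use that in blast)
  have root: "conj_pt z w" if "poly (\<Phi> m) w = 0" for w
    by (rule min_poly_root_conj[OF m(1-3) _ that]) (rule min)
  have deg: "degree (\<Phi> m) = degree m"
    by (rule map_poly_degree_eq) (use m(1,2) in \<open>simp add: hom_eq_0 polys_inD\<close>)
  have "degree m \<noteq> 0" using m(2,3) by (metis degree_eq_zeroE mult_eq_0_iff poly_const_conv pCons_eq_0_iff)
  moreover have "degree m \<noteq> 1"
  proof
    assume "degree m = 1"
    then obtain a b where ab: "m = [:a, b:]" "b \<noteq> 0" by (metis degree1_coeffs)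
    then have "a \<in> F" "b \<in> F" using m(1) polys_inD[of m F 0] polys_inD[of m F 1] by auto
    moreover have "z = - a / b" using m(3) ab by (simp add: field_simps eq_neg_iff_add_eq_0)
    ultimately show False using assms(2) is_subfieldD[OF F] by metis
  qed
  ultimately have d2: "degree m \<ge> 2" by simp
  show ?thesis
  proof (cases "poly (\<Phi> m) w0 = 0")
    case False
    have "\<not> constant (poly (\<Phi> m))" using d2 deg by (simp add: constant_degree)
    then obtain w where w: "poly (\<Phi> m) w = 0" using fundamental_theorem_of_algebra by blast
    then have "w \<noteq> w0" using False by blast
    then show ?thesis using root[OF w] by blast
  next
    case True
    then obtain v where v: "\<Phi> m = [:- w0, 1:] * v" by (metis poly_eq_0_iff_dvd dvdE)
    then have "v \<noteq> 0" using m map_eq_0 by auto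
    then have "degree (\<Phi> m) = Suc (degree v)" unfolding v by (subst degree_mult_eq) auto
    then have "\<not> constant (poly v)" using d2 deg by (simp add: constant_degree)
    then obtain w where w: "poly v w = 0" using fundamental_theorem_of_algebra by blast
    \<comment> \<open>A double root of \<open>\<Phi> m\<close> would be a root of \<open>\<Phi> (pderiv m)\<close>, so \<open>z\<close> would be a root of \<open>pderiv m\<close>,
      against the minimality of \<open>m\<close>.\<close>
    have "w \<noteq> w0"
    proof
      assume "w = w0"
      then have "poly (pderiv (\<Phi> m)) w0 = 0" unfolding v using w by (simp add: pderiv_mult del: mult_pCons_left)
      then have "poly (\<Phi> (pderiv m)) w0 = 0" using map_pderiv m(1) by simp
      then have "poly (pderiv m) z = 0"
        using root[OF True] pderiv_in[OF m(1)] unfolding conj_pt_def by blast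
      moreover have "pderiv m \<noteq> 0" using d2 by (simp add: pderiv_eq_0_iff)
      ultimately have "degree m \<le> degree (pderiv m)" using min pderiv_in[OF m(1)] by blast
      then show False using d2 by (simp add: degree_pderiv)
    qed
    moreover have "poly (\<Phi> m) w = 0" unfolding v using w by simp
    ultimately show ?thesis using root by blast
  qed
qed

text \<open>The field \<open>F'\<close> is \<open>F(z)\<close>, written as quotients of values at
  \<open>z\<close>. The freedom to avoid \<open>w0\<close> is what later moves a coordinate away
  from itself.\<close>

lemma extend_field_hom:
  assumes "countable F" "z \<notin> F"
  shows "\<exists>F' \<phi>'. is_subfield F' \<and> countable F' \<and> F \<subseteq> F' \<and> z \<in> F' \<and> is_field_hom F' \<phi>' \<and>
    (\<forall>x\<in>F. \<phi>' x = \<phi> x) \<and> \<phi>' z \<noteq> w0"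
proof -
  obtain w where w0: "w \<noteq> w0" and "conj_pt z w" using exists_conj_pt[OF assms] by blast
  then have w: "poly (\<Phi> u) w = 0 \<longleftrightarrow> poly u z = 0" if "u \<in> polys_in F" for u
    using that unfolding conj_pt_def by blast
  note P = is_subringD[OF is_subring_polys_in[OF FD(1)]]
  define D where "D = {(u, v). u \<in> polys_in F \<and> v \<in> polys_in F \<and> poly v z \<noteq> 0}"
  define F' where "F' = (\<lambda>(u, v). poly u z / poly v z) ` D"
  define \<phi>' where "\<phi>' = (\<lambda>x. let p = (SOME p. p \<in> D \<and> x = poly (fst p) z / poly (snd p) z)
    in poly (\<Phi> (fst p)) w / poly (\<Phi> (snd p)) w)"
  have F'I: "poly u z / poly v z \<in> F'" if "u \<in> polys_in F" "v \<in> polys_in F" "poly v z \<noteq> 0" for u v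
    unfolding F'_def D_def using that by force
  have \<phi>': "\<phi>' (poly u z / poly v z) = poly (\<Phi> u) w / poly (\<Phi> v) w"
    if uv: "u \<in> polys_in F" "v \<in> polys_in F" "poly v z \<noteq> 0" for u v
  proof -
    let ?x = "poly u z / poly v z"
    define p where "p = (SOME p. p \<in> D \<and> ?x = poly (fst p) z / poly (snd p) z)"
    have p: "p \<in> D \<and> ?x = poly (fst p) z / poly (snd p) z"
      unfolding p_def by (rule someI[of _ "(u, v)"]) (use uv D_def in auto)
    define a b where "a = fst p" and "b = snd p"
    have ab: "a \<in> polys_in F" "b \<in> polys_in F" "poly b z \<noteq> 0" "?x = poly a z / poly b z"
      using p unfolding D_def a_def b_def by auto
    \<comment> \<open>Independence of the chosen fraction: the cross-multiplied difference is a
      polynomial over \<open>F\<close> vanishing at \<open>z\<close>, so its image vanishes at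
      \<open>w\<close>.\<close>
    have "poly (u * b + - (a * v)) z = 0" using ab uv by (simp add: field_simps)
    moreover have "u * b + - (a * v) \<in> polys_in F" using ab uv by (intro P)
    ultimately have "poly (\<Phi> (u * b + - (a * v))) w = 0" using w by blast
    moreover have "\<Phi> (u * b + - (a * v)) = \<Phi> u * \<Phi> b + - (\<Phi> a * \<Phi> v)"
      using map_add[OF P(5)[OF uv(1) ab(2)] P(3)[OF P(5)[OF ab(1) uv(2)]]]
        map_minus[OF P(5)[OF ab(1) uv(2)]] map_mult[OF uv(1) ab(2)] map_mult[OF ab(1) uv(2)] by simp
    ultimately have "poly (\<Phi> u) w * poly (\<Phi> b) w = poly (\<Phi> a) w * poly (\<Phi> v) w"
      by simp
    moreover have "poly (\<Phi> b) w \<noteq> 0" "poly (\<Phi> v) w \<noteq> 0" using w ab uv by auto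
    ultimately have "poly (\<Phi> a) w / poly (\<Phi> b) w = poly (\<Phi> u) w / poly (\<Phi> v) w"
      by (simp add: field_simps)
    then show ?thesis unfolding \<phi>'_def Let_def p_def[symmetric] a_def b_def by simp
  qed
  have F'E: "\<exists>u v. u \<in> polys_in F \<and> v \<in> polys_in F \<and> poly v z \<noteq> 0 \<and> x = poly u z / poly v z" if "x \<in> F'" for x
    using that unfolding F'_def D_def by auto
  have 1: "x + y \<in> F' \<and> x * y \<in> F' \<and> \<phi>' (x + y) = \<phi>' x + \<phi>' y \<and> \<phi>' (x * y) = \<phi>' x * \<phi>' y"
    if xy: "x \<in> F'" "y \<in> F'" for x y
  proof -
    obtain a b where a: "a \<in> polys_in F" "b \<in> polys_in F" "poly b z \<noteq> 0" "x = poly a z / poly b z"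
      using F'E[OF xy(1)] by blast
    obtain c d where c: "c \<in> polys_in F" "d \<in> polys_in F" "poly d z \<noteq> 0" "y = poly c z / poly d z"
      using F'E[OF xy(2)] by blast
    have s: "x + y = poly (a * d + c * b) z / poly (b * d) z"
      unfolding a(4) c(4) using a(3) c(3) by (simp add: field_simps)
    have p: "x * y = poly (a * c) z / poly (b * d) z" using a c by simp
    have m: "a * d + c * b \<in> polys_in F" "b * d \<in> polys_in F" "a * c \<in> polys_in F" "poly (b * d) z \<noteq> 0"
      using a c by (auto intro: P)
    have nz: "poly (\<Phi> b) w \<noteq> 0" "poly (\<Phi> d) w \<noteq> 0" using w a c by auto
    have "\<phi>' (x + y) = \<phi>' x + \<phi>' y" "\<phi>' (x * y) = \<phi>' x * \<phi>' y"
      unfolding s \<phi>'[OF m(1,2,4)] p \<phi>'[OF m(3,2,4)] unfolding a(4) c(4) \<phi>'[OF a(1-3)] \<phi>'[OF c(1-3)]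
      using a c nz by (simp_all add: map_add map_mult P(5) field_simps)
    then show ?thesis using F'I[OF m(1,2,4)] F'I[OF m(3,2,4)] s p by simp
  qed
  have sub: "x \<in> F'" "\<phi>' x = \<phi> x" if "x \<in> F" for x
    using F'I[OF const_in_polys_in[OF FD(1) that] P(2)] \<phi>'[OF const_in_polys_in[OF FD(1) that] P(2)]
    by (simp_all add: map_poly_pCons hom_0 hom_1 map_poly_1')
  have X: "[:0, 1:] \<in> polys_in F" unfolding polys_in_def using FD(2,3) by (auto simp: coeff_pCons split: nat.split)
  have z: "z \<in> F'" "\<phi>' z = w"
    using F'I[OF X P(2)] \<phi>'[OF X P(2)] by (simp_all add: map_poly_pCons hom_0 hom_1 map_poly_1')
  have "- x \<in> F' \<and> inverse x \<in> F'" if x: "x \<in> F'" for x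
  proof -
    obtain a b where a: "a \<in> polys_in F" "b \<in> polys_in F" "poly b z \<noteq> 0" "x = poly a z / poly b z"
      using F'E[OF x] by blast
    have "inverse x \<in> F'"
    proof (cases "x = 0")
      case True
      then show ?thesis using sub(1)[OF FD(2)] by simp
    next
      case False
      then have "poly a z \<noteq> 0" using a by auto
      then show ?thesis using F'I[OF a(2,1)] a(4) by simp
    qed
    then show ?thesis using F'I[OF P(3)[OF a(1)] a(2,3)] a(4) by simp
  qed
  then have "is_subfield F'"
    unfolding is_subfield_def is_subring_def using 1 sub(1) FD(2,3) by blast
  moreover have "is_field_hom F' \<phi>'" unfolding is_field_hom_def using 1 sub(2)[OF FD(3)] hom_1 by simp
  moreover have "countable F'"
  proof -
    have "D \<subseteq> polys_in F \<times> polys_in F" unfolding D_def by blast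
    then have "countable D" using countable_polys_in[OF assms(1)] by (meson countable_SIGMA countable_subset)
    then show ?thesis unfolding F'_def by simp
  qed
  ultimately show ?thesis using sub z w0 by blast
qed

end

section \<open>Polynomial functions and generic points\<close>

text \<open>Polynomials over \<open>k\<close> in the variables indexed by \<open>J\<close>, taken as
  functions so that substitution is plain composition.\<close>

inductive_set pfun :: "complex set \<Rightarrow> nat set \<Rightarrow> ((nat \<Rightarrow> complex) \<Rightarrow> complex) set" for k J where
  const: "c \<in> k \<Longrightarrow> (\<lambda>_. c) \<in> pfun k J"
| coord: "j \<in> J \<Longrightarrow> (\<lambda>x. x j) \<in> pfun k J"
| add: "F \<in> pfun k J \<Longrightarrow> G \<in> pfun k J \<Longrightarrow> (\<lambda>x. F x + G x) \<in> pfun k J"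
| mult: "F \<in> pfun k J \<Longrightarrow> G \<in> pfun k J \<Longrightarrow> (\<lambda>x. F x * G x) \<in> pfun k J"

lemma pfun_mono: "F \<in> pfun k J \<Longrightarrow> k \<subseteq> k' \<Longrightarrow> J \<subseteq> J' \<Longrightarrow> F \<in> pfun k' J'"
  by (induction rule: pfun.induct) (blast intro: pfun.intros)+

lemma pfun_cong: "F \<in> pfun k J \<Longrightarrow> (\<And>j. j \<in> J \<Longrightarrow> x j = y j) \<Longrightarrow> F x = F y"
  by (induction rule: pfun.induct) auto

lemma pfun_value_in:
  assumes "is_subring R" "k \<subseteq> R" "\<And>j. j \<in> J \<Longrightarrow> x j \<in> R"
  shows "F \<in> pfun k J \<Longrightarrow> F x \<in> R"
  by (induction rule: pfun.induct) (use assms in \<open>simp_all add: is_subringD(4,5) subset_iff\<close>)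

text \<open>The source of all one-variable polynomials below: coordinate lines, segments between two
  points, and the ray through a generic point are curves of this kind.\<close>

lemma pfun_along_curve:
  assumes R: "is_subring R" "k \<subseteq> R" and c: "\<And>j. j \<in> J \<Longrightarrow> c j \<in> polys_in R"
  shows "F \<in> pfun k J \<Longrightarrow> \<exists>u\<in>polys_in R. \<forall>t. poly u t = F (\<lambda>j. poly (c j) t)"
proof (induction rule: pfun.induct)
  case (const a)
  then show ?case using R by (intro bexI[of _ "[:a:]"] const_in_polys_in) auto
next
  case (coord j)
  then show ?case using c by (intro bexI[of _ "c j"]) auto
next
  case (add F G)
  then obtain u v where "u \<in> polys_in R" "v \<in> polys_in R"
    "\<forall>t. poly u t = F (\<lambda>j. poly (c j) t)" "\<forall>t. poly v t = G (\<lambda>j. poly (c j) t)" by blast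
  then show ?case using is_subringD(4)[OF is_subring_polys_in[OF R(1)]]
    by (intro bexI[of _ "u + v"]) simp_all
next
  case (mult F G)
  then obtain u v where "u \<in> polys_in R" "v \<in> polys_in R"
    "\<forall>t. poly u t = F (\<lambda>j. poly (c j) t)" "\<forall>t. poly v t = G (\<lambda>j. poly (c j) t)" by blast
  then show ?case using is_subringD(5)[OF is_subring_polys_in[OF R(1)]]
    by (intro bexI[of _ "u * v"]) simp_all
qed

lemma pfun_compose:
  assumes "\<And>j. j \<in> J \<Longrightarrow> G j \<in> pfun k J'"
  shows "F \<in> pfun k J \<Longrightarrow> (\<lambda>x. F (\<lambda>j. G j x)) \<in> pfun k J'"
  by (induction rule: pfun.induct) (auto intro: pfun.intros assms)

lemma pfun_power: "1 \<in> k \<Longrightarrow> F \<in> pfun k J \<Longrightarrow> (\<lambda>x. F x ^ n) \<in> pfun k J"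
  by (induction n) (auto intro: pfun.intros)

lemma pfun_sum: "0 \<in> k \<Longrightarrow> (\<And>i. i \<in> I \<Longrightarrow> F i \<in> pfun k J) \<Longrightarrow> (\<lambda>x. \<Sum>i\<in>I. F i x) \<in> pfun k J"
  by (induction I rule: infinite_finite_induct) (auto intro: pfun.intros)

lemma pfun_diff:
  assumes "is_subring k" "F \<in> pfun k J" "G \<in> pfun k J" shows "(\<lambda>x. F x - G x) \<in> pfun k J"
proof -
  have "- 1 \<in> k" using is_subringD(2,3)[OF assms(1)] by blast
  then have "(\<lambda>x. F x + (- 1) * G x) \<in> pfun k J" by (intro pfun.intros assms)
  then show ?thesis by simp
qed

text \<open>The coordinates of \<open>y\<close> in \<open>J\<close> are algebraically independent
  over \<open>k\<close>.\<close>

definition generic :: "complex set \<Rightarrow> nat set \<Rightarrow> (nat \<Rightarrow> complex) \<Rightarrow> bool" where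
  "generic k J y \<longleftrightarrow> (\<forall>F\<in>pfun k J. F y = 0 \<longrightarrow> (\<forall>x. F x = 0))"

lemma genericD: "generic k J y \<Longrightarrow> F \<in> pfun k J \<Longrightarrow> F y = 0 \<Longrightarrow> F x = 0"
  unfolding generic_def by blast

lemma generic_mono: "generic k J y \<Longrightarrow> J' \<subseteq> J \<Longrightarrow> generic k J' y"
  unfolding generic_def using pfun_mono[of _ k J' k J] by blast

lemma generic_eq:
  assumes "generic k J y" "is_subring k" "F \<in> pfun k J" "G \<in> pfun k J" "F y = G y"
  shows "F x = G x"
  using pfun_diff[OF assms(2-4)] assms(1,5) unfolding generic_def by fastforce

text \<open>The subring generated by \<open>k\<close> and the coordinates \<open>y j\<close> for
  \<open>j\<close> in \<open>J\<close>.\<close>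

definition value_ring :: "complex set \<Rightarrow> nat set \<Rightarrow> (nat \<Rightarrow> complex) \<Rightarrow> complex set" where
  "value_ring k J y = (\<lambda>F. F y) ` pfun k J"

lemma is_subring_value_ring:
  assumes "is_subring k" shows "is_subring (value_ring k J y)"
proof -
  note k = is_subringD[OF assms]
  have "x + z \<in> value_ring k J y \<and> x * z \<in> value_ring k J y \<and> - x \<in> value_ring k J y"
    if xz: "x \<in> value_ring k J y" "z \<in> value_ring k J y" for x z
  proof -
    obtain F G where FG: "F \<in> pfun k J" "G \<in> pfun k J" "x = F y" "z = G y"
      using xz unfolding value_ring_def by blast
    have "(\<lambda>x. (- 1) * F x) \<in> pfun k J" using k(2,3) FG by (intro pfun.intros) auto
    then show ?thesis
      using imageI[OF pfun.add[OF FG(1,2)], of "\<lambda>F. F y"] imageI[OF pfun.mult[OF FG(1,2)], of "\<lambda>F. F y"]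
        imageI[of "\<lambda>x. (- 1) * F x" "pfun k J" "\<lambda>F. F y"] FG(3,4)
      unfolding value_ring_def by simp
  qed
  moreover have "c \<in> value_ring k J y" if "c \<in> k" for c
    using imageI[OF pfun.const[OF that], of "\<lambda>F. F y"] unfolding value_ring_def by simp
  ultimately show ?thesis unfolding is_subring_def using k(1,2) by blast
qed

lemma value_ring_base: "k \<subseteq> value_ring k J y"
  unfolding value_ring_def using pfun.const by force

lemma value_ring_coord: "j \<in> J \<Longrightarrow> y j \<in> value_ring k J y"
  unfolding value_ring_def using pfun.coord by force

lemma pfun_as_poly:
  assumes k: "is_subring k" and F: "F \<in> pfun k (insert j J)"
  shows "\<exists>u\<in>polys_in (value_ring k J y). \<forall>t. poly u t = F (y(j := t))"
proof -
  let ?c = "\<lambda>i. if i = j then [:0, 1:] else [:y i:]"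
  note R = is_subringD[OF is_subring_value_ring[OF k, of J y]]
  have c: "?c i \<in> polys_in (value_ring k J y)" if "i \<in> insert j J" for i
    using that value_ring_coord[of i J y k] R(1,2)
    by (auto simp: polys_in_def coeff_pCons split: nat.split)
  obtain u where "u \<in> polys_in (value_ring k J y)" "\<forall>t. poly u t = F (\<lambda>i. poly (?c i) t)"
    using pfun_along_curve[OF is_subring_value_ring[OF k] value_ring_base _ F, of ?c J y] c by blast
  moreover have "(\<lambda>i. poly (?c i) t) = y(j := t)" for t by auto
  ultimately show ?thesis by auto
qed

text \<open>Each coefficient is lifted to a polynomial function having that value at
  \<open>y\<close>. Since \<open>j\<close> lies outside \<open>J\<close>, varying coordinate
  \<open>j\<close> does not disturb these values.\<close>

lemma poly_as_pfun:
  assumes k: "is_subring k" and u: "u \<in> polys_in (value_ring k J y)" and j: "j \<notin> J"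
  shows "\<exists>H\<in>pfun k (insert j J). \<forall>t. H (y(j := t)) = poly u t"
proof -
  have "\<exists>C\<in>pfun k J. C y = coeff u i" for i
    using polys_inD[OF u, of i] unfolding value_ring_def by force
  then obtain C where C: "\<And>i. C i \<in> pfun k J" "\<And>i. C i y = coeff u i" by metis
  define H where "H = (\<lambda>x. \<Sum>i\<le>degree u. C i x * x j ^ i)"
  have "H \<in> pfun k (insert j J)"
    unfolding H_def using is_subringD(1,2)[OF k] pfun_mono[OF C(1), of k "insert j J"]
    by (intro pfun_sum pfun.mult pfun_power pfun.coord) auto
  moreover have "C i (y(j := t)) = C i y" for i t by (rule pfun_cong[OF C(1)]) (use j in auto)
  then have "H (y(j := t)) = poly u t" for t unfolding H_def poly_altdef by (simp add: C(2))
  ultimately show ?thesis by blast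
qed

lemma value_ring_insert:
  assumes k: "is_subring k" and j: "j \<notin> J"
  shows "value_ring k (insert j J) y = (\<lambda>u. poly u (y j)) ` polys_in (value_ring k J y)"
proof (intro equalityI subsetI)
  fix x assume "x \<in> value_ring k (insert j J) y"
  then obtain F where F: "F \<in> pfun k (insert j J)" "x = F y" unfolding value_ring_def by blast
  obtain u where "u \<in> polys_in (value_ring k J y)" "\<forall>t. poly u t = F (y(j := t))"
    using pfun_as_poly[OF k F(1)] by blast
  then show "x \<in> (\<lambda>u. poly u (y j)) ` polys_in (value_ring k J y)"
    using F(2) by (metis (no_types, lifting) fun_upd_triv imageI)
next
  fix x assume "x \<in> (\<lambda>u. poly u (y j)) ` polys_in (value_ring k J y)"
  then obtain u where u: "u \<in> polys_in (value_ring k J y)" "x = poly u (y j)" by blast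
  obtain H where "H \<in> pfun k (insert j J)" "\<forall>t. H (y(j := t)) = poly u t"
    using poly_as_pfun[OF k u(1) j] by blast
  then show "x \<in> value_ring k (insert j J) y" using u(2) unfolding value_ring_def
    by (metis (no_types, lifting) fun_upd_triv imageI)
qed

lemma value_ring_empty: "is_subring k \<Longrightarrow> value_ring k {} y = k"
  using value_ring_base[of k "{}" y] pfun_value_in[of k k "{}" y] unfolding value_ring_def by blast

lemma generic_not_algebraic:
  assumes k: "is_subring k" and g: "generic k (insert j J) y" and j: "j \<notin> J"
  shows "\<not> algebraic_over (value_ring k J y) (y j)"
proof
  assume "algebraic_over (value_ring k J y) (y j)"
  then obtain u where u: "u \<in> polys_in (value_ring k J y)" "u \<noteq> 0" "poly u (y j) = 0"
    unfolding algebraic_over_def by blast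
  obtain H where H: "H \<in> pfun k (insert j J)" "\<forall>t. H (y(j := t)) = poly u t"
    using poly_as_pfun[OF k u(1) j] by blast
  have "H y = 0" using H(2) u(3) by (metis fun_upd_triv)
  then have "poly u t = 0" for t using g H unfolding generic_def by metis
  then show False using u(2) by (metis poly_all_0_iff_0)
qed

text \<open>Transcendence of \<open>t\<close> kills the function on the line through
  \<open>y\<close>; genericity of \<open>y\<close> then has to spread this to all points. Natural
  numbers serve as test values because they lie in every subring and are infinite in number.\<close>

lemma generic_extend:
  assumes k: "is_subring k" and g: "generic k J y" and j: "j \<notin> J"
    and t: "\<not> algebraic_over (value_ring k J y) t"
  shows "generic k (insert j J) (y(j := t))"
  unfolding generic_def
proof (intro ballI impI allI)
  fix F x assume F: "F \<in> pfun k (insert j J)" "F (y(j := t)) = 0"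
  obtain u where u: "u \<in> polys_in (value_ring k J y)" "\<forall>t. poly u t = F (y(j := t))"
    using pfun_as_poly[OF k F(1)] by blast
  then have "u = 0" using t F(2) unfolding algebraic_over_def by metis
  then have 0: "F (y(j := s)) = 0" for s using u(2) by (metis poly_0)
  \<comment> \<open>Substituting a natural number for \<open>x j\<close> gives a polynomial function in the other variables alone.\<close>
  have 1: "F (x(j := of_nat n)) = 0" for x n
  proof -
    have "(\<lambda>x. F (\<lambda>i. (if i = j then (\<lambda>_. of_nat n) else (\<lambda>x. x i)) x)) \<in> pfun k J"
      using of_nat_in_subring[OF k, of n] by (intro pfun_compose[OF _ F(1)]) (auto intro: pfun.intros)
    then have "(\<lambda>x. F (x(j := of_nat n))) \<in> pfun k J"
      by (rule back_subst[of "\<lambda>G. G \<in> pfun k J"]) (auto intro!: ext arg_cong[of _ _ F])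
    then show ?thesis using g 0 unfolding generic_def by auto
  qed
  obtain v where v: "\<forall>t. poly v t = F (x(j := t))" using pfun_as_poly[OF k F(1)] by blast
  have "range of_nat \<subseteq> {t. poly v t = 0}" using v 1 by auto
  moreover have "infinite (range (of_nat :: nat \<Rightarrow> complex))" by (simp add: finite_image_iff inj_on_def)
  ultimately have "v = 0" using poly_roots_finite finite_subset by blast
  then show "F x = 0" using v by (metis fun_upd_triv poly_0)
qed

lemma factorial_in_subfield:
  assumes "is_subfield k" shows "factorial_in k"
proof -
  note k = is_subfieldD[OF assms]
  have "factors_in k x 0" if "x \<in> k" "x \<noteq> 0" for x
    by (rule factors_in.unit) (use that k(8)[of x] in \<open>auto simp: dvd_in_def intro!: bexI[of _ "inverse x"]\<close>)
  then show ?thesis unfolding factorial_in_def using k(1) by blast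
qed

text \<open>Each further generic coordinate is transcendental over the ring generated by the
  previous ones, so adjoining it gives a copy of a polynomial ring.\<close>

lemma factorial_in_value_ring:
  assumes k: "is_subfield k" and "finite J" "generic k J y"
  shows "factorial_in (value_ring k J y)"
  using assms(2,3)
proof (induction J rule: finite_induct)
  case empty
  then show ?case using factorial_in_subfield[OF k] value_ring_empty is_subfieldD(1)[OF k] by simp
next
  case (insert j J)
  note kr = is_subfieldD(1)[OF k]
  have "factorial_in (value_ring k J y)"
    using insert generic_mono[OF insert.prems, of J] by blast
  then have "factorial_in ((\<lambda>u. poly u (y j)) ` polys_in (value_ring k J y))"
  proof (intro factorial_in_image factorial_in_polys_in)
    show "u = 0" if "u \<in> polys_in (value_ring k J y)" "poly u (y j) = 0" for u
      using generic_not_algebraic[OF kr insert.prems insert.hyps(2)] that unfolding algebraic_over_def by blast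
  qed auto
  then show ?case using value_ring_insert[OF kr insert.hyps(2)] by simp
qed

lemma countable_value_ring:
  assumes k: "is_subring k" and "countable k" "finite J"
  shows "countable (value_ring k J y)"
  using assms(3)
proof (induction J rule: finite_induct)
  case empty
  then show ?case using value_ring_empty[OF k] assms(2) by simp
next
  case (insert j J)
  then show ?case unfolding value_ring_insert[OF k insert.hyps(2)]
    by (intro countable_image countable_polys_in)
qed

text \<open>Coordinates are replaced one at a time: a disc is uncountable, while the values
  algebraic over the ring generated so far are countable.\<close>

lemma exists_generic_near:
  assumes k: "is_subring k" "countable k" and "finite J" and e: "e > 0"
  shows "\<exists>y. generic k J y \<and> (\<forall>j. cmod (y j - \<beta> j) < e)"
  using assms(3)
proof (induction J rule: finite_induct)
  case empty
  have "generic k {} \<beta>"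
    unfolding generic_def using pfun_cong[of _ k "{}"] by (metis empty_iff)
  then show ?case using e by (intro exI[of _ \<beta>]) simp
next
  case (insert j J)
  then obtain y where y: "generic k J y" "\<forall>j. cmod (y j - \<beta> j) < e" by blast
  have "countable {t. algebraic_over (value_ring k J y) t}"
    using countable_algebraic_over countable_value_ring[OF k insert.hyps(1)] by blast
  moreover have "uncountable (ball (\<beta> j) e)" using e by (rule uncountable_ball)
  ultimately have "\<not> ball (\<beta> j) e \<subseteq> {t. algebraic_over (value_ring k J y) t}"
    using countable_subset by blast
  then obtain t where t: "t \<in> ball (\<beta> j) e" "\<not> algebraic_over (value_ring k J y) t" by blast
  have "generic k (insert j J) (y(j := t))" by (rule generic_extend[OF k(1) y(1) insert.hyps(2) t(2)])
  moreover have "\<forall>i. cmod ((y(j := t)) i - \<beta> i) < e"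
    using y(2) t(1) by (auto simp: dist_norm norm_minus_commute)
  ultimately show ?case by blast
qed

text \<open>On the line through \<open>y\<close> in direction \<open>s\<close>, both functions
  become polynomials over the factorial ring of the other coordinates, with common root
  \<open>t\<close>. The generator of the polynomials vanishing at \<open>t\<close> divides both, and
  genericity of \<open>y\<close> lifts these factorizations from the point to identities of
  functions.\<close>

lemma exists_common_factor:
  assumes k: "is_subfield k" and J: "finite J" "s \<in> J" and y: "generic k J y"
    and f: "f \<in> pfun k J" "f (y(s := t)) = 0" and g: "g \<in> pfun k J" "g (y(s := t)) = 0" "g x0 \<noteq> 0"
  shows "\<exists>H\<in>pfun k J. \<exists>f'\<in>pfun k J. \<exists>g'\<in>pfun k J.
    (\<forall>x. f x = H x * f' x) \<and> (\<forall>x. g x = H x * g' x) \<and> H (y(s := t)) = 0"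
proof -
  note kr = is_subfieldD(1)[OF k]
  let ?J = "J - {s}" let ?R = "value_ring k ?J y"
  have ins: "insert s ?J = J" using J by blast
  have R: "factorial_in ?R" using factorial_in_value_ring[OF k] J generic_mono[OF y, of ?J] by blast
  have ex: "\<exists>u\<in>polys_in ?R. \<forall>t. poly u t = F (y(s := t))" if "F \<in> pfun k J" for F
    using pfun_as_poly[OF kr, of F s ?J y] that ins by simp
  obtain u where u: "u \<in> polys_in ?R" "\<And>t. poly u t = f (y(s := t))" using ex[OF f(1)] by blast
  obtain v where v: "v \<in> polys_in ?R" "\<And>t. poly v t = g (y(s := t))" using ex[OF g(1)] by blast
  have "g y \<noteq> 0" using y g unfolding generic_def by blast
  then have "v \<noteq> 0" using v(2)[of "y s"] by auto
  then obtain m where m: "m \<in> polys_in ?R" "poly m t = 0" "dvd_in (polys_in ?R) m u" "dvd_in (polys_in ?R) m v"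
    using vanishing_ideal_principal[OF R v(1), of t] u v f g by auto
  obtain u' v' where u': "u' \<in> polys_in ?R" "u = m * u'" and v': "v' \<in> polys_in ?R" "v = m * v'"
    using m(3,4) unfolding dvd_in_def by blast
  have lift: "\<exists>H\<in>pfun k J. \<forall>t. H (y(s := t)) = poly w t" if "w \<in> polys_in ?R" for w
    using poly_as_pfun[OF kr that, of s] ins by simp
  obtain H where H: "H \<in> pfun k J" "\<And>t. H (y(s := t)) = poly m t" using lift[OF m(1)] by blast
  obtain f' where f': "f' \<in> pfun k J" "\<And>t. f' (y(s := t)) = poly u' t" using lift[OF u'(1)] by blast
  obtain g' where g': "g' \<in> pfun k J" "\<And>t. g' (y(s := t)) = poly v' t" using lift[OF v'(1)] by blast
  \<comment> \<open>Setting coordinate \<open>s\<close> back to \<open>y s\<close> returns to the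
    generic point itself.\<close>
  have "f (y(s := y s)) = H (y(s := y s)) * f' (y(s := y s))"
    unfolding H(2) f'(2) using u(2)[of "y s"] u'(2) by simp
  then have "f x = H x * f' x" for x
    using generic_eq[OF y kr f(1) pfun.mult[OF H(1) f'(1)]] by simp
  moreover have "g (y(s := y s)) = H (y(s := y s)) * g' (y(s := y s))"
    unfolding H(2) g'(2) using v(2)[of "y s"] v'(2) by simp
  then have "g x = H x * g' x" for x
    using generic_eq[OF y kr g(1) pfun.mult[OF H(1) g'(1)]] by simp
  ultimately show ?thesis using H m(2) f'(1) g'(1) by metis
qed

text \<open>A zero denominator adds nothing, since division by zero yields 0, which is already
  present in the fractions of a subring.\<close>

definition fraction_field :: "complex set \<Rightarrow> complex set" where
  "fraction_field R = {x / y | x y. x \<in> R \<and> y \<in> R}"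

lemma is_subfield_fraction_field:
  assumes "is_subring R" shows "is_subfield (fraction_field R)"
proof -
  note R = is_subringD[OF assms]
  have I: "x / y \<in> fraction_field R" if "x \<in> R" "y \<in> R" for x y
    using that unfolding fraction_field_def by blast
  have "u + v \<in> fraction_field R \<and> u * v \<in> fraction_field R \<and> - u \<in> fraction_field R \<and> inverse u \<in> fraction_field R"
    if uv: "u \<in> fraction_field R" "v \<in> fraction_field R" for u v
  proof -
    obtain a b c d where abcd: "a \<in> R" "b \<in> R" "c \<in> R" "d \<in> R" "u = a / b" "v = c / d"
      using uv unfolding fraction_field_def by blast
    have 1: "u + v \<in> fraction_field R"
    proof (cases "b = 0 \<or> d = 0")
      case True
      then have "u + v = u \<or> u + v = v" using abcd by auto
      then show ?thesis using uv by auto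
    next
      case False
      then have "u + v = (a * d + c * b) / (b * d)" using abcd by (simp add: field_simps)
      then show ?thesis using I R(4)[OF R(5) R(5)] R(5) abcd by simp
    qed
    have "u * v = (a * c) / (b * d)" "- u = (- a) / b" "inverse u = b / a" using abcd by simp_all
    then show ?thesis using 1 I[OF R(5)[OF abcd(1,3)] R(5)[OF abcd(2,4)]] I[OF R(3)[OF abcd(1)] abcd(2)]
        I[OF abcd(2,1)] by simp
  qed
  then show ?thesis
    unfolding is_subfield_def is_subring_def using I[OF R(1,2)] I[OF R(2,2)] by simp
qed

lemma subset_fraction_field: "is_subring R \<Longrightarrow> R \<subseteq> fraction_field R"
  unfolding fraction_field_def using is_subringD(2) by force

lemma countable_fraction_field: "countable R \<Longrightarrow> countable (fraction_field R)"
proof -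
  assume "countable R"
  moreover have "fraction_field R = (\<lambda>(x, y). x / y) ` (R \<times> R)" unfolding fraction_field_def by auto
  ultimately show ?thesis by simp
qed

text \<open>Once one coordinate has been moved, the images of the others are immaterial; they only
  have to exist so that the homomorphism can be applied to a whole point.\<close>

lemma extend_field_hom_finite:
  assumes "is_subfield F" "countable F" "is_field_hom F \<phi>"
  shows "\<exists>F' \<phi>'. is_subfield F' \<and> countable F' \<and> F \<subseteq> F' \<and> a ` {..<M::nat} \<subseteq> F' \<and> is_field_hom F' \<phi>' \<and>
    (\<forall>x\<in>F. \<phi>' x = \<phi> x)"
proof (induction M)
  case 0
  then show ?case using assms by auto
next
  case (Suc M)
  then obtain F1 \<phi>1 where 1: "is_subfield F1" "countable F1" "F \<subseteq> F1" "a ` {..<M} \<subseteq> F1" "is_field_hom F1 \<phi>1"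
    "\<forall>x\<in>F. \<phi>1 x = \<phi> x" by blast
  show ?case
  proof (cases "a M \<in> F1")
    case True
    then show ?thesis using 1 by (intro exI[of _ F1] exI[of _ \<phi>1]) (auto simp: less_Suc_eq image_subset_iff)
  next
    case False
    obtain F2 \<phi>2 where 2: "is_subfield F2" "countable F2" "F1 \<subseteq> F2" "a M \<in> F2" "is_field_hom F2 \<phi>2"
      "\<forall>x\<in>F1. \<phi>2 x = \<phi>1 x"
      using extend_field_hom[OF 1(1,5,2) False] by metis
    show ?thesis using 1 2 by (intro exI[of _ F2] exI[of _ \<phi>2]) (auto simp: less_Suc_eq subset_iff image_subset_iff)
  qed
qed

lemma pfun_field_hom:
  assumes F: "is_subfield F" "is_field_hom F \<phi>" "k \<subseteq> F" "\<And>x. x \<in> k \<Longrightarrow> \<phi> x = x" "\<And>j. j \<in> J \<Longrightarrow> a j \<in> F"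
  shows "G \<in> pfun k J \<Longrightarrow> \<phi> (G a) = G (\<lambda>j. \<phi> (a j))"
proof (induction rule: pfun.induct)
  case (add G H)
  then show ?case using F(2) pfun_value_in[OF is_subfieldD(1)[OF F(1)] F(3), of J a, OF F(5)]
    unfolding is_field_hom_def by simp
next
  case (mult G H)
  then show ?case using F(2) pfun_value_in[OF is_subfieldD(1)[OF F(1)] F(3), of J a, OF F(5)]
    unfolding is_field_hom_def by simp
qed (use F(4) in auto)

lemma injective_imp_rational:
  assumes k: "is_subfield k" "countable k" and p: "\<And>j. j < N \<Longrightarrow> p j \<in> pfun k {..<N}"
    and inj: "\<And>x x'. \<forall>j<N. p j x = p j x' \<Longrightarrow> \<forall>j<N. x j = x' j"
    and i: "i < N"
  shows "\<exists>f\<in>pfun k {..<N}. \<exists>g\<in>pfun k {..<N}. g (\<lambda>j. p j a) \<noteq> 0 \<and> a i * g (\<lambda>j. p j a) = f (\<lambda>j. p j a)"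
proof -
  define b where "b = (\<lambda>j. p j a)"
  define R where "R = value_ring k {..<N} b"
  define K where "K = fraction_field R"
  note kr = is_subfieldD(1)[OF k(1)]
  have R: "is_subring R" "countable R" "k \<subseteq> R"
    using is_subring_value_ring[OF kr] countable_value_ring[OF kr k(2)] value_ring_base unfolding R_def by auto
  have K: "is_subfield K" "countable K" "R \<subseteq> K"
    using is_subfield_fraction_field countable_fraction_field subset_fraction_field R unfolding K_def by auto
  have bK: "b j \<in> K" if "j < N" for j using value_ring_coord[of j "{..<N}" b k] that K(3) R_def by auto
  have "a i \<in> K"
  proof (rule ccontr)
    assume ai: "a i \<notin> K"
    have "is_field_hom K (\<lambda>x. x)" unfolding is_field_hom_def by simp
    then obtain F1 \<phi>1 where 1: "is_subfield F1" "countable F1" "K \<subseteq> F1" "a i \<in> F1" "is_field_hom F1 \<phi>1"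
      "\<forall>x\<in>K. \<phi>1 x = x" "\<phi>1 (a i) \<noteq> a i"
      using extend_field_hom[OF K(1) _ K(2) ai, of "\<lambda>x. x" "a i"] by metis
    \<comment> \<open>All coordinates of \<open>a\<close> must lie in the domain before
      \<open>\<phi>\<close> can be interchanged with \<open>p j\<close>.\<close>
    obtain F \<phi> where F: "is_subfield F" "F1 \<subseteq> F" "a ` {..<N} \<subseteq> F" "is_field_hom F \<phi>" "\<forall>x\<in>F1. \<phi> x = \<phi>1 x"
      using extend_field_hom_finite[OF 1(1,2,5), of a N] by metis
    have idK: "\<phi> x = x" if "x \<in> K" for x using that 1(3,6) F(5) by auto
    have "p j (\<lambda>j. \<phi> (a j)) = p j a" if j: "j < N" for j
    proof -
      have "\<phi> (p j a) = p j (\<lambda>j. \<phi> (a j))"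
        using pfun_field_hom[OF F(1,4) _ _ _ p[OF j], of a] R(3) K(3) 1(3) F(2,3) idK by blast
      then show ?thesis using idK[OF bK[OF j]] b_def by simp
    qed
    then have "\<phi> (a i) = a i" using inj[of "\<lambda>j. \<phi> (a j)" a] i by blast
    then show False using 1(4,7) F(5) by auto
  qed
  then obtain x y where xy: "x \<in> R" "y \<in> R" "a i = x / y" unfolding K_def fraction_field_def by blast
  show ?thesis
  proof (cases "y = 0")
    case True
    \<comment> \<open>A zero denominator means the value 0 by convention, so the fraction
      \<open>0 / 1\<close> is used instead.\<close>
    then have "a i = 0" using xy by simp
    then show ?thesis using is_subringD(1,2)[OF kr]
      by (intro bexI[of _ "\<lambda>_. 0"] bexI[of _ "\<lambda>_. 1"] pfun.const) auto
  next
    case False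
    then show ?thesis using xy unfolding R_def value_ring_def b_def by auto
  qed
qed

section \<open>Openness and zeros\<close>

text \<open>A basic open set of the product topology restricts finitely many coordinates, so the
  minimum of their radii is positive and serves for every coordinate.\<close>

lemma open_contains_box:
  fixes T :: "(nat \<Rightarrow> 'b::metric_space) set"
  assumes "open T" "x \<in> T"
  shows "\<exists>\<delta>>0. \<forall>y. (\<forall>j. dist (y j) (x j) < \<delta>) \<longrightarrow> y \<in> T"
proof -
  have "openin (product_topology (\<lambda>i. euclidean) UNIV) T" using assms(1) unfolding open_fun_def .
  from product_topology_open_contains_basis[OF this assms(2)]
  obtain X where X: "x \<in> (\<Pi>\<^sub>E i\<in>UNIV. X i)" "\<And>i. open (X i)" "finite {i. X i \<noteq> UNIV}"
    "(\<Pi>\<^sub>E i\<in>UNIV. X i) \<subseteq> T" by auto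
  have "\<exists>e>0. \<forall>y. dist y (x i) < e \<longrightarrow> y \<in> X i" for i
    using X(1) X(2)[of i] unfolding open_dist by (auto simp: PiE_iff)
  then obtain e where e: "\<And>i. e i > 0" "\<And>i y. dist y (x i) < e i \<Longrightarrow> y \<in> X i" by metis
  define \<delta> where "\<delta> = Min (insert 1 (e ` {i. X i \<noteq> UNIV}))"
  have "\<delta> > 0" unfolding \<delta>_def using X(3) e(1) by (subst Min_gr_iff) auto
  moreover have "y \<in> T" if y: "\<forall>j. dist (y j) (x j) < \<delta>" for y
  proof -
    have "y i \<in> X i" for i
    proof (cases "X i = UNIV")
      case False
      then have "\<delta> \<le> e i" unfolding \<delta>_def using X(3) by (intro Min_le) auto
      then show ?thesis using e(2)[of "y i" i] y by (meson less_le_trans)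
    qed simp
    then show ?thesis using X(4) by (auto simp: PiE_iff)
  qed
  ultimately show ?thesis by blast
qed

lemma continuous_pfun: "F \<in> pfun k J \<Longrightarrow> continuous_on UNIV F"
  by (induction rule: pfun.induct) (auto intro: continuous_intros)

lemma pfun_near:
  assumes F: "F \<in> pfun k J" and e: "e > 0"
  shows "\<exists>\<delta>>0. \<forall>y. (\<forall>j. cmod (y j - x j) < \<delta>) \<longrightarrow> cmod (F y - F x) < e"
proof -
  have "open (F -` ball (F x) e)"
    using continuous_pfun[OF F] by (intro open_vimage) auto
  then obtain \<delta> where "\<delta> > 0" "\<forall>y. (\<forall>j. dist (y j) (x j) < \<delta>) \<longrightarrow> y \<in> F -` ball (F x) e"
    using open_contains_box[of "F -` ball (F x) e" x] e by auto
  then show ?thesis by (intro exI[of _ \<delta>]) (auto simp: dist_norm norm_minus_commute)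
qed

lemma injective_imp_open:
  assumes p: "\<And>j. j < N \<Longrightarrow> p j \<in> pfun k {..<N}"
    and inj: "\<And>x x'. \<forall>j<N. p j x = p j x' \<Longrightarrow> \<forall>j<N. x j = x' j"
  shows "\<exists>\<epsilon>>0. \<forall>z. (\<forall>j<N. cmod (z j - p j \<alpha>) < \<epsilon>) \<longrightarrow> (\<exists>x. \<forall>j<N. p j x = z j)"
proof -
  \<comment> \<open>The map \<open>d\<close> interleaves real and imaginary parts and pads with
    zeros from index \<open>2 * N\<close> on, as membership in
    \<open>Euclidean_space (2 * N)\<close> demands; \<open>c\<close> reads complex coordinates
    back.\<close>
  define c where "c = (\<lambda>(r :: nat \<Rightarrow> real) (j :: nat). Complex (r (2 * j)) (r (2 * j + 1)))"
  define d where "d = (\<lambda>(z :: nat \<Rightarrow> complex) (i :: nat). if i < 2 * N then if even i then Re (z (i div 2)) else Im (z (i div 2)) else 0)"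
  define h where "h = (\<lambda>r. d (\<lambda>j. p j (c r)))"
  have cd: "c (d z) j = z j" if "j < N" for z j using that unfolding c_def d_def by simp
  have d_inj: "\<forall>j<N. z j = z' j" if "d z = d z'" for z z' using cd that by metis
  have d_c: "d (c r) i = r i" if "i < 2 * N" for r i
    using that unfolding c_def d_def by (cases "even i") (auto elim!: oddE)
  have cont_c: "continuous_on UNIV c" unfolding c_def
    by (intro continuous_on_coordinatewise_then_product continuous_on_Complex continuous_on_product_coordinates)
  have "continuous_on UNIV (\<lambda>r. h r i)" for i
  proof (cases "i < 2 * N")
    case True
    then have "continuous_on UNIV (p (i div 2))" using continuous_pfun[OF p] by auto
    then have "continuous_on UNIV (\<lambda>r. p (i div 2) (c r))"
      using continuous_on_compose2[OF _ cont_c, of UNIV "p (i div 2)"] by blast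
    then show ?thesis using True unfolding h_def d_def by (cases "even i") (auto intro: continuous_intros)
  next
    case False
    then show ?thesis unfolding h_def d_def by simp
  qed
  then have "continuous_on UNIV h" by (rule continuous_on_coordinatewise_then_product)
  then have "continuous_map (Euclidean_space (2 * N)) (Euclidean_space (2 * N)) h"
    unfolding Euclidean_space_def euclidean_product_topology
    by (auto simp: continuous_map_in_subtopology h_def d_def intro: continuous_on_subset)
  moreover have "inj_on h (topspace (Euclidean_space (2 * N)))"
  proof (rule inj_onI)
    fix r r' assume r: "r \<in> topspace (Euclidean_space (2 * N))" "r' \<in> topspace (Euclidean_space (2 * N))" "h r = h r'"
    then have "\<forall>j<N. p j (c r) = p j (c r')" using d_inj unfolding h_def by blast
    then have "\<forall>j<N. c r j = c r' j" by (rule inj)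
    then have "d (c r) = d (c r')" unfolding d_def by auto
    then have "r i = r' i" if "i < 2 * N" for i using d_c[OF that] by metis
    moreover have "r i = r' i" if "\<not> i < 2 * N" for i using r(1,2) that by (simp add: topspace_Euclidean_space)
    ultimately show "r = r'" by blast
  qed
  ultimately have "openin (Euclidean_space (2 * N)) (h ` topspace (Euclidean_space (2 * N)))"
    by (intro invariance_of_domain_Euclidean_space) (auto simp: subtopology_topspace)
  then obtain T where T: "open T" "h ` topspace (Euclidean_space (2 * N)) = T \<inter> {x. \<forall>i\<ge>2 * N. x i = 0}"
    unfolding Euclidean_space_def euclidean_product_topology openin_subtopology open_openin[symmetric] by blast
  define z0 where "z0 = d (\<lambda>j. p j \<alpha>)"
  have "z0 = h (d \<alpha>)"
  proof -
    have "p j (c (d \<alpha>)) = p j \<alpha>" if "j < N" for j by (rule pfun_cong[OF p[OF that]]) (simp add: cd)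
    then show ?thesis unfolding z0_def h_def d_def by auto
  qed
  moreover have "d \<alpha> \<in> topspace (Euclidean_space (2 * N))" by (simp add: topspace_Euclidean_space d_def)
  ultimately have "z0 \<in> T" using T(2) by blast
  then obtain \<epsilon> where \<epsilon>: "\<epsilon> > 0" "\<forall>y. (\<forall>j. dist (y j) (z0 j) < \<epsilon>) \<longrightarrow> y \<in> T"
    using open_contains_box[OF T(1)] by blast
  have "\<exists>x. \<forall>j<N. p j x = z j" if z: "\<forall>j<N. cmod (z j - p j \<alpha>) < \<epsilon>" for z
  proof -
    have "dist (d z i) (z0 i) < \<epsilon>" for i
    proof (cases "i < 2 * N")
      case True
      then have "cmod (z (i div 2) - p (i div 2) \<alpha>) < \<epsilon>" using z by auto
      moreover have "\<bar>Re (z (i div 2)) - Re (p (i div 2) \<alpha>)\<bar> \<le> cmod (z (i div 2) - p (i div 2) \<alpha>)"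
        "\<bar>Im (z (i div 2)) - Im (p (i div 2) \<alpha>)\<bar> \<le> cmod (z (i div 2) - p (i div 2) \<alpha>)"
        using abs_Re_le_cmod[of "z (i div 2) - p (i div 2) \<alpha>"] abs_Im_le_cmod[of "z (i div 2) - p (i div 2) \<alpha>"]
        by simp_all
      ultimately show ?thesis using True unfolding d_def z0_def dist_real_def by auto
    next
      case False
      then show ?thesis using \<epsilon>(1) unfolding d_def z0_def by simp
    qed
    then have "d z \<in> T" using \<epsilon>(2) by blast
    then have "d z \<in> h ` topspace (Euclidean_space (2 * N))" unfolding T(2) by (simp add: d_def)
    then obtain r where "d z = h r" by blast
    then have "\<forall>j<N. z j = p j (c r)" unfolding h_def using d_inj by blast
    then show ?thesis by metis
  qed
  then show ?thesis using \<epsilon>(1) by blast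
qed

text \<open>On the segment from \<open>\<beta>\<close> to \<open>x\<close> the function is a
  polynomial in the parameter that vanishes near 0, hence also at 1.\<close>

lemma pfun_zero_on_box:
  assumes F: "F \<in> pfun k {..<N}" and e: "e > 0"
    and z: "\<And>z. (\<And>j. cmod (z j - \<beta> j) < e) \<Longrightarrow> F z = 0"
  shows "F x = 0"
proof -
  \<comment> \<open>A bound for all coordinate differences; the added 1 keeps it positive for the
    division \<open>e / M\<close>.\<close>
  define M where "M = (\<Sum>j<N. cmod (x j - \<beta> j)) + 1"
  have M: "M > 0" unfolding M_def by (simp add: add_nonneg_pos sum_nonneg)
  have Mj: "cmod (x j - \<beta> j) \<le> M" if "j < N" for j
    unfolding M_def using member_le_sum[of j "{..<N}" "\<lambda>j. cmod (x j - \<beta> j)"] that by auto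
  obtain u where u: "\<And>t. poly u t = F (\<lambda>j. poly [:\<beta> j, x j - \<beta> j:] t)"
    using pfun_along_curve[of UNIV k "{..<N}" "\<lambda>j. [:\<beta> j, x j - \<beta> j:]" F] F
    by (auto simp: is_subring_def polys_in_def)
  have "poly u t = 0" if t: "t \<in> ball 0 (e / M)" for t
  proof -
    \<comment> \<open>Coordinates from \<open>N\<close> on are reset to \<open>\<beta>\<close>,
      because the box condition speaks of every index.\<close>
    define w where "w = (\<lambda>j. if j < N then \<beta> j + t * (x j - \<beta> j) else \<beta> j)"
    have "cmod (w j - \<beta> j) < e" for j
    proof (cases "j < N")
      case True
      have "cmod (t * (x j - \<beta> j)) \<le> cmod t * M" unfolding norm_mult
        using Mj[OF True] by (simp add: mult_left_mono)
      also have "\<dots> < e" using t M by (simp add: field_simps)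
      finally show ?thesis using True unfolding w_def by simp
    qed (use e in \<open>simp add: w_def\<close>)
    then have "F w = 0" by (rule z)
    moreover have "F w = F (\<lambda>j. poly [:\<beta> j, x j - \<beta> j:] t)"
      by (rule pfun_cong[OF F]) (auto simp: w_def)
    ultimately show ?thesis using u by simp
  qed
  then have "ball 0 (e / M) \<subseteq> {t. poly u t = 0}" by blast
  moreover have "infinite (ball (0::complex) (e / M))"
    using uncountable_ball[of "e / M" "0::complex"] e M uncountable_infinite by simp
  ultimately have "u = 0" using poly_roots_finite infinite_super by blast
  moreover have "poly u 1 = F x" using u[of 1] by simp
  ultimately show ?thesis by simp
qed

text \<open>The image contains a box, so it is large enough to detect polynomial identities, even
  with arbitrary complex coefficients.\<close>

lemma pfun_zero_on_image:
  assumes p: "\<And>j. j < N \<Longrightarrow> p j \<in> pfun k {..<N}"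
    and inj: "\<And>x x'. \<forall>j<N. p j x = p j x' \<Longrightarrow> \<forall>j<N. x j = x' j"
    and F: "F \<in> pfun UNIV {..<N}" and 0: "\<And>x. F (\<lambda>j. p j x) = 0"
  shows "F x = 0"
proof -
  define b where "b = (\<lambda>j. p j (\<lambda>_. 0))"
  have "\<exists>e>0. \<forall>z. (\<forall>j<N. cmod (z j - b j) < e) \<longrightarrow> (\<exists>x. \<forall>j<N. p j x = z j)"
    unfolding b_def by (rule injective_imp_open[of N p k]) (use p inj in blast)+
  then obtain e where e: "e > 0" "\<forall>z. (\<forall>j<N. cmod (z j - b j) < e) \<longrightarrow> (\<exists>x. \<forall>j<N. p j x = z j)"
    by blast
  have "F z = 0" if z: "\<And>j. cmod (z j - b j) < e" for z
  proof -
    obtain x where "\<forall>j<N. p j x = z j" using e(2) z by blast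
    then have "F (\<lambda>j. p j x) = F z" by (intro pfun_cong[OF F]) auto
    then show ?thesis using 0 by simp
  qed
  then show ?thesis by (rule pfun_zero_on_box[OF F e(1)])
qed

text \<open>A root \<open>r\<close> at distance at least \<open>e\<close> from \<open>c\<close>
  satisfies \<open>cmod (\<tau> - r) \<le> e + cmod (c - r) \<le> 2 * cmod (c - r)\<close>; multiply
  over all roots. This is an elementary form of the continuity of roots.\<close>

lemma poly_le_if_no_near_root:
  fixes u :: "complex poly"
  assumes "\<And>t. poly u t = 0 \<Longrightarrow> cmod (t - c) \<ge> e" "cmod (\<tau> - c) \<le> e"
  shows "cmod (poly u \<tau>) \<le> 2 ^ degree u * cmod (poly u c)"
  using assms(1)
proof (induction "degree u" arbitrary: u)
  case 0
  then obtain a where "u = [:a:]" by (metis degree_eq_zeroE)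
  then show ?case by simp
next
  case (Suc n)
  then have "\<not> constant (poly u)" by (simp add: constant_degree)
  then obtain r where r: "poly u r = 0" using fundamental_theorem_of_algebra by blast
  then obtain v where v: "u = [:- r, 1:] * v" by (metis poly_eq_0_iff_dvd dvdE)
  have "v \<noteq> 0" using v Suc.hyps(2) by auto
  then have deg: "degree u = Suc (degree v)" unfolding v by (subst degree_mult_eq) auto
  have "cmod (poly v \<tau>) \<le> 2 ^ degree v * cmod (poly v c)"
    using Suc.hyps(1)[of v] Suc.hyps(2) Suc.prems deg v by auto
  moreover have "cmod (\<tau> - r) \<le> 2 * cmod (c - r)"
    using norm_triangle_ineq[of "\<tau> - c" "c - r"] assms(2) Suc.prems[OF r] by (simp add: norm_minus_commute)
  ultimately have "cmod (\<tau> - r) * cmod (poly v \<tau>) \<le> (2 * cmod (c - r)) * (2 ^ degree v * cmod (poly v c))"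
    by (intro mult_mono) auto
  moreover have "poly u t = (t - r) * poly v t" for t unfolding v by (simp add: algebra_simps)
  ultimately show ?case unfolding deg by (simp add: norm_mult mult_ac)
qed

text \<open>The bound is uniform in \<open>y\<close>, so that the factor \<open>2 ^ degree\<close>
  of the root estimate does not depend on the perturbed point.\<close>

lemma pfun_bounded_degree:
  "F \<in> pfun k J \<Longrightarrow> \<exists>d. \<forall>y. \<exists>u. degree u \<le> d \<and> (\<forall>t. poly u t = F (y(s := t)))"
proof (induction rule: pfun.induct)
  case (const c)
  then show ?case by (intro exI[of _ 0] allI exI[of _ "[:c:]"]) auto
next
  case (coord j)
  have "degree (if j = s then [:0, 1:] else [:y j:]) \<le> 1" "poly (if j = s then [:0, 1:] else [:y j:]) t = (y(s := t)) j"
    for y :: "nat \<Rightarrow> complex" and t by auto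
  then show ?case by blast
next
  case (add F G)
  then obtain d1 d2 where d: "\<forall>y. \<exists>u. degree u \<le> d1 \<and> (\<forall>t. poly u t = F (y(s := t)))"
    "\<forall>y. \<exists>u. degree u \<le> d2 \<and> (\<forall>t. poly u t = G (y(s := t)))" by blast
  show ?case
  proof (intro exI[of _ "max d1 d2"] allI)
    fix y
    obtain u v where "degree u \<le> d1" "degree v \<le> d2" "\<forall>t. poly u t = F (y(s := t))" "\<forall>t. poly v t = G (y(s := t))"
      using d by blast
    then show "\<exists>u. degree u \<le> max d1 d2 \<and> (\<forall>t. poly u t = F (y(s := t)) + G (y(s := t)))"
      by (intro exI[of _ "u + v"]) (auto intro: degree_add_le)
  qed
next
  case (mult F G)
  then obtain d1 d2 where d: "\<forall>y. \<exists>u. degree u \<le> d1 \<and> (\<forall>t. poly u t = F (y(s := t)))"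
    "\<forall>y. \<exists>u. degree u \<le> d2 \<and> (\<forall>t. poly u t = G (y(s := t)))" by blast
  show ?case
  proof (intro exI[of _ "d1 + d2"] allI)
    fix y
    obtain u v where "degree u \<le> d1" "degree v \<le> d2" "\<forall>t. poly u t = F (y(s := t))" "\<forall>t. poly v t = G (y(s := t))"
      using d by blast
    then show "\<exists>u. degree u \<le> d1 + d2 \<and> (\<forall>t. poly u t = F (y(s := t)) * G (y(s := t)))"
      using degree_mult_le[of u v] by (intro exI[of _ "u * v"]) auto
  qed
qed

text \<open>The hypothesis on \<open>\<tau>0\<close> excludes that the whole line in direction
  \<open>s\<close> consists of zeros. If a nearby line had no root near \<open>\<beta> s\<close>, a
  tiny value at \<open>\<beta> s\<close> would bound the value at a fixed \<open>\<tau>\<close>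
  where \<open>F\<close> is bounded away from 0.\<close>

lemma root_near:
  assumes F: "F \<in> pfun k J" and 0: "F \<beta> = 0" and nz: "F (\<beta>(s := \<tau>0)) \<noteq> 0" and e: "e > 0"
  shows "\<exists>\<delta>>0. \<forall>y. (\<forall>j. cmod (y j - \<beta> j) < \<delta>) \<longrightarrow> (\<exists>t. cmod (t - \<beta> s) < e \<and> F (y(s := t)) = 0)"
proof -
  obtain d where d: "\<And>y. \<exists>u. degree u \<le> d \<and> (\<forall>t. poly u t = F (y(s := t)))"
    using pfun_bounded_degree[OF F] by metis
  obtain u where u: "\<And>t. poly u t = F (\<beta>(s := t))" using d by metis
  have "u \<noteq> 0" using u[of \<tau>0] nz by auto
  then have "finite {t. poly u t = 0}" by (rule poly_roots_finite)
  moreover have "infinite (ball (\<beta> s) e)" using uncountable_ball[OF e] uncountable_infinite by blast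
  ultimately obtain \<tau> where \<tau>: "\<tau> \<in> ball (\<beta> s) e" "poly u \<tau> \<noteq> 0"
    by (metis (mono_tags, lifting) infinite_super mem_Collect_eq subsetI)
  \<comment> \<open>Closeness \<open>\<eta> / 2\<close> keeps the value at \<open>\<tau>\<close>
    above \<open>\<eta> / 2\<close> in modulus, while \<open>\<eta> / 2 / 2 ^ d\<close> at
    \<open>\<beta> s\<close> is what the root estimate turns into a bound below
    \<open>\<eta> / 2\<close>.\<close>
  define \<eta> where "\<eta> = cmod (F (\<beta>(s := \<tau>)))"
  have \<eta>: "\<eta> > 0" using \<tau>(2) u unfolding \<eta>_def by simp
  obtain \<delta>1 where \<delta>1: "\<delta>1 > 0" "\<forall>y. (\<forall>j. cmod (y j - (\<beta>(s := \<tau>)) j) < \<delta>1) \<longrightarrow> cmod (F y - F (\<beta>(s := \<tau>))) < \<eta> / 2"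
    using pfun_near[OF F, of "\<eta> / 2" "\<beta>(s := \<tau>)"] \<eta> by auto
  obtain \<delta>2 where \<delta>2: "\<delta>2 > 0" "\<forall>y. (\<forall>j. cmod (y j - \<beta> j) < \<delta>2) \<longrightarrow> cmod (F y - F \<beta>) < \<eta> / 2 / 2 ^ d"
    using pfun_near[OF F, of "\<eta> / 2 / 2 ^ d" \<beta>] \<eta> by auto
  have "\<exists>t. cmod (t - \<beta> s) < e \<and> F (y(s := t)) = 0" if y: "\<forall>j. cmod (y j - \<beta> j) < min \<delta>1 \<delta>2" for y
  proof (rule ccontr)
    assume no: "\<not> ?thesis"
    obtain v where v: "degree v \<le> d" "\<forall>t. poly v t = F (y(s := t))" using d by blast
    have "cmod (t - \<beta> s) \<ge> e" if "poly v t = 0" for t using no v that by force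
    moreover have "cmod (\<tau> - \<beta> s) \<le> e" using \<tau>(1) by (simp add: dist_norm norm_minus_commute)
    ultimately have "cmod (poly v \<tau>) \<le> 2 ^ degree v * cmod (poly v (\<beta> s))" by (rule poly_le_if_no_near_root)
    also have "\<dots> \<le> 2 ^ d * cmod (poly v (\<beta> s))" using v(1) by (intro mult_right_mono power_increasing) auto
    also have "\<dots> < 2 ^ d * (\<eta> / 2 / 2 ^ d)"
    proof -
      have "cmod ((y(s := \<beta> s)) j - \<beta> j) < \<delta>2" for j using y \<delta>2(1) by auto
      then have "cmod (poly v (\<beta> s)) < \<eta> / 2 / 2 ^ d" using \<delta>2(2) v(2) 0 by (metis diff_zero)
      then show ?thesis by (intro mult_strict_left_mono) auto
    qed
    also have "\<dots> = \<eta> / 2" by simp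
    finally have 1: "cmod (F (y(s := \<tau>))) < \<eta> / 2" using v(2) by simp
    have "cmod ((y(s := \<tau>)) j - (\<beta>(s := \<tau>)) j) < \<delta>1" for j using y \<delta>1(1) by auto
    then have "cmod (F (y(s := \<tau>)) - F (\<beta>(s := \<tau>))) < \<eta> / 2" using \<delta>1(2) by blast
    then show False using 1 norm_triangle_ineq3[of "F (y(s := \<tau>))" "F (\<beta>(s := \<tau>))"] unfolding \<eta>_def by linarith
  qed
  then show ?thesis using \<delta>1(1) \<delta>2(1) by (intro exI[of _ "min \<delta>1 \<delta>2"]) auto
qed

text \<open>A nonzero polynomial vanishing on every axis-parallel line through each of its zeros near \<open>\<beta>\<close>
  would vanish on a whole box, reached from \<open>\<beta>\<close> by changing one coordinate at a time.\<close>

lemma exists_zero_with_nonzero_axis: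
  assumes F: "F \<in> pfun k {..<N}" and 0: "F \<beta> = 0" and nz: "F x0 \<noteq> 0" and e: "e > 0"
  shows "\<exists>z s \<tau>. s < N \<and> (\<forall>j. cmod (z j - \<beta> j) < e) \<and> F z = 0 \<and> F (z(s := \<tau>)) \<noteq> 0"
proof (rule ccontr)
  assume no: "\<not> ?thesis"
  have "F z = 0" if z: "\<And>j. cmod (z j - \<beta> j) < e" for z
  proof -
    define w where "w = (\<lambda>m j. if j < m then z j else \<beta> j)"
    have near: "cmod (w m j - \<beta> j) < e" for m j using z e unfolding w_def by auto
    have "F (w m) = 0" if "m \<le> N" for m using that
    proof (induction m)
      case 0
      then show ?case using assms(2) unfolding w_def by simp
    next
      case (Suc m)
      have "F ((w m)(m := z m)) = 0" using no near Suc by (metis Suc_le_lessD Suc_leD)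
      moreover have "(w m)(m := z m) = w (Suc m)" unfolding w_def by (auto simp: less_Suc_eq)
      ultimately show ?case by simp
    qed
    then have "F (w N) = 0" by simp
    moreover have "F (w N) = F z" by (rule pfun_cong[OF F]) (simp add: w_def)
    ultimately show ?thesis by simp
  qed
  then show False using pfun_zero_on_box[OF F e] nz by blast
qed

theorem injective_imp_polynomial_left_inverse:
  assumes k: "is_subfield k" "countable k" and p: "\<And>j. j < N \<Longrightarrow> p j \<in> pfun k {..<N}"
    and inj: "\<And>x x'. \<forall>j<N. p j x = p j x' \<Longrightarrow> \<forall>j<N. x j = x' j"
    and i: "i < N"
  shows "\<exists>q\<in>pfun k {..<N}. \<forall>x. q (\<lambda>j. p j x) = x i"
proof -
  note kr = is_subfieldD(1)[OF k(1)]
  note k' = is_subfieldD[OF k(1)]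
  let ?P = "pfun k {..<N}"
  obtain a where a: "generic k {..<N} a" using exists_generic_near[OF kr k(2) finite_lessThan, of 1 N] by auto
  define b where "b = (\<lambda>j. p j a)"
  have comp: "(\<lambda>x. F (\<lambda>j. p j x)) \<in> ?P" if "F \<in> ?P" for F
    using pfun_compose[OF _ that, of p] p by auto
  have opn: "\<exists>e>0. \<forall>z. (\<forall>j<N. cmod (z j - p j \<alpha>) < e) \<longrightarrow> (\<exists>x. \<forall>j<N. p j x = z j)" for \<alpha>
    by (rule injective_imp_open[of N p k]) (use p inj in blast)+
  have dense: "F x = 0" if "F \<in> pfun UNIV {..<N}" "\<And>x. F (\<lambda>j. p j x) = 0" for F x
    using pfun_zero_on_image[of N p k F x] p inj that by blast
  \<comment> \<open>A relation between the coordinates of \<open>b\<close> is one for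
    \<open>F\<close> composed with \<open>p\<close> at the generic \<open>a\<close>. It therefore
    holds at all points of the image, hence everywhere.\<close>
  have b: "generic k {..<N} b"
    unfolding generic_def
  proof (intro ballI impI)
    fix F assume F: "F \<in> ?P" "F b = 0"
    then have "F (\<lambda>j. p j x) = 0" for x
      using genericD[OF a comp[OF F(1)]] unfolding b_def by simp
    then show "\<forall>x. F x = 0" using dense[OF pfun_mono[OF F(1)]] by simp
  qed
  define S where "S = {(f, g). f \<in> ?P \<and> g \<in> ?P \<and> g b \<noteq> 0 \<and> a i * g b = f b}"
  have ray: "\<exists>u. \<forall>t. poly u t = F (\<lambda>j. t * b j)" if F: "F \<in> ?P" for F
  proof -
    have "\<exists>u\<in>polys_in UNIV. \<forall>t. poly u t = F (\<lambda>j. poly [:0, b j:] t)"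
      by (rule pfun_along_curve[OF _ _ _ F]) (auto simp: is_subring_def polys_in_def)
    then show ?thesis by auto
  qed
  \<comment> \<open>The degree of a denominator is read off along the ray through the generic point \<open>b\<close>.\<close>
  define D where "D = (\<lambda>g d. \<exists>u. (\<forall>t. poly u t = g (\<lambda>j. t * b j)) \<and> degree u = d)"
  define d where "d = (LEAST d. \<exists>f g. (f, g) \<in> S \<and> D g d)"
  obtain f0 g0 where fg0: "(f0, g0) \<in> S"
    using injective_imp_rational[of k N p i a, OF k _ _ i] p inj unfolding S_def b_def by blast
  then obtain d0 where "D g0 d0" using ray unfolding S_def D_def by blast
  with fg0 have "\<exists>f g. (f, g) \<in> S \<and> D g d" unfolding d_def by (intro LeastI[of "\<lambda>d. \<exists>f g. (f, g) \<in> S \<and> D g d" d0]) blast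
  then obtain f g where fg: "f \<in> ?P" "g \<in> ?P" "g b \<noteq> 0" "a i * g b = f b" and Dg: "D g d" unfolding S_def by blast
  have dmin: "d \<le> d'" if "(f', g') \<in> S" "D g' d'" for f' g' d' unfolding d_def by (rule Least_le) (use that in blast)
  have gen_id: "f' (\<lambda>j. p j x) = x i * g' (\<lambda>j. p j x)" if f': "f' \<in> ?P" "g' \<in> ?P" "a i * g' b = f' b" for f' g' x
    using generic_eq[OF a kr comp[OF f'(1)] pfun.mult[OF pfun.coord comp[OF f'(2)]], of i] i f'(3)
    unfolding b_def by simp
  have g_const: "g x = g b" for x
  proof (rule ccontr)
    assume "g x \<noteq> g b"
    \<comment> \<open>A nonconstant \<open>g\<close> is not constant on the image either. On a line
      joining two points with different values the composite is a nonconstant polynomial, which has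
      a root.\<close>
    have "\<exists>\<alpha>. g (\<lambda>j. p j \<alpha>) = 0"
    proof -
      have "\<exists>x2. g (\<lambda>j. p j x2) \<noteq> g (\<lambda>j. p j a)"
      proof (rule ccontr)
        assume "\<not> ?thesis"
        then have "g (\<lambda>j. p j x2) - g b = 0" for x2 unfolding b_def by simp
        moreover have "(\<lambda>x. g x - g b) \<in> pfun UNIV {..<N}"
          using pfun_mono[OF fg(2), of UNIV "{..<N}"]
          by (intro pfun_diff pfun.const) (auto simp: is_subring_def)
        ultimately have "g x - g b = 0" by (intro dense[of "\<lambda>x. g x - g b" x])
        then show False using \<open>g x \<noteq> g b\<close> by simp
      qed
      then obtain x2 where x2: "g (\<lambda>j. p j x2) \<noteq> g (\<lambda>j. p j a)" by blast
      obtain u where u: "\<And>t. poly u t = (\<lambda>x. g (\<lambda>j. p j x)) (\<lambda>j. poly [:a j, x2 j - a j:] t)"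
        using pfun_along_curve[of UNIV k "{..<N}" "\<lambda>j. [:a j, x2 j - a j:]", OF _ _ _ comp[OF fg(2)]]
        by (auto simp: is_subring_def polys_in_def)
      have "poly u 0 \<noteq> poly u 1" unfolding u using x2 by simp
      then have "\<not> constant (poly u)" unfolding constant_def by metis
      then obtain t where "poly u t = 0" using fundamental_theorem_of_algebra by blast
      then show ?thesis unfolding u by blast
    qed
    then obtain \<alpha> where \<alpha>: "g (\<lambda>j. p j \<alpha>) = 0" by blast
    \<comment> \<open>Two radii are used: \<open>e1\<close> keeps the shifted zero \<open>z\<close>
      in the image, and \<open>e2\<close>, taken at a preimage of \<open>z\<close>, keeps the final
      perturbation \<open>w\<close> of \<open>z\<close> there.\<close>
    obtain e1 where e1: "e1 > 0" "\<forall>z. (\<forall>j<N. cmod (z j - p j \<alpha>) < e1) \<longrightarrow> (\<exists>x. \<forall>j<N. p j x = z j)"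
      using opn by blast
    \<comment> \<open>The zero is moved to one lying on a coordinate line where \<open>g\<close>
      does not vanish identically, as \<open>root_near\<close> requires.\<close>
    obtain z s \<tau> where z: "s < N" "\<forall>j. cmod (z j - p j \<alpha>) < e1" "g z = 0" "g (z(s := \<tau>)) \<noteq> 0"
      using exists_zero_with_nonzero_axis[OF fg(2) \<alpha> fg(3) e1(1)] by blast
    obtain \<alpha>' where \<alpha>': "\<forall>j<N. p j \<alpha>' = z j" using e1(2) z(2) by blast
    obtain e2 where e2: "e2 > 0" "\<forall>z. (\<forall>j<N. cmod (z j - p j \<alpha>') < e2) \<longrightarrow> (\<exists>x. \<forall>j<N. p j x = z j)"
      using opn by blast
    obtain \<delta> where \<delta>: "\<delta> > 0"
      "\<forall>y. (\<forall>j. cmod (y j - z j) < \<delta>) \<longrightarrow> (\<exists>t. cmod (t - z s) < e2 \<and> g (y(s := t)) = 0)"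
      using root_near[OF fg(2) z(3,4) e2(1)] by blast
    obtain y where y: "generic k {..<N} y" "\<forall>j. cmod (y j - z j) < min \<delta> e2"
      using exists_generic_near[OF kr k(2) finite_lessThan, of "min \<delta> e2" N z] \<delta>(1) e2(1) by auto
    obtain t where t: "cmod (t - z s) < e2" "g (y(s := t)) = 0" using \<delta>(2) y(2) by auto
    define w where "w = y(s := t)"
    have "\<forall>j<N. cmod (w j - p j \<alpha>') < e2" using \<alpha>' y(2) t(1) unfolding w_def by auto
    then obtain x' where x': "\<forall>j<N. p j x' = w j" using e2(2) by blast
    have "f w = f (\<lambda>j. p j x')" "g w = g (\<lambda>j. p j x')"
      by (rule pfun_cong[OF fg(1)] pfun_cong[OF fg(2)]; use x' in simp)+
    \<comment> \<open>This is where \<open>w\<close> must lie in the image: the identity relating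
      \<open>f\<close> and \<open>g\<close> is available only there.\<close>
    then have "f w = 0" using gen_id[OF fg(1,2,4)] t(2) w_def by simp
    then obtain H f' g' where H: "H \<in> ?P" "f' \<in> ?P" "g' \<in> ?P" "\<forall>x. f x = H x * f' x" "\<forall>x. g x = H x * g' x" "H w = 0"
      using exists_common_factor[OF k(1) finite_lessThan _ y(1) fg(1) _ fg(2), of s t b] z(1) t(2) fg(3)
      unfolding w_def by auto
    have Hb: "H b \<noteq> 0" "g' b \<noteq> 0" using fg(3) H(5) by auto
    have "H b * (a i * g' b) = H b * f' b" using fg(4) H(4,5) by (simp add: mult_ac)
    then have "(f', g') \<in> S" unfolding S_def using H Hb by simp
    obtain uH where uH: "\<And>t. poly uH t = H (\<lambda>j. t * b j)" using ray[OF H(1)] by blast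
    obtain ug where ug: "\<And>t. poly ug t = g' (\<lambda>j. t * b j)" using ray[OF H(3)] by blast
    obtain u where u: "\<And>t. poly u t = g (\<lambda>j. t * b j)" "degree u = d" using Dg unfolding D_def by blast
    have "poly u t = poly (uH * ug) t" for t unfolding u(1) poly_mult uH ug using H(5) by simp
    then have "poly u = poly (uH * ug)" by (rule ext)
    then have "u = uH * ug" by (simp only: poly_eq_poly_eq_iff)
    moreover have "uH \<noteq> 0" "ug \<noteq> 0" using Hb uH[of 1] ug[of 1] by auto
    ultimately have "d = degree uH + degree ug" using u(2) by (simp add: degree_mult_eq)
    moreover have "d \<le> degree ug" using dmin[OF \<open>(f', g') \<in> S\<close>] ug unfolding D_def by blast
    ultimately have "degree uH = 0" by simp
    then obtain c where "uH = [:c:]" by (metis degree_eq_zeroE)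
    \<comment> \<open>The factor \<open>H\<close> contributes no degree along the ray, so its values
      at \<open>b\<close> and at the origin agree. The latter lies in \<open>k\<close>, so
      genericity of \<open>b\<close> makes \<open>H\<close> constant, although it vanishes at
      \<open>w\<close> and not at \<open>b\<close>.\<close>
    then have H0: "H b = H (\<lambda>j. 0)" using uH[of 0] uH[of 1] by simp
    have Hk: "H (\<lambda>j. 0) \<in> k" by (rule pfun_value_in[OF kr subset_refl _ H(1)]) (rule k'(2))
    have "H w = H (\<lambda>j. 0)" by (rule generic_eq[OF b kr H(1) pfun.const[OF Hk]]) (rule H0)
    then show False using H(6) Hb(1) H0 by simp
  qed
  \<comment> \<open>The constant value of \<open>g\<close> is computed at the origin, which shows
    that it belongs to \<open>k\<close>.\<close>
  have "g (\<lambda>j. 0) \<in> k" by (rule pfun_value_in[OF kr subset_refl _ fg(2)]) (rule k'(2))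
  then have gk: "inverse (g b) \<in> k" using g_const[of "\<lambda>j. 0"] k'(8) by simp
  have "(\<lambda>x. inverse (g b) * f x) \<in> ?P" by (rule pfun.mult[OF pfun.const[OF gk] fg(1)])
  moreover have "inverse (g b) * f (\<lambda>j. p j x) = x i" for x
    using gen_id[OF fg(1,2,4), of x] g_const[of "\<lambda>j. p j x"] fg(3) by simp
  ultimately show ?thesis by (intro bexI[of _ "\<lambda>x. inverse (g b) * f x"]) auto
qed

section \<open>Commutative polynomials\<close>

text \<open>Linear extension of a function on monomials. Scalar evaluation and every single entry of
  a matrix evaluation are instances, so sums and products are treated once.\<close>

definition lin :: "('m \<Rightarrow> complex) \<Rightarrow> ('m \<Rightarrow>\<^sub>0 complex) \<Rightarrow> complex" where
  "lin h p = (\<Sum>m\<in>Poly_Mapping.keys p. Poly_Mapping.lookup p m * h m)"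

lemma lin_superset:
  assumes "finite A" "Poly_Mapping.keys p \<subseteq> A"
  shows "lin h p = (\<Sum>m\<in>A. Poly_Mapping.lookup p m * h m)"
  unfolding lin_def using assms by (intro sum.mono_neutral_left) (auto simp: in_keys_iff)

lemma lin_zero: "lin h 0 = 0"
  by (simp add: lin_def)

lemma lin_add: "lin h (p + q) = lin h p + lin h q"
proof -
  let ?A = "Poly_Mapping.keys p \<union> Poly_Mapping.keys q"
  have A: "finite ?A" by simp
  show ?thesis
    unfolding lin_superset[OF A Poly_Mapping.keys_add] lin_superset[OF A Un_upper1] lin_superset[OF A Un_upper2]
    by (simp add: lookup_add distrib_right sum.distrib)
qed

lemma lin_sum: "lin h (sum f I) = (\<Sum>i\<in>I. lin h (f i))"
  by (induction I rule: infinite_finite_induct) (simp_all add: lin_zero lin_add)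

lemma lin_single: "lin h (Poly_Mapping.single m c) = c * h m"
  by (simp add: lin_def)

lemma sum_single_lookup:
  "(\<Sum>m\<in>Poly_Mapping.keys p. Poly_Mapping.single m (Poly_Mapping.lookup p m)) = p"
proof (rule poly_mapping_eqI)
  fix a
  have "Poly_Mapping.lookup (\<Sum>m\<in>Poly_Mapping.keys p. Poly_Mapping.single m (Poly_Mapping.lookup p m)) a =
      (\<Sum>m\<in>Poly_Mapping.keys p. if m = a then Poly_Mapping.lookup p a else 0)"
    unfolding lookup_sum by (intro sum.cong) (auto simp: lookup_single when_def)
  then show "Poly_Mapping.lookup (\<Sum>m\<in>Poly_Mapping.keys p. Poly_Mapping.single m (Poly_Mapping.lookup p m)) a =
      Poly_Mapping.lookup p a"
    by (simp add: sum.delta' in_keys_iff)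
qed

lemma lin_mult:
  "lin h (p * q) = (\<Sum>m\<in>Poly_Mapping.keys p. \<Sum>m'\<in>Poly_Mapping.keys q.
     Poly_Mapping.lookup p m * Poly_Mapping.lookup q m' * h (m + m'))"
proof -
  have "p * q = (\<Sum>m\<in>Poly_Mapping.keys p. Poly_Mapping.single m (Poly_Mapping.lookup p m)) *
      (\<Sum>m\<in>Poly_Mapping.keys q. Poly_Mapping.single m (Poly_Mapping.lookup q m))"
    by (simp add: sum_single_lookup)
  also have "\<dots> = (\<Sum>m\<in>Poly_Mapping.keys p. \<Sum>m'\<in>Poly_Mapping.keys q.
      Poly_Mapping.single (m + m') (Poly_Mapping.lookup p m * Poly_Mapping.lookup q m'))"
    by (simp add: sum_product mult_single)
  finally show ?thesis by (simp add: lin_sum lin_single)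
qed

definition ev :: "nat \<Rightarrow> cpoly \<Rightarrow> (nat \<Rightarrow> complex) \<Rightarrow> complex" where
  "ev N p x = lin (\<lambda>m. \<Prod>i<N. x i ^ Poly_Mapping.lookup m i) p"

lemma ev_add: "ev N (p + q) x = ev N p x + ev N q x"
  by (simp add: ev_def lin_add)

lemma ev_mult: "ev N (p * q) x = ev N p x * ev N q x"
  by (simp add: ev_def lin_mult lookup_add power_add prod.distrib)
    (simp add: lin_def sum_product mult_ac)

abbreviation cp_const :: "complex \<Rightarrow> cpoly" where
  "cp_const c \<equiv> Poly_Mapping.single 0 c"

abbreviation cp_var :: "nat \<Rightarrow> cpoly" where
  "cp_var i \<equiv> Poly_Mapping.single (Poly_Mapping.single i 1) 1"

lemma ev_const: "ev N (cp_const c) x = c"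
  by (simp add: ev_def lin_single)

lemma ev_var:
  assumes "i < N" shows "ev N (cp_var i) x = x i"
proof -
  have "(\<Prod>j<N. x j ^ Poly_Mapping.lookup (Poly_Mapping.single i (1::nat)) j) = (\<Prod>j<N. if j = i then x i else 1)"
    by (intro prod.cong) (auto simp: lookup_single when_def)
  then show ?thesis using assms by (simp add: ev_def lin_single prod.delta)
qed

lemma poly_in_vars_add: "poly_in_vars N p \<Longrightarrow> poly_in_vars N q \<Longrightarrow> poly_in_vars N (p + q)"
  unfolding poly_in_vars_def using Poly_Mapping.keys_add[of p q] by blast

lemma poly_in_vars_mult:
  assumes "poly_in_vars N p" "poly_in_vars N q" shows "poly_in_vars N (p * q)"
  unfolding poly_in_vars_def
proof
  fix m assume "m \<in> Poly_Mapping.keys (p * q)"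
  then obtain a b where ab: "a \<in> Poly_Mapping.keys p" "b \<in> Poly_Mapping.keys q" "m = a + b"
    using keys_mult[of p q] by blast
  then show "Poly_Mapping.keys m \<subseteq> {..<N}"
    using assms Poly_Mapping.keys_add[of a b] unfolding poly_in_vars_def by blast
qed

lemma poly_in_vars_const: "poly_in_vars N (cp_const c)"
  by (simp add: poly_in_vars_def)

lemma poly_in_vars_var: "i < N \<Longrightarrow> poly_in_vars N (cp_var i)"
  by (simp add: poly_in_vars_def)

lemma poly_in_vars_diff: "poly_in_vars N p \<Longrightarrow> poly_in_vars N q \<Longrightarrow> poly_in_vars N (p - q)"
  unfolding poly_in_vars_def using Poly_Mapping.keys_diff[of p q] by blast

lemma poly_in_vars_zero: "poly_in_vars N 0"
  by (simp add: poly_in_vars_def)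

lemma poly_in_vars_sum: "(\<And>i. i \<in> I \<Longrightarrow> poly_in_vars N (f i)) \<Longrightarrow> poly_in_vars N (sum f I)"
  by (induction I rule: infinite_finite_induct) (simp_all add: poly_in_vars_add poly_in_vars_zero)

lemma poly_in_vars_power: "poly_in_vars N p \<Longrightarrow> poly_in_vars N (p ^ k)"
  by (induction k) (auto intro: poly_in_vars_mult simp: poly_in_vars_const simp flip: single_one)

lemma ev_in_pfun:
  assumes k: "is_subring k" and "\<And>m. Poly_Mapping.lookup p m \<in> k"
  shows "ev N p \<in> pfun k {..<N}"
proof -
  note kk = is_subringD(1,2)[OF k]
  have "(\<lambda>x. \<Prod>i<M. x i ^ Poly_Mapping.lookup m i) \<in> pfun k {..<N}" if "M \<le> N" for m M
    using that
  proof (induction M)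
    case 0
    then show ?case using kk by (simp add: pfun.const)
  next
    case (Suc M)
    then have "(\<lambda>x. (\<Prod>i<M. x i ^ Poly_Mapping.lookup m i) * x M ^ Poly_Mapping.lookup m M) \<in> pfun k {..<N}"
      by (intro pfun.mult pfun_power kk pfun.coord) auto
    then show ?case by simp
  qed
  then have "(\<lambda>x. \<Sum>m\<in>Poly_Mapping.keys p. Poly_Mapping.lookup p m * (\<Prod>i<N. x i ^ Poly_Mapping.lookup m i)) \<in> pfun k {..<N}"
    by (intro pfun_sum kk pfun.mult pfun.const assms(2)) auto
  then show ?thesis unfolding ev_def lin_def .
qed

lemma pfun_as_ev: "F \<in> pfun k {..<N} \<Longrightarrow> \<exists>p. poly_in_vars N p \<and> (\<forall>x. ev N p x = F x)"
proof (induction rule: pfun.induct)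
  case (const c)
  then show ?case using poly_in_vars_const ev_const by blast
next
  case (coord j)
  then show ?case using poly_in_vars_var ev_var by blast
next
  case (add F G)
  then show ?case using poly_in_vars_add ev_add by metis
next
  case (mult F G)
  then show ?case using poly_in_vars_mult ev_mult by metis
qed

text \<open>Viewed as a polynomial in the last variable, the sum has vanishing coefficients. The
  coefficient at the last exponent of \<open>m\<close> is a relation among the monomials sharing
  that exponent, in one variable fewer.\<close>

lemma monomials_independent:
  fixes c :: "(nat \<Rightarrow>\<^sub>0 nat) \<Rightarrow> complex"
  assumes "finite M" "\<And>m m'. m \<in> M \<Longrightarrow> m' \<in> M \<Longrightarrow> \<forall>i<N. Poly_Mapping.lookup m i = Poly_Mapping.lookup m' i \<Longrightarrow> m = m'"
    "\<And>x. (\<Sum>m\<in>M. c m * (\<Prod>i<N. x i ^ Poly_Mapping.lookup m i)) = 0" "m \<in> M"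
  shows "c m = 0"
  using assms
proof (induction N arbitrary: M)
  case 0
  then have "M = {m}" by auto
  then show ?case using 0(3) by simp
next
  case (Suc N)
  define M' where "M' = {m' \<in> M. Poly_Mapping.lookup m' N = Poly_Mapping.lookup m N}"
  have M': "(\<Sum>m\<in>M'. c m * (\<Prod>i<N. x i ^ Poly_Mapping.lookup m i)) = 0" for x
  proof -
    define u where "u = (\<Sum>m\<in>M. monom (c m * (\<Prod>i<N. x i ^ Poly_Mapping.lookup m i)) (Poly_Mapping.lookup m N))"
    have "poly u t = 0" for t
    proof -
      have "poly u t = (\<Sum>m\<in>M. c m * (\<Prod>i<Suc N. (x(N := t)) i ^ Poly_Mapping.lookup m i))"
        unfolding u_def poly_sum by (intro sum.cong refl) (simp add: poly_monom mult_ac)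
      then show ?thesis using Suc.prems(3)[of "x(N := t)"] by (simp only:)
    qed
    then have "u = 0" using poly_all_0_iff_0 by blast
    then have "0 = coeff u (Poly_Mapping.lookup m N)" by simp
    also have "\<dots> = (\<Sum>m'\<in>M. if Poly_Mapping.lookup m' N = Poly_Mapping.lookup m N
        then c m' * (\<Prod>i<N. x i ^ Poly_Mapping.lookup m' i) else 0)"
      unfolding u_def coeff_sum by (intro sum.cong refl) simp
    also have "\<dots> = (\<Sum>m'\<in>M'. c m' * (\<Prod>i<N. x i ^ Poly_Mapping.lookup m' i))"
      unfolding M'_def using Suc.prems(1) by (simp add: sum.inter_filter)
    finally show ?thesis by simp
  qed
  show ?case
  proof (rule Suc.IH[of M'])
    show "a = b" if "a \<in> M'" "b \<in> M'" "\<forall>i<N. Poly_Mapping.lookup a i = Poly_Mapping.lookup b i" for a b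
      using that Suc.prems(2)[of a b] unfolding M'_def by (auto simp: less_Suc_eq)
  qed (use Suc.prems M' in \<open>auto simp: M'_def\<close>)
qed

text \<open>Bridges scalar values and formal polynomials. All exponents beyond \<open>N\<close> are
  zero, so the first \<open>N\<close> determine a monomial.\<close>

lemma ev_eq_zero_imp:
  assumes p: "poly_in_vars N p" and "\<And>x. ev N p x = 0" shows "p = 0"
proof (rule ccontr)
  assume "p \<noteq> 0"
  then obtain m where m: "m \<in> Poly_Mapping.keys p" by fastforce
  have "Poly_Mapping.lookup p m = 0"
  proof (rule monomials_independent[where M = "Poly_Mapping.keys p" and N = N])
    fix a b assume ab: "a \<in> Poly_Mapping.keys p" "b \<in> Poly_Mapping.keys p"
      "\<forall>i<N. Poly_Mapping.lookup a i = Poly_Mapping.lookup b i"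
    have "Poly_Mapping.lookup a i = Poly_Mapping.lookup b i" for i
    proof (cases "i < N")
      case False
      then have "i \<notin> Poly_Mapping.keys a" "i \<notin> Poly_Mapping.keys b" using ab(1,2) p unfolding poly_in_vars_def by auto
      then show ?thesis by (simp add: in_keys_iff)
    qed (use ab in auto)
    then show "a = b" by (intro poly_mapping_eqI)
  qed (use assms(2) m in \<open>auto simp: ev_def lin_def\<close>)
  then show False using m by (simp add: in_keys_iff)
qed

lemma ev_eq_imp:
  assumes "poly_in_vars N p" "poly_in_vars N q" "\<And>x. ev N p x = ev N q x" shows "p = q"
proof -
  have "ev N (p - q) x = 0" for x using ev_add[of N "p - q" q x] assms(3)[of x] by simp
  then show ?thesis using ev_eq_zero_imp[of N "p - q"] poly_in_vars_diff assms by auto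
qed

text \<open>The product is folded in the same order as in \<open>mono_eval\<close>, so that
  evaluation of a substitution is proved by induction over the list of variables.\<close>

definition cp_subst :: "nat \<Rightarrow> cpoly \<Rightarrow> (nat \<Rightarrow> cpoly) \<Rightarrow> cpoly" where
  "cp_subst N q P = (\<Sum>m\<in>Poly_Mapping.keys q. cp_const (Poly_Mapping.lookup q m) *
     foldr (\<lambda>j A. P j ^ Poly_Mapping.lookup m j * A) [0..<N] 1)"

lemma poly_in_vars_subst:
  assumes "\<And>j. j < N \<Longrightarrow> poly_in_vars N (P j)" shows "poly_in_vars N (cp_subst N q P)"
proof -
  have *: "poly_in_vars N (foldr (\<lambda>j A. P j ^ Poly_Mapping.lookup m j * A) xs 1)" if "set xs \<subseteq> {..<N}" for m xs
    using that by (induction xs) (auto intro!: poly_in_vars_mult poly_in_vars_power assms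
        simp: poly_in_vars_const simp flip: single_one)
  show ?thesis unfolding cp_subst_def
    by (intro poly_in_vars_sum poly_in_vars_mult poly_in_vars_const *) auto
qed

section \<open>Evaluation at commuting matrices\<close>

text \<open>Generalizes \<open>mono_eval\<close> from \<open>[0..<N]\<close> to any list of
  variables, as the inductions require.\<close>

definition mono_list :: "nat list \<Rightarrow> nat \<Rightarrow> (nat \<Rightarrow>\<^sub>0 nat) \<Rightarrow> (nat \<Rightarrow> complex mat) \<Rightarrow> complex mat" where
  "mono_list xs n m X = foldr (\<lambda>i A. X i ^\<^sub>m Poly_Mapping.lookup m i * A) xs (1\<^sub>m n)"

lemma mono_list_simps:
  "mono_list [] n m X = 1\<^sub>m n"
  "mono_list (i # xs) n m X = X i ^\<^sub>m Poly_Mapping.lookup m i * mono_list xs n m X"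
  by (simp_all add: mono_list_def)

lemma mono_eval_list: "mono_eval N n m X = mono_list [0..<N] n m X"
  by (simp add: mono_eval_def mono_list_def)

lemma mono_list_carrier:
  "(\<And>i. i \<in> set xs \<Longrightarrow> X i \<in> carrier_mat n n) \<Longrightarrow> mono_list xs n m X \<in> carrier_mat n n"
  by (induction xs) (auto simp: mono_list_simps intro!: mult_carrier_mat pow_carrier_mat)

lemma pow_mat_intertwine:
  fixes T :: "complex mat"
  assumes T: "T \<in> carrier_mat m n" and A: "A \<in> carrier_mat n n" and B: "B \<in> carrier_mat m m"
    and eq: "T * A = B * T"
  shows "T * A ^\<^sub>m k = B ^\<^sub>m k * T"
proof (induction k)
  case 0
  then show ?case using assms by simp
next
  case (Suc k)
  have Ak: "A ^\<^sub>m k \<in> carrier_mat n n" and Bk: "B ^\<^sub>m k \<in> carrier_mat m m" using A B by auto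
  have "T * (A ^\<^sub>m k * A) = (B ^\<^sub>m k * T) * A" using assoc_mult_mat[OF T Ak A] Suc by simp
  also have "\<dots> = B ^\<^sub>m k * (B * T)" using assoc_mult_mat[OF Bk T A] eq by simp
  also have "\<dots> = (B ^\<^sub>m k * B) * T" using assoc_mult_mat[OF Bk B T] by simp
  finally show ?case by simp
qed

lemma mono_list_intertwine:
  assumes T: "T \<in> carrier_mat m n"
    and X: "\<And>i. i \<in> set xs \<Longrightarrow> X i \<in> carrier_mat n n" and Y: "\<And>i. i \<in> set xs \<Longrightarrow> Y i \<in> carrier_mat m m"
    and eq: "\<And>i. i \<in> set xs \<Longrightarrow> T * X i = Y i * T"
  shows "T * mono_list xs n e X = mono_list xs m e Y * T"
  using X Y eq
proof (induction xs)
  case Nil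
  then show ?case using T by (simp add: mono_list_simps)
next
  case (Cons i xs)
  let ?k = "Poly_Mapping.lookup e i"
  have c: "X i ^\<^sub>m ?k \<in> carrier_mat n n" "Y i ^\<^sub>m ?k \<in> carrier_mat m m"
    "mono_list xs n e X \<in> carrier_mat n n" "mono_list xs m e Y \<in> carrier_mat m m"
    using Cons.prems by (auto intro!: mono_list_carrier pow_carrier_mat)
  have p: "T * X i ^\<^sub>m ?k = Y i ^\<^sub>m ?k * T"
    using Cons.prems by (intro pow_mat_intertwine[OF T]) auto
  have IH: "T * mono_list xs n e X = mono_list xs m e Y * T" using Cons by simp
  have "T * (X i ^\<^sub>m ?k * mono_list xs n e X) = (Y i ^\<^sub>m ?k * T) * mono_list xs n e X"
    using assoc_mult_mat[OF T c(1,3)] p by simp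
  also have "\<dots> = Y i ^\<^sub>m ?k * (mono_list xs m e Y * T)" using assoc_mult_mat[OF c(2) T c(3)] IH by simp
  also have "\<dots> = (Y i ^\<^sub>m ?k * mono_list xs m e Y) * T" using assoc_mult_mat[OF c(2,4) T] by simp
  finally show ?case by (simp add: mono_list_simps)
qed

lemma pow_mat_add:
  assumes "A \<in> carrier_mat n n" shows "A ^\<^sub>m (a + b) = A ^\<^sub>m a * (A ^\<^sub>m b :: complex mat)"
proof (induction b)
  case 0
  have "A ^\<^sub>m a \<in> carrier_mat n n" using assms by auto
  then show ?case using assms by simp
next
  case (Suc b)
  have "A ^\<^sub>m a \<in> carrier_mat n n" "A ^\<^sub>m b \<in> carrier_mat n n" using assms by auto
  then show ?case using Suc assms by (simp add: assoc_mult_mat[of _ n n _ n _ n])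
qed

lemma mono_list_add:
  assumes X: "\<And>i. i \<in> set xs \<Longrightarrow> X i \<in> carrier_mat n n"
    and comm: "\<And>i j. i \<in> set xs \<Longrightarrow> j \<in> set xs \<Longrightarrow> X i * X j = X j * X i"
  shows "mono_list xs n (a + b) X = mono_list xs n a X * mono_list xs n b X"
  using assms
proof (induction xs)
  case Nil
  then show ?case by (simp add: mono_list_simps)
next
  case (Cons i xs)
  let ?A = "X i ^\<^sub>m Poly_Mapping.lookup a i" and ?B = "X i ^\<^sub>m Poly_Mapping.lookup b i"
  let ?M = "mono_list xs n a X" and ?M' = "mono_list xs n b X"
  have Xi: "X i \<in> carrier_mat n n" using Cons.prems by simp
  then have AB: "?A \<in> carrier_mat n n" "?B \<in> carrier_mat n n" by auto
  have M: "?M \<in> carrier_mat n n" "?M' \<in> carrier_mat n n" using Cons.prems by (auto intro: mono_list_carrier)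
  have "?M * X i = X i * ?M"
    using mono_list_intertwine[of "X i" n n xs X X a] Cons.prems by simp
  then have c: "?M * ?B = ?B * ?M" by (rule pow_mat_intertwine[OF M(1) Xi Xi])
  have IH: "mono_list xs n (a + b) X = ?M * ?M'" using Cons by simp
  have "mono_list (i # xs) n (a + b) X = (?A * ?B) * (?M * ?M')"
    by (simp add: mono_list_simps IH lookup_add pow_mat_add[OF Xi])
  also have "\<dots> = ?A * ((?B * ?M) * ?M')"
    using AB M by (simp add: assoc_mult_mat[of _ n n _ n _ n])
  also have "\<dots> = (?A * ?M) * (?B * ?M')"
    using AB M by (simp add: c[symmetric] assoc_mult_mat[of _ n n _ n _ n])
  finally show ?case by (simp add: mono_list_simps)
qed

lemma index_mult_mat_sum:
  assumes "A \<in> carrier_mat n m" "B \<in> carrier_mat m k" "i < n" "j < k"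
  shows "(A * B) $$ (i, j) = (\<Sum>l<m. A $$ (i, l) * B $$ (l, j))"
  using assms by (auto simp: scalar_prod_def atLeast0LessThan intro!: sum.cong)

lemma peval_carrier [simp]: "peval N n p X \<in> carrier_mat n n"
  by (simp add: peval_def)

lemma peval_index:
  "i < n \<Longrightarrow> j < n \<Longrightarrow> peval N n p X $$ (i, j) = lin (\<lambda>m. mono_eval N n m X $$ (i, j)) p"
  by (simp add: peval_def lin_def)

lemma lin_linear: "lin (\<lambda>m. \<Sum>l\<in>L. c l * h l m) p = (\<Sum>l\<in>L. c l * lin (h l) p)"
  unfolding lin_def by (simp add: sum_distrib_left mult_ac) (rule sum.swap)

text \<open>Used with different \<open>T\<close>: entries of a commuting tuple show that its
  polynomial values commute, and an invertible \<open>T\<close> gives compatibility with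
  similarity.\<close>

lemma peval_intertwine:
  assumes T: "T \<in> carrier_mat m n"
    and X: "\<And>i. i < N \<Longrightarrow> X i \<in> carrier_mat n n" and Y: "\<And>i. i < N \<Longrightarrow> Y i \<in> carrier_mat m m"
    and eq: "\<And>i. i < N \<Longrightarrow> T * X i = Y i * T"
  shows "T * peval N n p X = peval N m p Y * T"
proof (rule eq_matI)
  fix i j assume "i < dim_row (peval N m p Y * T)" "j < dim_col (peval N m p Y * T)"
  then have ij: "i < m" "j < n" using T by (auto simp: peval_def)
  have cX: "mono_eval N n e X \<in> carrier_mat n n" and cY: "mono_eval N m e Y \<in> carrier_mat m m" for e
    unfolding mono_eval_list using X Y by (auto intro!: mono_list_carrier)
  have "(T * peval N n p X) $$ (i, j) = (\<Sum>l<n. T $$ (i, l) * lin (\<lambda>e. mono_eval N n e X $$ (l, j)) p)"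
    using index_mult_mat_sum[OF T peval_carrier ij] ij(2) by (simp add: peval_index)
  also have "\<dots> = lin (\<lambda>e. (T * mono_eval N n e X) $$ (i, j)) p"
    using index_mult_mat_sum[OF T cX ij] by (simp add: lin_linear)
  also have "\<dots> = lin (\<lambda>e. (mono_eval N m e Y * T) $$ (i, j)) p"
    unfolding mono_eval_list using mono_list_intertwine[OF T, of "[0..<N]" X Y] X Y eq by simp
  also have "\<dots> = (\<Sum>l<m. T $$ (l, j) * lin (\<lambda>e. mono_eval N m e Y $$ (i, l)) p)"
    using index_mult_mat_sum[OF cY T ij] by (simp add: lin_linear[symmetric] mult.commute)
  also have "\<dots> = (peval N m p Y * T) $$ (i, j)"
    using index_mult_mat_sum[OF peval_carrier T ij] ij(1) by (simp add: peval_index mult.commute)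
  finally show "(T * peval N n p X) $$ (i, j) = (peval N m p Y * T) $$ (i, j)" .
qed (use T in \<open>auto simp: peval_def\<close>)

lemma peval_cong:
  assumes "\<And>i. i < N \<Longrightarrow> X i = Y i" shows "peval N n p X = peval N n p Y"
proof -
  have "mono_list xs n m X = mono_list xs n m Y" if "set xs \<subseteq> {..<N}" for xs m
    using that assms by (induction xs) (auto simp: mono_list_simps)
  from this[of "[0..<N]"] have "mono_eval N n m X = mono_eval N n m Y" for m
    unfolding mono_eval_list by (simp add: lessThan_atLeast0)
  then show ?thesis unfolding peval_def by simp
qed

lemma peval_sum_index:
  "i < n \<Longrightarrow> j < n \<Longrightarrow> peval N n (sum f I) X $$ (i, j) = (\<Sum>a\<in>I. peval N n (f a) X $$ (i, j))"
  by (simp add: peval_index lin_sum)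

lemma peval_const:
  assumes "\<And>i. i < N \<Longrightarrow> X i \<in> carrier_mat n n"
  shows "peval N n (cp_const c) X = c \<cdot>\<^sub>m 1\<^sub>m n"
proof -
  have "mono_list xs n 0 X = 1\<^sub>m n" if "set xs \<subseteq> {..<N}" for xs
    using that
  proof (induction xs)
    case (Cons i xs)
    then have "X i \<in> carrier_mat n n" using assms by simp
    then show ?case using Cons by (simp add: mono_list_simps)
  qed (simp add: mono_list_simps)
  from this[of "[0..<N]"] have "mono_eval N n 0 X = 1\<^sub>m n"
    unfolding mono_eval_list by (simp add: lessThan_atLeast0)
  then show ?thesis by (intro eq_matI) (auto simp: peval_index lin_single peval_def[of _ _ _ X])
qed

lemma peval_var:
  assumes X: "\<And>i. i < N \<Longrightarrow> X i \<in> carrier_mat n n" and i: "i < N"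
  shows "peval N n (cp_var i) X = X i"
proof -
  have "mono_list xs n (Poly_Mapping.single i 1) X = (if i \<in> set xs then X i else 1\<^sub>m n)"
    if "set xs \<subseteq> {..<N}" "distinct xs" for xs
    using that
  proof (induction xs)
    case (Cons j xs)
    then have Xj: "X j \<in> carrier_mat n n" "X i \<in> carrier_mat n n" using X i by auto
    show ?case using Cons Xj by (cases "j = i") (auto simp: mono_list_simps lookup_single)
  qed (simp add: mono_list_simps)
  then have "mono_eval N n (Poly_Mapping.single i 1) X = X i" unfolding mono_eval_list using i by (simp add: subset_iff)
  then show ?thesis using X[OF i] by (intro eq_matI) (auto simp: peval_index lin_single peval_def[of _ _ _ X])
qed

lemma ctupleD:
  assumes "ctuple N n X"
  shows "i < N \<Longrightarrow> X i \<in> carrier_mat n n" "i < N \<Longrightarrow> j < N \<Longrightarrow> X i * X j = X j * X i"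
  using assms unfolding ctuple_def by auto

lemma peval_mult:
  assumes X: "ctuple N n X"
  shows "peval N n (p * q) X = peval N n p X * peval N n q X"
proof (rule eq_matI)
  fix i j assume "i < dim_row (peval N n p X * peval N n q X)" "j < dim_col (peval N n p X * peval N n q X)"
  then have ij: "i < n" "j < n" by (auto simp: peval_def)
  have c: "mono_eval N n e X \<in> carrier_mat n n" for e
    unfolding mono_eval_list using ctupleD[OF X] by (auto intro!: mono_list_carrier)
  have "mono_eval N n (a + b) X = mono_eval N n a X * mono_eval N n b X" for a b
    unfolding mono_eval_list using ctupleD[OF X] by (intro mono_list_add) auto
  then have "peval N n (p * q) X $$ (i, j) = (\<Sum>a\<in>Poly_Mapping.keys p. \<Sum>b\<in>Poly_Mapping.keys q.
      Poly_Mapping.lookup p a * Poly_Mapping.lookup q b * (\<Sum>l<n. mono_eval N n a X $$ (i, l) * mono_eval N n b X $$ (l, j)))"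
    using ij by (simp add: peval_index lin_mult index_mult_mat_sum[OF c c ij])
  also have "\<dots> = (\<Sum>a\<in>Poly_Mapping.keys p. \<Sum>b\<in>Poly_Mapping.keys q. \<Sum>l<n.
      (Poly_Mapping.lookup p a * mono_eval N n a X $$ (i, l)) * (Poly_Mapping.lookup q b * mono_eval N n b X $$ (l, j)))"
    by (simp add: sum_distrib_left mult_ac)
  also have "\<dots> = (\<Sum>a\<in>Poly_Mapping.keys p. \<Sum>l<n. \<Sum>b\<in>Poly_Mapping.keys q.
      (Poly_Mapping.lookup p a * mono_eval N n a X $$ (i, l)) * (Poly_Mapping.lookup q b * mono_eval N n b X $$ (l, j)))"
    by (intro sum.cong refl sum.swap)
  also have "\<dots> = (\<Sum>l<n. \<Sum>a\<in>Poly_Mapping.keys p. \<Sum>b\<in>Poly_Mapping.keys q.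
      (Poly_Mapping.lookup p a * mono_eval N n a X $$ (i, l)) * (Poly_Mapping.lookup q b * mono_eval N n b X $$ (l, j)))"
    by (rule sum.swap)
  also have "\<dots> = (\<Sum>l<n. peval N n p X $$ (i, l) * peval N n q X $$ (l, j))"
    using ij by (simp add: peval_index lin_def sum_product)
  also have "\<dots> = (peval N n p X * peval N n q X) $$ (i, j)"
    using index_mult_mat_sum[OF peval_carrier peval_carrier ij] by simp
  finally show "peval N n (p * q) X $$ (i, j) = (peval N n p X * peval N n q X) $$ (i, j)" .
qed (auto simp: peval_def)

lemma peval_one:
  assumes "ctuple N n X" shows "peval N n 1 X = 1\<^sub>m n"
  using peval_const[of N X n 1] ctupleD(1)[OF assms] by (simp add: single_one) (auto intro: eq_matI)

lemma peval_power:
  assumes X: "ctuple N n X" shows "peval N n (p ^ k) X = peval N n p X ^\<^sub>m k"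
proof (induction k)
  case 0
  then show ?case using peval_one[OF X] by (simp add: peval_def)
next
  case (Suc k)
  have "peval N n (p ^ Suc k) X = peval N n (p ^ k * p) X" by (simp add: mult.commute)
  then show ?case using Suc by (simp add: peval_mult[OF X])
qed

lemma pmap_eval_carrier: "pmap_eval N n P X j \<in> carrier_mat n n"
  by (simp add: pmap_eval_def)

text \<open>Two applications of intertwining: a value commutes with each \<open>X j\<close>, and
  then, taken as intertwiner itself, with every other value.\<close>

lemma ctuple_pmap_eval:
  assumes X: "ctuple N n X" shows "ctuple N n (pmap_eval N n P X)"
proof -
  note D = ctupleD[OF X]
  have 1: "peval N n p X * X j = X j * peval N n p X" if "j < N" for p j
    using peval_intertwine[OF D(1)[OF that], of N X X p] D that by simp
  have "peval N n q X * peval N n p X = peval N n p X * peval N n q X" for p q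
    using peval_intertwine[of "peval N n p X" n n N X X q] D 1 by simp
  then show ?thesis unfolding ctuple_def pmap_eval_def by simp
qed

lemma peval_subst:
  assumes X: "ctuple N n X"
  shows "peval N n (cp_subst N q P) X = peval N n q (pmap_eval N n P X)"
proof (rule eq_matI)
  fix i j assume "i < dim_row (peval N n q (pmap_eval N n P X))" "j < dim_col (peval N n q (pmap_eval N n P X))"
  then have ij: "i < n" "j < n" by (auto simp: peval_def)
  have "peval N n (foldr (\<lambda>j A. P j ^ Poly_Mapping.lookup m j * A) xs 1) X = mono_list xs n m (pmap_eval N n P X)"
    if "set xs \<subseteq> {..<N}" for xs m
    using that by (induction xs) (simp_all add: mono_list_simps peval_one[OF X] peval_mult[OF X] peval_power[OF X] pmap_eval_def)
  from this[of "[0..<N]"] have f: "peval N n (foldr (\<lambda>j A. P j ^ Poly_Mapping.lookup m j * A) [0..<N] 1) X =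
      mono_eval N n m (pmap_eval N n P X)" for m
    unfolding mono_eval_list by (simp add: subset_iff)
  have c: "mono_eval N n m (pmap_eval N n P X) \<in> carrier_mat n n" for m
    unfolding mono_eval_list by (intro mono_list_carrier pmap_eval_carrier)
  have "c \<cdot>\<^sub>m 1\<^sub>m n * mono_eval N n m (pmap_eval N n P X) = c \<cdot>\<^sub>m mono_eval N n m (pmap_eval N n P X)" for c m
    using c[of m] by (simp add: mult_smult_assoc_mat[of _ n n _ n])
  then show "peval N n (cp_subst N q P) X $$ (i, j) = peval N n q (pmap_eval N n P X) $$ (i, j)"
    using ij c ctupleD(1)[OF X]
    by (simp add: cp_subst_def peval_sum_index peval_mult[OF X] peval_const f)
      (simp add: peval_def carrier_matD[OF c])
qed (auto simp: peval_def)

definition scalar_tuple :: "(nat \<Rightarrow> complex) \<Rightarrow> nat \<Rightarrow> complex mat" where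
  "scalar_tuple x i = mat 1 1 (\<lambda>_. x i)"

lemma mat_1_1_mult: "mat 1 1 (\<lambda>_. a) * mat 1 1 (\<lambda>_. b) = mat 1 1 (\<lambda>_. a * b :: complex)"
  by (rule eq_matI) (auto simp: scalar_prod_def)

lemma ctuple_scalar_tuple: "ctuple N 1 (scalar_tuple x)"
  unfolding ctuple_def scalar_tuple_def by (auto simp only: mat_1_1_mult mult.commute mat_carrier)

lemma peval_scalar_tuple: "peval N 1 p (scalar_tuple x) = mat 1 1 (\<lambda>_. ev N p x)"
proof -
  have pow: "mat 1 1 (\<lambda>_. a) ^\<^sub>m k = mat 1 1 (\<lambda>_. a ^ k)" for a :: complex and k
  proof (induction k)
    case 0
    then show ?case by (intro eq_matI) auto
  next
    case (Suc k)
    then show ?case by (simp add: mat_1_1_mult mult.commute del: One_nat_def)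
  qed
  have one: "1\<^sub>m 1 = mat 1 1 (\<lambda>_. 1 :: complex)" by (intro eq_matI) auto
  have "mono_list [0..<M] 1 m (scalar_tuple x) = mat 1 1 (\<lambda>_. \<Prod>i<M. x i ^ Poly_Mapping.lookup m i)" for M m
  proof -
    have "mono_list xs 1 m (scalar_tuple x) = mat 1 1 (\<lambda>_. \<Prod>i\<leftarrow>xs. x i ^ Poly_Mapping.lookup m i)" for xs
      by (induction xs) (simp_all only: mono_list_simps one scalar_tuple_def pow mat_1_1_mult list.map prod_list.Nil prod_list.Cons)
    moreover have "(\<Prod>i\<leftarrow>[0..<M]. x i ^ Poly_Mapping.lookup m i) = (\<Prod>i<M. x i ^ Poly_Mapping.lookup m i)"
      by (induction M) (simp_all add: mult.commute)
    ultimately show ?thesis by simp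
  qed
  then show ?thesis
    unfolding peval_def mono_eval_list ev_def lin_def by (intro eq_matI) auto
qed

text \<open>Read off from the matrix statement at \<open>1 \<times> 1\<close> tuples.\<close>

lemma ev_subst: "ev N (cp_subst N q P) x = ev N q (\<lambda>j. ev N (P j) x)"
proof -
  have "mat 1 1 (\<lambda>_. ev N (cp_subst N q P) x) = peval N 1 q (pmap_eval N 1 P (scalar_tuple x))"
    using peval_subst[OF ctuple_scalar_tuple] peval_scalar_tuple by metis
  also have "\<dots> = peval N 1 q (scalar_tuple (\<lambda>j. ev N (P j) x))"
    by (rule peval_cong) (simp add: pmap_eval_def peval_scalar_tuple scalar_tuple_def del: One_nat_def)
  also have "\<dots> = mat 1 1 (\<lambda>_. ev N q (\<lambda>j. ev N (P j) x))" by (rule peval_scalar_tuple)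
  finally have "mat 1 1 (\<lambda>_. ev N (cp_subst N q P) x) $$ (0, 0) = mat 1 1 (\<lambda>_. ev N q (\<lambda>j. ev N (P j) x)) $$ (0, 0)"
    by simp
  then show ?thesis by simp
qed

section \<open>Block triangular matrices, similarity and commutators\<close>

lemma four_block_mat_eq_iff:
  assumes "A \<in> carrier_mat n n" "B \<in> carrier_mat n m" "C \<in> carrier_mat m n" "D \<in> carrier_mat m m"
    and "A' \<in> carrier_mat n n" "B' \<in> carrier_mat n m" "C' \<in> carrier_mat m n" "D' \<in> carrier_mat m m"
  shows "four_block_mat A B C D = four_block_mat A' B' C' D' \<longleftrightarrow> A = A' \<and> B = B' \<and> C = C' \<and> D = D'"
proof
  assume eq: "four_block_mat A B C D = four_block_mat A' B' C' D'"
  note d = assms[THEN carrier_matD(1)] assms[THEN carrier_matD(2)]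
  have ix: "four_block_mat A B C D $$ (i, j) = four_block_mat A' B' C' D' $$ (i, j)" for i j using eq by simp
  have "A $$ (i, j) = A' $$ (i, j)" if "i < n" "j < n" for i j
    using ix[of i j] that by (simp add: d)
  then have "A = A'" by (intro eq_matI) (simp_all add: d)
  moreover have "B $$ (i, j) = B' $$ (i, j)" if "i < n" "j < m" for i j
    using ix[of i "j + n"] that by (simp add: d)
  then have "B = B'" by (intro eq_matI) (simp_all add: d)
  moreover have "C $$ (i, j) = C' $$ (i, j)" if "i < m" "j < n" for i j
    using ix[of "i + n" j] that by (simp add: d)
  then have "C = C'" by (intro eq_matI) (simp_all add: d)
  moreover have "D $$ (i, j) = D' $$ (i, j)" if "i < m" "j < m" for i j
    using ix[of "i + n" "j + n"] that by (simp add: d)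
  then have "D = D'" by (intro eq_matI) (simp_all add: d)
  ultimately show "A = A' \<and> B = B' \<and> C = C' \<and> D = D'" by blast
qed simp

text \<open>The flag \<open>d\<close> requires the off-diagonal block to vanish.\<close>

definition block_upper :: "nat \<Rightarrow> nat \<Rightarrow> bool \<Rightarrow> complex mat \<Rightarrow> complex mat \<Rightarrow> complex mat \<Rightarrow> bool" where
  "block_upper n m d Z A C \<longleftrightarrow> A \<in> carrier_mat n n \<and> C \<in> carrier_mat m m \<and>
     (\<exists>B\<in>carrier_mat n m. Z = four_block_mat A B (0\<^sub>m m n) C \<and> (d \<longrightarrow> B = 0\<^sub>m n m))"

lemma block_upper_one: "block_upper n m d (1\<^sub>m (n + m)) (1\<^sub>m n) (1\<^sub>m m)"
proof -
  have "1\<^sub>m (n + m) = four_block_mat (1\<^sub>m n) (0\<^sub>m n m) (0\<^sub>m m n) (1\<^sub>m m :: complex mat)"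
    by (rule eq_matI) auto
  then show ?thesis unfolding block_upper_def by (metis one_carrier_mat zero_carrier_mat)
qed

lemma block_upper_mult:
  assumes "block_upper n m d Z A C" "block_upper n m d Z' A' C'"
  shows "block_upper n m d (Z * Z') (A * A') (C * C')"
proof -
  obtain B B' where B: "B \<in> carrier_mat n m" "Z = four_block_mat A B (0\<^sub>m m n) C" "d \<longrightarrow> B = 0\<^sub>m n m"
    and B': "B' \<in> carrier_mat n m" "Z' = four_block_mat A' B' (0\<^sub>m m n) C'" "d \<longrightarrow> B' = 0\<^sub>m n m"
    and c: "A \<in> carrier_mat n n" "C \<in> carrier_mat m m" "A' \<in> carrier_mat n n" "C' \<in> carrier_mat m m"
    using assms unfolding block_upper_def by blast
  have z: "0\<^sub>m m n \<in> carrier_mat m n" by simp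
  have "Z * Z' = four_block_mat (A * A') (A * B' + B * C') (0\<^sub>m m n) (C * C')"
    unfolding B(2) B'(2) mult_four_block_mat[OF c(1) B(1) z c(2) c(3) B'(1) z c(4)]
    using c B(1) B'(1) by simp
  moreover have "d \<longrightarrow> A * B' + B * C' = 0\<^sub>m n m" using B(3) B'(3) c by auto
  ultimately show ?thesis unfolding block_upper_def using c B(1) B'(1)
    by (auto intro!: bexI[of _ "A * B' + B * C'"])
qed

lemma block_upper_pow:
  assumes "block_upper n m d Z A C" shows "block_upper n m d (Z ^\<^sub>m k) (A ^\<^sub>m k) (C ^\<^sub>m k)"
proof (induction k)
  case 0
  have "dim_row Z = n + m" "dim_row A = n" "dim_row C = m" using assms unfolding block_upper_def by auto
  then show ?case using block_upper_one[of n m d] by simp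
next
  case (Suc k)
  then show ?case using block_upper_mult[OF Suc assms] by simp
qed

lemma block_upper_mono_list:
  "(\<And>i. i \<in> set xs \<Longrightarrow> block_upper n m d (Z i) (A i) (C i)) \<Longrightarrow>
    block_upper n m d (mono_list xs (n + m) e Z) (mono_list xs n e A) (mono_list xs m e C)"
proof (induction xs)
  case (Cons i xs)
  then have "block_upper n m d (mono_list xs (n + m) e Z) (mono_list xs n e A) (mono_list xs m e C)" by simp
  then show ?case unfolding mono_list_simps using Cons.prems by (intro block_upper_mult block_upper_pow) auto
qed (simp add: mono_list_simps block_upper_one)

text \<open>Diagonal blocks multiply independently of the off-diagonal one. The latter has no such
  simple description and is merely read off as \<open>B\<close>.\<close>

lemma block_upper_peval:
  assumes "\<And>i. i < N \<Longrightarrow> block_upper n m d (Z i) (A i) (C i)"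
  shows "block_upper n m d (peval N (n + m) p Z) (peval N n p A) (peval N m p C)"
proof -
  define B where "B = mat n m (\<lambda>(i, j). peval N (n + m) p Z $$ (i, j + n))"
  have "block_upper n m d (mono_eval N (n + m) e Z) (mono_eval N n e A) (mono_eval N m e C)" for e
    unfolding mono_eval_list using assms by (intro block_upper_mono_list) auto
  then obtain E where E: "\<And>e. E e \<in> carrier_mat n m"
    "\<And>e. mono_eval N (n + m) e Z = four_block_mat (mono_eval N n e A) (E e) (0\<^sub>m m n) (mono_eval N m e C)"
    "\<And>e. d \<Longrightarrow> E e = 0\<^sub>m n m"
    and c: "\<And>e. mono_eval N n e A \<in> carrier_mat n n" "\<And>e. mono_eval N m e C \<in> carrier_mat m m"
    unfolding block_upper_def by metis
  have "peval N (n + m) p Z = four_block_mat (peval N n p A) B (0\<^sub>m m n) (peval N m p C)"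
  proof (rule eq_matI)
    fix i j assume "i < dim_row (four_block_mat (peval N n p A) B (0\<^sub>m m n) (peval N m p C))"
      "j < dim_col (four_block_mat (peval N n p A) B (0\<^sub>m m n) (peval N m p C))"
    then have ij: "i < n + m" "j < n + m" by (auto simp: peval_def)
    have l0: "lin (\<lambda>e. 0) p = 0" for p :: cpoly by (simp add: lin_def)
    show "peval N (n + m) p Z $$ (i, j) = four_block_mat (peval N n p A) B (0\<^sub>m m n) (peval N m p C) $$ (i, j)"
    proof (cases "i < n \<and> j \<ge> n")
      case True
      then have "j - n < m" using ij by linarith
      then show ?thesis using ij True by (simp add: B_def carrier_matD[OF peval_carrier])
    next
      case False
      then show ?thesis using ij
        by (auto simp: peval_index E(2) carrier_matD[OF c(1)] carrier_matD[OF c(2)] carrier_matD[OF peval_carrier] l0)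
    qed
  qed (auto simp: peval_def B_def)
  moreover have "B = 0\<^sub>m n m" if d
    by (rule eq_matI) (use E(1,2) E(3)[OF that] in
      \<open>auto simp: B_def peval_index carrier_matD[OF c(1)] carrier_matD[OF c(2)] lin_def\<close>)
  moreover have "B \<in> carrier_mat n m" by (simp add: B_def)
  ultimately show ?thesis unfolding block_upper_def by auto
qed

lemma block_upperI:
  "A \<in> carrier_mat n n \<Longrightarrow> B \<in> carrier_mat n m \<Longrightarrow> C \<in> carrier_mat m m \<Longrightarrow>
    block_upper n m False (four_block_mat A B (0\<^sub>m m n) C) A C"
  "A \<in> carrier_mat n n \<Longrightarrow> C \<in> carrier_mat m m \<Longrightarrow>
    block_upper n m True (four_block_mat A (0\<^sub>m n m) (0\<^sub>m m n) C) A C"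
  unfolding block_upper_def by auto

lemma peval_block_diag:
  assumes "\<And>i. i < N \<Longrightarrow> A i \<in> carrier_mat n n" "\<And>i. i < N \<Longrightarrow> C i \<in> carrier_mat m m"
  shows "peval N (n + m) p (\<lambda>i. four_block_mat (A i) (0\<^sub>m n m) (0\<^sub>m m n) (C i)) =
    four_block_mat (peval N n p A) (0\<^sub>m n m) (0\<^sub>m m n) (peval N m p C)"
proof -
  have "block_upper n m True (peval N (n + m) p (\<lambda>i. four_block_mat (A i) (0\<^sub>m n m) (0\<^sub>m m n) (C i)))
      (peval N n p A) (peval N m p C)"
    using assms by (intro block_upper_peval block_upperI)
  then show ?thesis unfolding block_upper_def by auto
qed

lemma ctuple_block_diag:
  assumes "ctuple N n A" "ctuple N m C"
  shows "ctuple N (n + m) (\<lambda>i. four_block_mat (A i) (0\<^sub>m n m) (0\<^sub>m m n) (C i))"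
  unfolding ctuple_def
proof (intro conjI allI impI)
  fix i j assume ij: "i < N" "j < N"
  note c = ctupleD(1)[OF assms(1) ij(1)] ctupleD(1)[OF assms(1) ij(2)] ctupleD(1)[OF assms(2) ij(1)] ctupleD(1)[OF assms(2) ij(2)]
  note z = zero_carrier_mat[of n m] zero_carrier_mat[of m n]
  show "four_block_mat (A i) (0\<^sub>m n m) (0\<^sub>m m n) (C i) * four_block_mat (A j) (0\<^sub>m n m) (0\<^sub>m m n) (C j) =
      four_block_mat (A j) (0\<^sub>m n m) (0\<^sub>m m n) (C j) * four_block_mat (A i) (0\<^sub>m n m) (0\<^sub>m m n) (C i)"
    unfolding mult_four_block_mat[OF c(1) z c(3) c(2) z c(4)] mult_four_block_mat[OF c(2) z c(4) c(1) z c(3)]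
    using c ctupleD(2)[OF assms(1) ij] ctupleD(2)[OF assms(2) ij] by simp
qed (intro four_block_carrier_mat ctupleD(1)[OF assms(1)] ctupleD(1)[OF assms(2)])

lemma
  assumes S: "S \<in> carrier_mat n n" "S' \<in> carrier_mat n n" "S * S' = 1\<^sub>m n" "S' * S = 1\<^sub>m n"
    and X: "ctuple N n X"
  shows ctuple_similar: "ctuple N n (\<lambda>i. S * X i * S')"
    and peval_similar: "peval N n p (\<lambda>i. S * X i * S') = S * peval N n p X * S'"
proof -
  note D = ctupleD[OF X]
  have prod: "(S * A * S') * (S * B * S') = S * (A * B) * S'" if "A \<in> carrier_mat n n" "B \<in> carrier_mat n n" for A B
  proof -
    have "(S * A * S') * (S * B * S') = S * (A * ((S' * S) * (B * S')))"
      using S(1,2) that by (simp add: assoc_mult_mat[of _ n n _ n _ n])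
    also have "\<dots> = S * (A * B) * S'"
      unfolding S(4) using S(1,2) that by (simp add: assoc_mult_mat[of _ n n _ n _ n])
    finally show ?thesis .
  qed
  show "ctuple N n (\<lambda>i. S * X i * S')"
    unfolding ctuple_def using D S(1,2) by (simp add: prod mult_carrier_mat[of _ n n _ n])
  have c: "peval N n p X \<in> carrier_mat n n" "peval N n p (\<lambda>i. S * X i * S') \<in> carrier_mat n n" by simp_all
  have "S * peval N n p X = peval N n p (\<lambda>i. S * X i * S') * S"
  proof (rule peval_intertwine[OF S(1)])
    fix i assume i: "i < N"
    have "S * X i * S' * S = S * X i * (S' * S)"
      using S(1,2) D(1)[OF i] by (simp add: assoc_mult_mat[of _ n n _ n _ n])
    then show "S * X i = S * X i * S' * S" using S D(1)[OF i] by simp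
  qed (use D(1) S in auto)
  then have "S * peval N n p X * S' = peval N n p (\<lambda>i. S * X i * S') * (S * S')"
    using S(1,2) c by (simp add: assoc_mult_mat[of _ n n _ n _ n])
  then show "peval N n p (\<lambda>i. S * X i * S') = S * peval N n p X * S'" using S(3) c by simp
qed

text \<open>Conjugating \<open>A \<oplus> A\<close> by a shear places the commutator
  \<open>[A, T]\<close> in the corner. Since polynomials respect similarity, this computes a
  derivative without differentiating monomials.\<close>

lemma shear_conj:
  assumes T: "T \<in> carrier_mat n n" and A: "A \<in> carrier_mat n n"
  shows "four_block_mat (1\<^sub>m n) (- T) (0\<^sub>m n n) (1\<^sub>m n) * four_block_mat A (0\<^sub>m n n) (0\<^sub>m n n) A *
      four_block_mat (1\<^sub>m n) T (0\<^sub>m n n) (1\<^sub>m n) =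
    four_block_mat A (A * T + (- T) * A) (0\<^sub>m n n) (A :: complex mat)"
proof -
  note z = zero_carrier_mat[of n n] and o = one_carrier_mat[of n]
  have mT: "- T \<in> carrier_mat n n" and mTA: "(- T) * A \<in> carrier_mat n n" using T A by auto
  have "four_block_mat (1\<^sub>m n) (- T) (0\<^sub>m n n) (1\<^sub>m n) * four_block_mat A (0\<^sub>m n n) (0\<^sub>m n n) A =
      four_block_mat A ((- T) * A) (0\<^sub>m n n) A"
    unfolding mult_four_block_mat[OF o mT z o A z z A] using T A mT mTA by simp
  then show ?thesis
    using mult_four_block_mat[OF A mTA z A o T z o] A T mTA by simp
qed

lemma shear_inverse:
  assumes T: "T \<in> carrier_mat n n"
  shows "four_block_mat (1\<^sub>m n) (- T) (0\<^sub>m n n) (1\<^sub>m n) * four_block_mat (1\<^sub>m n) T (0\<^sub>m n n) (1\<^sub>m n) = (1\<^sub>m (n + n) :: complex mat)"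
    "four_block_mat (1\<^sub>m n) T (0\<^sub>m n n) (1\<^sub>m n) * four_block_mat (1\<^sub>m n) (- T) (0\<^sub>m n n) (1\<^sub>m n) = (1\<^sub>m (n + n) :: complex mat)"
proof -
  note z = zero_carrier_mat[of n n] and o = one_carrier_mat[of n]
  have mT: "- T \<in> carrier_mat n n" using T by auto
  have TT: "T + - T = 0\<^sub>m n n" by (rule eq_matI) (use T in auto)
  have m0: "- 0\<^sub>m n n = (0\<^sub>m n n :: complex mat)" by (rule eq_matI) auto
  show "four_block_mat (1\<^sub>m n) (- T) (0\<^sub>m n n) (1\<^sub>m n) * four_block_mat (1\<^sub>m n) T (0\<^sub>m n n) (1\<^sub>m n) = (1\<^sub>m (n + n) :: complex mat)"
    unfolding mult_four_block_mat[OF o mT z o o T z o] using T mT TT by simp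
  show "four_block_mat (1\<^sub>m n) T (0\<^sub>m n n) (1\<^sub>m n) * four_block_mat (1\<^sub>m n) (- T) (0\<^sub>m n n) (1\<^sub>m n) = (1\<^sub>m (n + n) :: complex mat)"
    unfolding mult_four_block_mat[OF o T z o o mT z o] using T mT TT m0 by simp
qed

text \<open>With this nilpotent \<open>T\<close> the commutator measures the difference of the two
  diagonal blocks, which links derivatives to injectivity.\<close>

lemma diag_commutator:
  assumes A: "A \<in> carrier_mat n n" and B: "B \<in> carrier_mat n n"
  defines "T \<equiv> four_block_mat (0\<^sub>m n n) (1\<^sub>m n) (0\<^sub>m n n) (0\<^sub>m n n)"
  shows "four_block_mat A (0\<^sub>m n n) (0\<^sub>m n n) B * T + (- T) * four_block_mat A (0\<^sub>m n n) (0\<^sub>m n n) B =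
    four_block_mat (0\<^sub>m n n) (A + - B) (0\<^sub>m n n) (0\<^sub>m n n :: complex mat)"
proof -
  note z = zero_carrier_mat[of n n] and o = one_carrier_mat[of n]
  have T: "- T = four_block_mat (0\<^sub>m n n) (- (1\<^sub>m n)) (0\<^sub>m n n) (0\<^sub>m n n)"
    unfolding T_def by (rule eq_matI) auto
  have mo: "- (1\<^sub>m n) \<in> carrier_mat n n" by simp
  have 1: "four_block_mat A (0\<^sub>m n n) (0\<^sub>m n n) B * T = four_block_mat (0\<^sub>m n n) A (0\<^sub>m n n) (0\<^sub>m n n)"
    unfolding T_def mult_four_block_mat[OF A z z B z o z z] using A B by simp
  have 2: "(- T) * four_block_mat A (0\<^sub>m n n) (0\<^sub>m n n) B = four_block_mat (0\<^sub>m n n) (- B) (0\<^sub>m n n) (0\<^sub>m n n)"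
    unfolding T mult_four_block_mat[OF z mo z z A z z B] using A B by (simp add: uminus_mult_left_mat)
  show ?thesis unfolding 1 2 by (rule eq_matI) (use A B in auto)
qed

lemma upper_right_four_block:
  assumes "A \<in> carrier_mat n n" "B \<in> carrier_mat n n" "D \<in> carrier_mat n n"
  shows "upper_right n (four_block_mat A B C D) = B"
  by (rule eq_matI) (use assms in \<open>auto simp: upper_right_def\<close>)

section \<open>Inverting polynomial maps\<close>

text \<open>The field generated by \<open>C\<close> over the rationals; enumerating \<open>C\<close>
  as coordinates of a point makes it a fraction field of a \<open>value_ring\<close>.\<close>

lemma exists_countable_subfield:
  assumes "finite (C :: complex set)"
  shows "\<exists>k. is_subfield k \<and> countable k \<and> C \<subseteq> k"
proof -
  obtain c :: "nat \<Rightarrow> complex" and M where c: "C = c ` {i. i < M}"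
    using finite_imp_nat_seg_image_inj_on[OF assms] by blast
  have Q: "is_subring (\<rat> :: complex set)" unfolding is_subring_def by auto
  have "countable (\<rat> :: complex set)" unfolding Rats_def by (intro countable_image countableI_type)
  then have "countable (fraction_field (value_ring \<rat> {..<M} c))"
    by (intro countable_fraction_field countable_value_ring Q) auto
  moreover have "is_subfield (fraction_field (value_ring \<rat> {..<M} c))"
    by (intro is_subfield_fraction_field is_subring_value_ring Q)
  moreover have "C \<subseteq> fraction_field (value_ring \<rat> {..<M} c)"
    using c value_ring_coord subset_fraction_field[OF is_subring_value_ring[OF Q]] by blast
  ultimately show ?thesis by blast
qed

text \<open>Both identities are stated for formal polynomials, because they will be evaluated at
  commuting matrices and not only at scalars.\<close>

lemma polynomial_inverse_exists:
  assumes P: "poly_map N P"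
    and inj: "\<And>x x'. \<forall>j<N. ev N (P j) x = ev N (P j) x' \<Longrightarrow> \<forall>j<N. x j = x' j"
  shows "\<exists>Q. poly_map N Q \<and> (\<forall>i<N. cp_subst N (Q i) P = cp_var i) \<and> (\<forall>i<N. cp_subst N (P i) Q = cp_var i)"
proof -
  have "finite (\<Union>j<N. Poly_Mapping.lookup (P j) ` Poly_Mapping.keys (P j))" by simp
  then obtain k where k: "is_subfield k" "countable k"
    "(\<Union>j<N. Poly_Mapping.lookup (P j) ` Poly_Mapping.keys (P j)) \<subseteq> k"
    using exists_countable_subfield by blast
  have p: "ev N (P j) \<in> pfun k {..<N}" if "j < N" for j
  proof (rule ev_in_pfun[OF is_subfieldD(1)[OF k(1)]])
    fix m show "Poly_Mapping.lookup (P j) m \<in> k"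
    proof (cases "m \<in> Poly_Mapping.keys (P j)")
      case True
      then show ?thesis using k(3) that by blast
    next
      case False
      then show ?thesis using is_subfieldD(2)[OF k(1)] by (simp add: in_keys_iff)
    qed
  qed
  have "\<exists>q. poly_in_vars N q \<and> (\<forall>x. ev N q (\<lambda>j. ev N (P j) x) = x i)" if i: "i < N" for i
  proof -
    have "\<exists>F\<in>pfun k {..<N}. \<forall>x. F (\<lambda>j. ev N (P j) x) = x i"
      by (rule injective_imp_polynomial_left_inverse[OF k(1,2) _ _ i]) (use p inj in blast)+
    then obtain F where F: "F \<in> pfun k {..<N}" "\<forall>x. F (\<lambda>j. ev N (P j) x) = x i" by blast
    then show ?thesis using pfun_as_ev[OF F(1)] by auto
  qed
  then obtain Q where Q: "\<And>i. i < N \<Longrightarrow> poly_in_vars N (Q i)"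
    "\<And>i x. i < N \<Longrightarrow> ev N (Q i) (\<lambda>j. ev N (P j) x) = x i" by metis
  have PN: "poly_in_vars N (P j)" if "j < N" for j using P that unfolding poly_map_def by blast
  have QP: "cp_subst N (Q i) P = cp_var i" if i: "i < N" for i
    by (rule ev_eq_imp[of N]) (use i Q PN in \<open>simp_all add: poly_in_vars_subst poly_in_vars_var ev_subst ev_var del: One_nat_def\<close>)
  \<comment> \<open>On the image of \<open>P\<close> the claim reads
    \<open>P(Q(P(x))) = P(x)\<close>, which follows from the left inverse; a polynomial function
    vanishing on the image is zero.\<close>
  have PQ_point: "ev N (P i) (\<lambda>j. ev N (Q j) y) = y i" if i: "i < N" for i y
  proof -
    have U: "is_subring (UNIV :: complex set)" by (simp add: is_subring_def)
    have e: "ev N q \<in> pfun UNIV {..<N}" for q by (rule ev_in_pfun[OF U]) simp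
    have F: "(\<lambda>y. ev N (P i) (\<lambda>j. ev N (Q j) y) - y i) \<in> pfun UNIV {..<N}"
      using i by (intro pfun_diff[OF U] pfun_compose[OF _ e] e pfun.coord) auto
    have "ev N (P i) (\<lambda>j. ev N (Q j) y) - y i = 0"
    proof (rule pfun_zero_on_image[where p = "\<lambda>j. ev N (P j)" and N = N and k = k and x = y, OF _ _ F])
      fix x
      have "ev N (P i) (\<lambda>j. ev N (Q j) (\<lambda>j. ev N (P j) x)) = ev N (P i) x"
        by (rule pfun_cong[OF e]) (simp add: Q(2))
      then show "ev N (P i) (\<lambda>j. ev N (Q j) (\<lambda>j. ev N (P j) x)) - ev N (P i) x = 0" by simp
    qed (use p inj in blast)+
    then show ?thesis by simp
  qed
  have PQ: "cp_subst N (P i) Q = cp_var i" if i: "i < N" for i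
    by (rule ev_eq_imp[of N]) (use i Q PN PQ_point in \<open>simp_all add: poly_in_vars_subst poly_in_vars_var ev_subst ev_var del: One_nat_def\<close>)
  show ?thesis using Q(1) QP PQ unfolding poly_map_def by blast
qed

text \<open>Injectivity compares tuples of different sizes; the dimension of the first coordinate of
  the value reveals the size.\<close>

lemma same_size:
  assumes "0 < N" "\<forall>j<N. pmap_eval N n P X j = pmap_eval N m P Y j" shows "n = m"
proof -
  have "dim_row (pmap_eval N n P X 0) = dim_row (pmap_eval N m P Y 0)" using assms by simp
  then show ?thesis
    by (simp only: carrier_matD(1)[OF pmap_eval_carrier])
qed

lemma injective_on_points:
  assumes inj: "\<forall>n m X Y. ctuple N n X \<longrightarrow> ctuple N m Y \<longrightarrow>
      (\<forall>j<N. pmap_eval N n P X j = pmap_eval N m P Y j) \<longrightarrow> (\<forall>i<N. X i = Y i)"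
    and eq: "\<forall>j<N. ev N (P j) x = ev N (P j) x'"
  shows "\<forall>j<N. x j = x' j"
proof -
  have "\<forall>j<N. pmap_eval N 1 P (scalar_tuple x) j = pmap_eval N 1 P (scalar_tuple x') j"
    using eq unfolding pmap_eval_def peval_scalar_tuple by simp
  then have "\<forall>j<N. scalar_tuple x j = scalar_tuple x' j" using inj ctuple_scalar_tuple by blast
  then have "\<forall>j<N. scalar_tuple x j $$ (0, 0) = scalar_tuple x' j $$ (0, 0)" by simp
  then show ?thesis unfolding scalar_tuple_def by simp
qed

text \<open>Both tuples are put into one, \<open>Z = X \<oplus> Y\<close>, of size
  \<open>n + n\<close>. The direction \<open>[Z, T]\<close> has corner \<open>X - Y\<close>, so a
  vanishing derivative in this direction forces \<open>X = Y\<close>.\<close>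

lemma derivative_nonsingular_imp_injective:
  assumes nonsing: "\<forall>n X H. ctuple N n X \<longrightarrow> (\<forall>i<N. H i \<in> carrier_mat n n) \<longrightarrow>
      ctuple N (2 * n) (block_tuple n X H) \<longrightarrow>
      (\<forall>j<N. deriv_pmap N n P X H j = 0\<^sub>m n n) \<longrightarrow> (\<forall>i<N. H i = 0\<^sub>m n n)"
    and X: "ctuple N n X" and Y: "ctuple N m Y"
    and eq: "\<forall>j<N. pmap_eval N n P X j = pmap_eval N m P Y j"
    and i: "i < N"
  shows "X i = Y i"
proof -
  have "m = n" using same_size[OF _ eq] i by simp
  then have Y: "ctuple N n Y" and eq: "\<And>j. j < N \<Longrightarrow> peval N n (P j) X = peval N n (P j) Y"
    using Y eq by (auto simp: pmap_eval_def)
  note cX = ctupleD(1)[OF X] and cY = ctupleD(1)[OF Y]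
  define Z where "Z = (\<lambda>i. four_block_mat (X i) (0\<^sub>m n n) (0\<^sub>m n n) (Y i))"
  define T where "T = four_block_mat (0\<^sub>m n n) (1\<^sub>m n) (0\<^sub>m n n) (0\<^sub>m n n :: complex mat)"
  define H where "H = (\<lambda>i. Z i * T + (- T) * Z i)"
  have Z: "ctuple N (n + n) Z" unfolding Z_def by (rule ctuple_block_diag[OF X Y])
  note cZ = ctupleD(1)[OF Z]
  have T: "T \<in> carrier_mat (n + n) (n + n)" unfolding T_def by simp
  let ?D = "\<lambda>i. four_block_mat (Z i) (0\<^sub>m (n + n) (n + n)) (0\<^sub>m (n + n) (n + n)) (Z i)"
  let ?S = "four_block_mat (1\<^sub>m (n + n)) (- T) (0\<^sub>m (n + n) (n + n)) (1\<^sub>m (n + n))"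
  let ?S' = "four_block_mat (1\<^sub>m (n + n)) T (0\<^sub>m (n + n) (n + n)) (1\<^sub>m (n + n))"
  have S: "?S \<in> carrier_mat (n + n + (n + n)) (n + n + (n + n))" "?S' \<in> carrier_mat (n + n + (n + n)) (n + n + (n + n))"
    by (rule four_block_carrier_mat; simp)+
  note SS = S shear_inverse[OF T]
  have D: "ctuple N (n + n + (n + n)) ?D" by (rule ctuple_block_diag[OF Z Z])
  \<comment> \<open>The direction \<open>H = [Z, T]\<close> makes the block tuple similar to \<open>Z \<oplus> Z\<close>, so that the derivative there
    is \<open>[P(Z), T]\<close>, with upper right block \<open>P(X) - P(Y)\<close>.\<close>
  have W: "block_tuple (n + n) Z H i = ?S * ?D i * ?S'" if "i < N" for i
    unfolding block_tuple_def H_def by (rule shear_conj[OF T cZ[OF that], symmetric])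
  have "ctuple N (n + n + (n + n)) (\<lambda>i. ?S * ?D i * ?S')" by (rule ctuple_similar[OF SS D])
  then have cW: "ctuple N (2 * (n + n)) (block_tuple (n + n) Z H)"
    using W unfolding ctuple_def by (simp add: mult_2)
  have cH: "H i \<in> carrier_mat (n + n) (n + n)" if "i < N" for i unfolding H_def using cZ[OF that] T by auto
  have "deriv_pmap N (n + n) P Z H j = 0\<^sub>m (n + n) (n + n)" if j: "j < N" for j
  proof -
    let ?PZ = "peval N (n + n) (P j) Z"
    have PZ: "?PZ = four_block_mat (peval N n (P j) X) (0\<^sub>m n n) (0\<^sub>m n n) (peval N n (P j) Y)"
      unfolding Z_def by (rule peval_block_diag[OF cX cY])
    have "peval N (2 * (n + n)) (P j) (block_tuple (n + n) Z H) = peval N (n + n + (n + n)) (P j) (\<lambda>i. ?S * ?D i * ?S')"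
      using peval_cong[of N "block_tuple (n + n) Z H" "\<lambda>i. ?S * ?D i * ?S'"] W by (simp add: mult_2)
    also have "\<dots> = ?S * peval N (n + n + (n + n)) (P j) ?D * ?S'" by (rule peval_similar[OF SS D])
    also have "\<dots> = ?S * four_block_mat ?PZ (0\<^sub>m (n + n) (n + n)) (0\<^sub>m (n + n) (n + n)) ?PZ * ?S'"
      by (subst peval_block_diag[OF cZ cZ]) auto
    also have "\<dots> = four_block_mat ?PZ (?PZ * T + (- T) * ?PZ) (0\<^sub>m (n + n) (n + n)) ?PZ"
      by (rule shear_conj[OF T peval_carrier])
    also have "?PZ * T + (- T) * ?PZ = four_block_mat (0\<^sub>m n n) (peval N n (P j) X + - peval N n (P j) Y) (0\<^sub>m n n) (0\<^sub>m n n)"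
      unfolding PZ T_def by (rule diag_commutator[OF peval_carrier peval_carrier])
    also have "peval N n (P j) X + - peval N n (P j) Y = 0\<^sub>m n n"
      unfolding eq[OF j] by (rule eq_matI) (auto simp: carrier_matD[OF peval_carrier])
    also have "four_block_mat (0\<^sub>m n n) (0\<^sub>m n n) (0\<^sub>m n n) (0\<^sub>m n n) = (0\<^sub>m (n + n) (n + n) :: complex mat)"
      by (rule eq_matI) auto
    finally show ?thesis using j unfolding deriv_pmap_def pmap_eval_def
      by (simp add: upper_right_four_block[OF peval_carrier zero_carrier_mat peval_carrier])
  qed
  then have "H i = 0\<^sub>m (n + n) (n + n)" using nonsing Z cH cW i by blast
  moreover have "H i = four_block_mat (0\<^sub>m n n) (X i + - Y i) (0\<^sub>m n n) (0\<^sub>m n n)"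
    unfolding H_def Z_def T_def by (rule diag_commutator[OF cX[OF i] cY[OF i]])
  moreover have "(0\<^sub>m (n + n) (n + n) :: complex mat) = four_block_mat (0\<^sub>m n n) (0\<^sub>m n n) (0\<^sub>m n n) (0\<^sub>m n n)"
    by (rule eq_matI) auto
  ultimately have "four_block_mat (0\<^sub>m n n) (X i + - Y i) (0\<^sub>m n n) (0\<^sub>m n n) =
      four_block_mat (0\<^sub>m n n) (0\<^sub>m n n) (0\<^sub>m n n) (0\<^sub>m n n)" by (simp only:)
  moreover have "X i + - Y i \<in> carrier_mat n n" using cX[OF i] cY[OF i] by simp
  ultimately have XY: "X i + - Y i = 0\<^sub>m n n"
    using four_block_mat_eq_iff[OF zero_carrier_mat _ zero_carrier_mat zero_carrier_mat zero_carrier_mat zero_carrier_mat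
      zero_carrier_mat zero_carrier_mat, of "X i + - Y i" n n] by (simp only:)
  show ?thesis
  proof (rule eq_matI)
    fix a b assume ab: "a < dim_row (Y i)" "b < dim_col (Y i)"
    have "(X i + - Y i) $$ (a, b) = 0" using XY ab cY[OF i] by simp
    then show "X i $$ (a, b) = Y i $$ (a, b)" using ab cX[OF i] cY[OF i] by simp
  qed (use cX[OF i] cY[OF i] in auto)
qed

text \<open>A zero derivative means that \<open>P\<close> takes the same value at the block tuple
  with corner \<open>H\<close> and at \<open>X \<oplus> X\<close>.\<close>

lemma injective_imp_derivative_nonsingular:
  assumes inj: "\<forall>n m X Y. ctuple N n X \<longrightarrow> ctuple N m Y \<longrightarrow>
      (\<forall>j<N. pmap_eval N n P X j = pmap_eval N m P Y j) \<longrightarrow> (\<forall>i<N. X i = Y i)"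
    and X: "ctuple N n X" and H: "\<forall>i<N. H i \<in> carrier_mat n n"
    and Z: "ctuple N (2 * n) (block_tuple n X H)"
    and D: "\<forall>j<N. deriv_pmap N n P X H j = 0\<^sub>m n n" and i: "i < N"
  shows "H i = 0\<^sub>m n n"
proof -
  note cX = ctupleD(1)[OF X]
  let ?W = "\<lambda>i. four_block_mat (X i) (0\<^sub>m n n) (0\<^sub>m n n) (X i)"
  have W: "ctuple N (2 * n) ?W" using ctuple_block_diag[OF X X] by (simp add: mult_2)
  have "pmap_eval N (2 * n) P (block_tuple n X H) j = pmap_eval N (2 * n) P ?W j" if j: "j < N" for j
  proof -
    have "block_upper n n False (peval N (n + n) (P j) (block_tuple n X H)) (peval N n (P j) X) (peval N n (P j) X)"
      unfolding block_tuple_def using cX H by (intro block_upper_peval block_upperI(1)) auto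
    then obtain B where B: "B \<in> carrier_mat n n"
      "peval N (n + n) (P j) (block_tuple n X H) = four_block_mat (peval N n (P j) X) B (0\<^sub>m n n) (peval N n (P j) X)"
      unfolding block_upper_def by blast
    have "upper_right n (pmap_eval N (2 * n) P (block_tuple n X H) j) = 0\<^sub>m n n"
      using D j unfolding deriv_pmap_def by blast
    then have "upper_right n (peval N (n + n) (P j) (block_tuple n X H)) = 0\<^sub>m n n"
      using j by (simp add: pmap_eval_def mult_2)
    then have "B = 0\<^sub>m n n" unfolding B(2) upper_right_four_block[OF peval_carrier B(1) peval_carrier] .
    then have "peval N (n + n) (P j) (block_tuple n X H) = peval N (n + n) (P j) ?W"
      using B(2) peval_block_diag[where N = N and p = "P j" and A = X and C = X and n = n and m = n] cX by simp
    then show ?thesis using j by (simp add: pmap_eval_def mult_2)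
  qed
  then have "block_tuple n X H i = ?W i" using inj Z W i by blast
  moreover have "H i \<in> carrier_mat n n" using H i by blast
  ultimately show ?thesis
    unfolding block_tuple_def using four_block_mat_eq_iff[OF cX[OF i] _ zero_carrier_mat cX[OF i] cX[OF i] zero_carrier_mat
      zero_carrier_mat cX[OF i], of "H i"] by (simp only:)
qed

theorem mainTheorem4:
  fixes N :: nat and P :: "nat \<Rightarrow> cpoly"
  assumes "poly_map N P"
  defines "cond1 \<equiv> (\<forall>n X H. ctuple N n X \<longrightarrow> (\<forall>i<N. H i \<in> carrier_mat n n) \<longrightarrow>
              ctuple N (2 * n) (block_tuple n X H) \<longrightarrow>
              (\<forall>j<N. deriv_pmap N n P X H j = 0\<^sub>m n n) \<longrightarrow> (\<forall>i<N. H i = 0\<^sub>m n n))"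
      and "cond2 \<equiv> (\<forall>n m X Y. ctuple N n X \<longrightarrow> ctuple N m Y \<longrightarrow>
              (\<forall>j<N. pmap_eval N n P X j = pmap_eval N m P Y j) \<longrightarrow> (\<forall>i<N. X i = Y i))"
      and "cond3 \<equiv> (\<forall>n m X Y. ctuple N n X \<longrightarrow> ctuple N m Y \<longrightarrow>
              (\<forall>j<N. pmap_eval N n P X j = pmap_eval N m P Y j) \<longrightarrow> (\<forall>i<N. X i = Y i))
            \<and> (\<forall>m Y. ctuple N m Y \<longrightarrow>
              (\<exists>n X. ctuple N n X \<and> (\<forall>j<N. pmap_eval N n P X j = Y j)))"
      and "cond4 \<equiv> (\<exists>Q. poly_map N Q \<and>
              (\<forall>n X. ctuple N n X \<longrightarrow>
                 (\<forall>i<N. pmap_eval N n Q (pmap_eval N n P X) i = X i) \<and>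
                 (\<forall>i<N. pmap_eval N n P (pmap_eval N n Q X) i = X i)))"
  shows "(cond1 \<longleftrightarrow> cond2) \<and> (cond2 \<longleftrightarrow> cond3) \<and> (cond3 \<longleftrightarrow> cond4)"
proof -
  have 12: "cond2" if cond1
    unfolding cond2_def
  proof (intro allI impI)
    fix n m X Y i
    assume "ctuple N n X" "ctuple N m Y" "\<forall>j<N. pmap_eval N n P X j = pmap_eval N m P Y j" "i < N"
    then show "X i = Y i" by (rule derivative_nonsingular_imp_injective[OF that[unfolded cond1_def]])
  qed
  have 21: "cond1" if cond2
    unfolding cond1_def
  proof (intro allI impI)
    fix n X H i
    assume "ctuple N n X" "\<forall>i<N. H i \<in> carrier_mat n n" "ctuple N (2 * n) (block_tuple n X H)"
      "\<forall>j<N. deriv_pmap N n P X H j = 0\<^sub>m n n" "i < N"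
    then show "H i = 0\<^sub>m n n" by (rule injective_imp_derivative_nonsingular[OF that[unfolded cond2_def]])
  qed
  have 24: "cond4" if cond2
  proof -
    have "\<exists>Q. poly_map N Q \<and> (\<forall>i<N. cp_subst N (Q i) P = cp_var i) \<and> (\<forall>i<N. cp_subst N (P i) Q = cp_var i)"
      by (rule polynomial_inverse_exists[OF assms(1)]) (rule injective_on_points[OF that[unfolded cond2_def]])
    then obtain Q where Q: "poly_map N Q" "\<forall>i<N. cp_subst N (Q i) P = cp_var i" "\<forall>i<N. cp_subst N (P i) Q = cp_var i"
      by blast
    \<comment> \<open>The formal identities come from scalar points alone, yet hold at commuting
      tuples of every size by \<open>peval_subst\<close>.\<close>
    have "pmap_eval N n Q (pmap_eval N n P X) i = X i \<and> pmap_eval N n P (pmap_eval N n Q X) i = X i"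
      if X: "ctuple N n X" and i: "i < N" for n X i
      using peval_subst[OF X, of "Q i" P] peval_subst[OF X, of "P i" Q] peval_var[OF ctupleD(1)[OF X] i] Q(2,3) i
      by (simp add: pmap_eval_def)
    then show ?thesis unfolding cond4_def using Q(1) by blast
  qed
  have 43: "cond3" if c4: cond4
  proof -
    obtain Q where QQ: "\<forall>n X. ctuple N n X \<longrightarrow>
        (\<forall>i<N. pmap_eval N n Q (pmap_eval N n P X) i = X i) \<and>
        (\<forall>i<N. pmap_eval N n P (pmap_eval N n Q X) i = X i)"
      using c4 unfolding cond4_def by blast
    have Q: "pmap_eval N n Q (pmap_eval N n P X) i = X i" "pmap_eval N n P (pmap_eval N n Q X) i = X i"
      if "ctuple N n X" "i < N" for n X i
      using QQ[rule_format, OF that(1)] that(2) by simp_all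
    have "X i = Y i" if X: "ctuple N n X" and Y: "ctuple N m Y" and
      eq: "\<forall>j<N. pmap_eval N n P X j = pmap_eval N m P Y j" and i: "i < N" for n m X Y i
    proof -
      have "n = m" by (rule same_size[OF _ eq]) (use i in simp)
      then have "pmap_eval N n Q (pmap_eval N n P X) i = pmap_eval N m Q (pmap_eval N m P Y) i"
        using peval_cong[of N "pmap_eval N n P X" "pmap_eval N m P Y" n "Q i"] eq i by (simp add: pmap_eval_def)
      then show ?thesis using Q(1)[OF X i] Q(1)[OF Y i] by simp
    qed
    \<comment> \<open>The preimage of \<open>Y\<close> is \<open>Q(Y)\<close>, a commuting tuple of
      the same size.\<close>
    then show ?thesis unfolding cond3_def using Q(2) ctuple_pmap_eval by blast
  qed
  have 32: "cond2" if cond3 using that unfolding cond2_def cond3_def by blast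
  show ?thesis using 12 21 24 43 32 by blast
qed

end
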